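(* Let $d\ge2$ and let $\theta$ be a real antisymmetric $d\times d$ matrix. Let $\alpha,\beta \in \mathbb{R}$, and let $x \in \mathcal{A}(\mathbb{R}^d_\theta)$. If $\alpha< \beta+1$, then $$[J_\theta^{\alpha}, x]J^{-\beta}_\theta \in \mathcal{L}_{\frac{d}{\beta-\alpha+1},\infty}.$$ On the other hand, if $\alpha = \beta+1$, then the operator $[J^{\alpha}_\theta, x]J_\theta^{-\beta}$ has bounded extension.
   Context: For $t\in\mathbb{R}^d$ let $U(t)$ be the unitary on $L_2(\mathbb{R}^d)$ given by $(U(t)\xi)(r)=e^{-\frac{i}{2}(t,\theta r)}\xi(r-t)$, and for $f\in\mathcal{S}(\mathbb{R}^d)$ (Schwartz space) let $U(f)=\int_{\mathbb{R}^d} f(t)U(t)\,dt$ (strong Bochner integral). $\mathcal{S}(\mathbb{R}^d_\theta)=\{U(f): f\in\mathcal{S}(\mathbb{R}^d)\}$. $\mathcal{A}(\mathbb{R}^d_\theta)$ is the following dense $*$-subalgebra of $\mathcal{S}(\mathbb{R}^d_\theta)$. After an orthogonal change of variables one may write $\theta=\begin{pmatrix}0&0\\0&\theta'\end{pmatrix}$ with $\det(\theta')\ne0$ and $d_1=\dim\ker\theta$; in these coordinates $\mathcal{A}(\mathbb{R}^d_\theta)$ is the set of finite linear combinations of operators $U(f\otimes g)$ with $f\in\mathcal{S}(\mathbb{R}^{d_1})$, $g\in\mathcal{S}(\mathbb{R}^{d-d_1})$, where $(f\otimes g)(t)=f(t_1,\dots,t_{d_1})g(t_{d_1+1},\dots,t_d)$.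 (If $\theta=0$ or $\det(\theta)\neq 0$, it is all of $\mathcal{S}(\mathbb{R}^d_\theta)$.) Elements of $\mathcal{A}(\mathbb{R}^d_\theta)$ are bounded operators on $L_2(\mathbb{R}^d)$. For $\alpha\in\mathbb{R}$, $J_\theta^\alpha$ is the operator on $L_2(\mathbb{R}^d)$ of multiplication by $t\mapsto(1+|t|^2)^{\alpha/2}$ (so $J_\theta=(1-\Delta_\theta)^{1/2}$). The operators in the statement are defined on $\mathcal{S}(\mathbb{R}^d)$, which is mapped into itself by $x$ and by each $J_\theta^\alpha$; membership in an ideal means that the operator extends to an element of the ideal of $\mathcal{B}(L_2(\mathbb{R}^d))$. For a compact operator $T$, $\mu(k,T)=\inf\{\|T-R\|:\mathrm{rank}(R)\le k\}$; for $0<p<\infty$, $\mathcal{L}_{p,\infty}$ is the ideal of compact $T$ with $\sup_{k\ge0}(k+1)^{1/p}\mu(k,T)<\infty$. *)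

theory Defs
  imports "HOL-Analysis.Analysis"
begin

definition square_integrable :: "('a::euclidean_space \<Rightarrow> complex) \<Rightarrow> bool" where
  "square_integrable f \<longleftrightarrow>
     f \<in> borel_measurable lborel \<and> integrable lborel (\<lambda>x. (norm (f x))\<^sup>2)"

lemma square_integrable_measurable [dest]:
  "square_integrable f \<Longrightarrow> f \<in> borel_measurable borel"
  by (simp add: square_integrable_def)

lemma square_integrable_0 [simp]: "square_integrable (\<lambda>x. 0)"
  by (simp add: square_integrable_def)

lemma square_integrable_bound:
  assumes "g \<in> borel_measurable borel" "integrable lborel w"
    "AE x in lborel. (norm (g x))\<^sup>2 \<le> w x"
  shows "square_integrable g"
  unfolding square_integrable_def
proof
  show "integrable lborel (\<lambda>x. (norm (g x))\<^sup>2)"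
    by (rule Bochner_Integration.integrable_bound[OF assms(2)]) (use assms in auto)
qed (use assms in simp)

lemma square_integrable_cmult:
  assumes "square_integrable f"
  shows "square_integrable (\<lambda>x. c * f x)"
  using assms by (auto simp: square_integrable_def norm_mult power_mult_distrib)

lemma add_power2_le: "(a + b)\<^sup>2 \<le> 2 * (a\<^sup>2 + b\<^sup>2)" for a b :: real
  using zero_le_power2[of "a - b"] by (simp add: power2_eq_square algebra_simps)

lemma norm_add_power2_le: "(norm (a + b :: complex))\<^sup>2 \<le> 2 * ((norm a)\<^sup>2 + (norm b)\<^sup>2)"
proof -
  have "(norm (a + b))\<^sup>2 \<le> (norm a + norm b)\<^sup>2"
    by (simp add: norm_triangle_ineq power_mono)
  also have "\<dots> \<le> 2 * ((norm a)\<^sup>2 + (norm b)\<^sup>2)"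
    by (rule add_power2_le)
  finally show ?thesis .
qed

lemma square_integrable_add:
  assumes "square_integrable f" "square_integrable g"
  shows "square_integrable (\<lambda>x. f x + g x)"
  by (rule square_integrable_bound[where w = "\<lambda>x. 2 * ((norm (f x))\<^sup>2 + (norm (g x))\<^sup>2)"])
     (use assms norm_add_power2_le in \<open>auto simp: square_integrable_def\<close>)

lemma square_integrable_diff:
  assumes "square_integrable f" "square_integrable g"
  shows "square_integrable (\<lambda>x. f x - g x)"
  using square_integrable_add[OF assms(1) square_integrable_cmult[OF assms(2), of "-1"]] by simp

lemma integrable_inner_square_integrable:
  assumes "square_integrable f" "square_integrable g"
  shows "integrable lborel (\<lambda>x. f x \<bullet> g x)"
proof (rule Bochner_Integration.integrable_bound)
  show "integrable lborel (\<lambda>x. (norm (f x))\<^sup>2 + (norm (g x))\<^sup>2)"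
    using assms by (auto simp: square_integrable_def)
  show "(\<lambda>x. f x \<bullet> g x) \<in> borel_measurable lborel"
    using assms by (auto simp: square_integrable_def)
  have "\<bar>f x \<bullet> g x\<bar> \<le> (norm (f x))\<^sup>2 + (norm (g x))\<^sup>2" for x
  proof -
    have "\<bar>f x \<bullet> g x\<bar> \<le> norm (f x) * norm (g x)"
      by (rule Cauchy_Schwarz_ineq2)
    also have "2 * (norm (f x) * norm (g x)) \<le> (norm (f x))\<^sup>2 + (norm (g x))\<^sup>2"
      using zero_le_power2[of "norm (f x) - norm (g x)"]
      by (simp add: power2_eq_square algebra_simps)
    then have "norm (f x) * norm (g x) \<le> (norm (f x))\<^sup>2 + (norm (g x))\<^sup>2"
      using mult_nonneg_nonneg[OF norm_ge_zero[of "f x"] norm_ge_zero[of "g x"]] by linarith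
    finally show ?thesis .
  qed
  then show "AE x in lborel. norm (f x \<bullet> g x) \<le> norm ((norm (f x))\<^sup>2 + (norm (g x))\<^sup>2)"
    by (auto intro!: AE_I2)
qed

definition l2_rel :: "('a::euclidean_space \<Rightarrow> complex) \<Rightarrow> ('a \<Rightarrow> complex) \<Rightarrow> bool" where
  "l2_rel f g \<longleftrightarrow> square_integrable f \<and> square_integrable g \<and> (AE x in lborel. f x = g x)"

quotient_type (overloaded) 'a l2 = "'a::euclidean_space \<Rightarrow> complex" / partial: l2_rel
proof (rule part_equivpI)
  show "\<exists>x. l2_rel x x" by (rule exI[of _ "\<lambda>x. 0"]) (simp add: l2_rel_def)
  show "symp l2_rel" by (auto simp: l2_rel_def symp_def)
  show "transp l2_rel" by (auto simp: l2_rel_def transp_def)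
qed

instantiation l2 :: (euclidean_space) real_vector
begin

lift_definition zero_l2 :: "'a l2" is "\<lambda>x. 0"
  by (simp add: l2_rel_def)

lift_definition plus_l2 :: "'a l2 \<Rightarrow> 'a l2 \<Rightarrow> 'a l2" is "\<lambda>f g x. f x + g x"
  by (auto simp: l2_rel_def square_integrable_add)

lift_definition minus_l2 :: "'a l2 \<Rightarrow> 'a l2 \<Rightarrow> 'a l2" is "\<lambda>f g x. f x - g x"
  by (auto simp: l2_rel_def square_integrable_diff)

lift_definition uminus_l2 :: "'a l2 \<Rightarrow> 'a l2" is "\<lambda>f x. - f x"
  using square_integrable_cmult[of _ "-1"] by (auto simp: l2_rel_def)

lift_definition scaleR_l2 :: "real \<Rightarrow> 'a l2 \<Rightarrow> 'a l2" is "\<lambda>r f x. r *\<^sub>R f x"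
  using square_integrable_cmult[of _ "complex_of_real r" for r]
  by (auto simp: l2_rel_def scaleR_conv_of_real)

instance
proof
  fix x y z :: "'a l2" and a b :: real
  show "x + y + z = x + (y + z)"
    by transfer (auto simp: l2_rel_def add.assoc intro!: square_integrable_add)
  show "x + y = y + x"
    by transfer (auto simp: l2_rel_def add.commute intro!: square_integrable_add)
  show "0 + x = x"
    by transfer (auto simp: l2_rel_def)
  show "- x + x = 0"
    by transfer (auto simp: l2_rel_def)
  show "x - y = x + - y"
    by transfer (auto simp: l2_rel_def intro!: square_integrable_diff)
  have sc: "square_integrable (\<lambda>x. r *\<^sub>R f x)" if "square_integrable f" for f :: "'a \<Rightarrow> complex" and r
    using square_integrable_cmult[OF that, of "of_real r"] by (simp add: scaleR_conv_of_real)
  show "a *\<^sub>R (x + y) = a *\<^sub>R x + a *\<^sub>R y"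
    by transfer (auto simp: l2_rel_def scaleR_add_right intro!: square_integrable_add sc)
  show "(a + b) *\<^sub>R x = a *\<^sub>R x + b *\<^sub>R x"
    by transfer (auto simp: l2_rel_def scaleR_add_left intro!: square_integrable_add sc)
  show "a *\<^sub>R b *\<^sub>R x = (a * b) *\<^sub>R x"
    by transfer (auto simp: l2_rel_def algebra_simps intro!: sc)
  show "1 *\<^sub>R x = x"
    by transfer (auto simp: l2_rel_def)
qed

end

instantiation l2 :: (euclidean_space) real_inner
begin

text \<open>The real part of the usual complex inner product; it induces the usual norm.\<close>

lift_definition inner_l2 :: "'a l2 \<Rightarrow> 'a l2 \<Rightarrow> real" is "\<lambda>f g. \<integral>x. f x \<bullet> g x \<partial>lborel"
proof -
  fix f1 f2 g1 g2 :: "'a \<Rightarrow> complex"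
  assume *: "l2_rel f1 f2" "l2_rel g1 g2"
  show "(\<integral>x. f1 x \<bullet> g1 x \<partial>lborel) = (\<integral>x. f2 x \<bullet> g2 x \<partial>lborel)"
  proof (rule integral_cong_AE)
    show "AE x in lborel. f1 x \<bullet> g1 x = f2 x \<bullet> g2 x"
      using * by (auto simp: l2_rel_def)
  qed (use * in \<open>auto simp: l2_rel_def square_integrable_def\<close>)
qed

definition norm_l2 :: "'a l2 \<Rightarrow> real" where "norm_l2 x = sqrt (x \<bullet> x)"
definition dist_l2 :: "'a l2 \<Rightarrow> 'a l2 \<Rightarrow> real" where "dist_l2 x y = norm (x - y)"
definition sgn_l2 :: "'a l2 \<Rightarrow> 'a l2" where "sgn_l2 x = x /\<^sub>R norm x"
definition uniformity_l2 :: "('a l2 \<times> 'a l2) filter" where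
  "uniformity_l2 = (INF e\<in>{0 <..}. principal {(x, y). dist x y < e})"
definition open_l2 :: "'a l2 set \<Rightarrow> bool" where
  "open_l2 U = (\<forall>x\<in>U. eventually (\<lambda>(x', y). x' = x \<longrightarrow> y \<in> U) uniformity)"

instance
proof
  fix x y z :: "'a l2" and r :: real
  show "dist x y = norm (x - y)" by (rule dist_l2_def)
  show "sgn x = x /\<^sub>R norm x" by (rule sgn_l2_def)
  show "(uniformity :: ('a l2 \<times> 'a l2) filter) = (INF e\<in>{0 <..}. principal {(x, y). dist x y < e})"
    by (rule uniformity_l2_def)
  show "open U = (\<forall>x\<in>U. eventually (\<lambda>(x', y). x' = x \<longrightarrow> y \<in> U) uniformity)" for U :: "'a l2 set"
    by (rule open_l2_def)
  show "x \<bullet> y = y \<bullet> x"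
    by transfer (simp add: inner_commute)
  show "(x + y) \<bullet> z = x \<bullet> z + y \<bullet> z"
    by transfer (simp add: l2_rel_def inner_add_left integrable_inner_square_integrable)
  show "r *\<^sub>R x \<bullet> y = r * (x \<bullet> y)"
    by transfer simp
  show "0 \<le> x \<bullet> x"
    by transfer simp
  show "x \<bullet> x = 0 \<longleftrightarrow> x = 0"
  proof transfer
    fix f :: "'a \<Rightarrow> complex" assume "l2_rel f f"
    then have f: "square_integrable f" by (simp add: l2_rel_def)
    have "(\<integral>x. f x \<bullet> f x \<partial>lborel) = 0 \<longleftrightarrow> (AE x in lborel. f x \<bullet> f x = 0)"
      by (rule integral_nonneg_eq_0_iff_AE) (simp_all add: integrable_inner_square_integrable f)
    then show "(\<integral>x. f x \<bullet> f x \<partial>lborel) = 0 \<longleftrightarrow> l2_rel f (\<lambda>x. 0)"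
      using f by (simp add: l2_rel_def)
  qed
  show "norm x = sqrt (x \<bullet> x)" by (rule norm_l2_def)
qed

end

lift_definition l2_class :: "('a::euclidean_space \<Rightarrow> complex) \<Rightarrow> 'a l2"
  is "\<lambda>f. if square_integrable f then f else (\<lambda>x. 0)"
  by (simp add: l2_rel_def)

lemma l2_class_cases:
  obtains f where "square_integrable f" "x = l2_class f"
proof -
  have "\<exists>f. square_integrable f \<and> x = l2_class f"
    by transfer (auto simp: l2_rel_def)
  then show ?thesis using that by blast
qed

lemma l2_class_add:
  "square_integrable f \<Longrightarrow> square_integrable g \<Longrightarrow>
    l2_class (\<lambda>x. f x + g x) = l2_class f + l2_class g"
  by transfer (auto simp: l2_rel_def square_integrable_add)

lemma l2_class_diff:
  "square_integrable f \<Longrightarrow> square_integrable g \<Longrightarrow>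
    l2_class (\<lambda>x. f x - g x) = l2_class f - l2_class g"
  by transfer (auto simp: l2_rel_def square_integrable_diff)

lemma l2_class_scaleR:
  "square_integrable f \<Longrightarrow> l2_class (\<lambda>x. r *\<^sub>R f x) = r *\<^sub>R l2_class f"
  using square_integrable_cmult[of f "of_real r"]
  by transfer (auto simp: l2_rel_def scaleR_conv_of_real)

lemma l2_class_0: "l2_class (\<lambda>x. 0) = 0"
  by transfer (auto simp: l2_rel_def)

lemma l2_class_cong_AE:
  "square_integrable f \<Longrightarrow> square_integrable g \<Longrightarrow> AE x in lborel. f x = g x \<Longrightarrow>
    l2_class f = l2_class g"
  by transfer (auto simp: l2_rel_def)

lemma norm_l2_class:
  "square_integrable f \<Longrightarrow> norm (l2_class f) = sqrt (\<integral>x. (norm (f x))\<^sup>2 \<partial>lborel)"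
proof -
  assume "square_integrable f"
  then have "l2_class f \<bullet> l2_class f = (\<integral>x. (norm (f x))\<^sup>2 \<partial>lborel)"
    by transfer (simp add: power2_norm_eq_inner)
  then show ?thesis by (simp add: norm_l2_def)
qed

lemma square_integrable_sum:
  "(\<And>i. i \<in> I \<Longrightarrow> square_integrable (f i)) \<Longrightarrow> square_integrable (\<lambda>x. \<Sum>i\<in>I. f i x)"
  by (induction I rule: infinite_finite_induct) (auto intro: square_integrable_add)

lemma l2_class_sum:
  "(\<And>i. i \<in> I \<Longrightarrow> square_integrable (f i)) \<Longrightarrow>
    l2_class (\<lambda>x. \<Sum>i\<in>I. f i x) = (\<Sum>i\<in>I. l2_class (f i))"
  by (induction I rule: infinite_finite_induct)
     (auto simp: l2_class_0 l2_class_add square_integrable_sum)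

lemma l2_class_dominated_convergence:
  fixes g :: "nat \<Rightarrow> 'a::euclidean_space \<Rightarrow> complex" and w :: "'a \<Rightarrow> real"
  assumes f: "f \<in> borel_measurable borel" and g: "\<And>i. g i \<in> borel_measurable borel"
    and w: "integrable lborel (\<lambda>x. (w x)\<^sup>2)"
    and lim: "AE x in lborel. (\<lambda>i. g i x) \<longlonglongrightarrow> f x"
    and bound: "\<And>i. AE x in lborel. norm (g i x) \<le> w x"
  shows "square_integrable f" "\<And>i. square_integrable (g i)"
    and "(\<lambda>i. l2_class (g i)) \<longlonglongrightarrow> l2_class f"
proof -
  have bf: "AE x in lborel. norm (f x) \<le> w x"
  proof -
    have "AE x in lborel. \<forall>i. norm (g i x) \<le> w x"
      using bound by (simp add: AE_all_countable)
    with lim show ?thesis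
    proof eventually_elim
      case (elim x)
      then show ?case
        by (intro LIMSEQ_le_const2[OF tendsto_norm[OF elim(1)]]) auto
    qed
  qed
  show sf: "square_integrable f"
    by (rule square_integrable_bound[OF f w]) (use bf in \<open>auto elim!: eventually_mono intro!: power_mono\<close>)
  show sg: "square_integrable (g i)" for i
    by (rule square_integrable_bound[OF g w])
       (use bound[of i] in \<open>auto elim!: eventually_mono intro!: power_mono\<close>)
  have sd: "square_integrable (\<lambda>x. g i x - f x)" for i
    by (rule square_integrable_diff[OF sg sf])
  have "(\<lambda>i. \<integral>x. (norm (g i x - f x))\<^sup>2 \<partial>lborel) \<longlonglongrightarrow> integral\<^sup>L lborel (\<lambda>x::'a. 0)"
  proof (rule integral_dominated_convergence[where w = "\<lambda>x. 4 * (w x)\<^sup>2"])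
    show "AE x in lborel. (\<lambda>i. (norm (g i x - f x))\<^sup>2) \<longlonglongrightarrow> 0"
      using lim
    proof eventually_elim
      case (elim x)
      have "(\<lambda>i. (norm (g i x - f x))\<^sup>2) \<longlonglongrightarrow> (norm (f x - f x))\<^sup>2"
        by (intro tendsto_intros elim)
      then show ?case by simp
    qed
    show "AE x in lborel. norm ((norm (g i x - f x))\<^sup>2) \<le> 4 * (w x)\<^sup>2" for i
      using bound[of i] bf
    proof eventually_elim
      case (elim x)
      have "norm (g i x - f x) \<le> 2 * w x"
        using elim norm_triangle_ineq4[of "g i x" "f x"] by linarith
      then have "(norm (g i x - f x))\<^sup>2 \<le> (2 * w x)\<^sup>2"
        by (rule power_mono) simp
      then show ?case by (simp add: power_mult_distrib)
    qed
  qed (use w f g in auto)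
  then have "(\<lambda>i. norm (l2_class (g i) - l2_class f)) \<longlonglongrightarrow> 0"
    using tendsto_real_sqrt[of _ 0]
    by (force simp: norm_l2_class[OF sd] l2_class_diff[OF sg sf, symmetric])
  then show "(\<lambda>i. l2_class (g i)) \<longlonglongrightarrow> l2_class f"
    by (simp add: tendsto_norm_zero_iff LIM_zero_cancel)
qed


instance l2 :: (euclidean_space) banach
proof
  fix X :: "nat \<Rightarrow> 'a l2"
  assume X: "Cauchy X"
  have "\<exists>r. strict_mono r \<and> (\<forall>n. norm (X (r (Suc n)) - X (r n)) \<le> (1/2)^n)"
  proof -
    have "\<exists>N. \<forall>m\<ge>N. \<forall>n\<ge>N. norm (X m - X n) < (1/2)^k" for k :: nat
      using X by (force simp: Cauchy_iff)
    then obtain N where N: "\<And>k m n. m \<ge> N k \<Longrightarrow> n \<ge> N k \<Longrightarrow> norm (X m - X n) < (1/2)^k"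
      by metis
    define r where "r = rec_nat (N 0) (\<lambda>k a. max (Suc a) (N (Suc k)))"
    have r: "r 0 = N 0" "r (Suc k) = max (Suc (r k)) (N (Suc k))" for k
      by (simp_all add: r_def)
    have rN: "r k \<ge> N k" for k
      by (cases k) (simp_all add: r)
    have mono: "strict_mono r"
      by (rule strict_monoI_Suc) (simp add: r)
    have "norm (X (r (Suc n)) - X (r n)) \<le> (1/2)^n" for n
      using N[where k = n and m = "r (Suc n)" and n = "r n"] rN[of n] strict_mono_less[OF mono, of n "Suc n"]
      by (auto intro: less_imp_le)
    with mono show ?thesis by blast
  qed
  then obtain r where r: "strict_mono r"
    and r_le: "\<And>n. norm (X (r (Suc n)) - X (r n)) \<le> (1/2)^n" by blast
  have "\<exists>f. square_integrable f \<and> X (r n) = l2_class f" for n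
    using l2_class_cases by blast
  then obtain f where f: "\<And>n. square_integrable (f n)" and Xf: "\<And>n. X (r n) = l2_class (f n)"
    by metis
  have fm [measurable]: "f n \<in> borel_measurable borel" for n
    using f by blast
  define u where "u n x = norm (f (Suc n) x - f n x)" for n x
  define h where "h N x = (\<Sum>n<N. u n x)" for N x
  have um [measurable]: "u n \<in> borel_measurable borel" for n
    unfolding u_def[abs_def] by measurable
  have hm [measurable]: "h n \<in> borel_measurable borel" for n
    unfolding h_def[abs_def] by measurable
  have u0: "u n x \<ge> 0" and h0: "h n x \<ge> 0" for n x
    by (simp_all add: u_def h_def sum_nonneg)
  have su: "square_integrable (\<lambda>x. complex_of_real (u n x))" for n
    using square_integrable_diff[OF f[of "Suc n"] f[of n]]
    by (auto simp: square_integrable_def u_def)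
  have sh: "square_integrable (\<lambda>x. complex_of_real (h N x))" for N
    unfolding h_def of_real_sum by (rule square_integrable_sum) (rule su)
  have nu: "norm (l2_class (\<lambda>x. complex_of_real (u n x))) \<le> (1/2)^n" for n
  proof -
    have "norm (l2_class (\<lambda>x. complex_of_real (u n x))) = norm (X (r (Suc n)) - X (r n))"
      unfolding Xf l2_class_diff[OF f f, symmetric]
      using norm_l2_class[OF su[of n]] norm_l2_class[OF square_integrable_diff[OF f f, of "Suc n" n]]
      by (simp add: u_def)
    with r_le[of n] show ?thesis by simp
  qed
  have nh: "norm (l2_class (\<lambda>x. complex_of_real (h N x))) \<le> 2" for N
  proof -
    have "l2_class (\<lambda>x. complex_of_real (h N x)) = (\<Sum>n<N. l2_class (\<lambda>x. complex_of_real (u n x)))"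
      unfolding h_def of_real_sum by (rule l2_class_sum) (rule su)
    then have "norm (l2_class (\<lambda>x. complex_of_real (h N x))) \<le> (\<Sum>n<N. (1/2)^n)"
      using nu by (simp add: sum_norm_le)
    also have "\<dots> \<le> 2"
    proof -
      have "(\<Sum>n<N. (1/2)^n) = 2 - 2 * (1/2 :: real)^N"
        by (induction N) simp_all
      then show ?thesis by simp
    qed
    finally show ?thesis .
  qed
  have int_h: "(\<integral>x. (h N x)\<^sup>2 \<partial>lborel) \<le> 4" for N
  proof -
    have "sqrt (\<integral>x. (h N x)\<^sup>2 \<partial>lborel) \<le> 2"
      using nh[of N] by (simp add: norm_l2_class[OF sh])
    then show ?thesis using sqrt_le_D[of _ 2] by force
  qed
  have integ_h: "integrable lborel (\<lambda>x. (h N x)\<^sup>2)" for N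
    using sh[of N] by (simp add: square_integrable_def)
  have nn_h: "(\<integral>\<^sup>+x. ennreal ((h N x)\<^sup>2) \<partial>lborel) \<le> 4" for N
    using ennreal_leI[OF int_h[of N]] integ_h[of N] by (subst nn_integral_eq_integral) auto
  have inc_h: "h N x \<le> h (Suc N) x" for N x
    by (simp add: h_def u0)
  define H where "H x = (SUP N. ennreal ((h N x)\<^sup>2))" for x
  have Hm [measurable]: "H \<in> borel_measurable borel"
    unfolding H_def[abs_def] by measurable
  have "(\<integral>\<^sup>+x. H x \<partial>lborel) = (SUP N. \<integral>\<^sup>+x. ennreal ((h N x)\<^sup>2) \<partial>lborel)"
    unfolding H_def
    by (rule nn_integral_monotone_convergence_SUP)
       (auto intro!: incseq_SucI le_funI ennreal_leI power_mono inc_h h0)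
  also have "\<dots> \<le> 4" by (rule SUP_least) (rule nn_h)
  finally have H4: "(\<integral>\<^sup>+x. H x \<partial>lborel) \<le> 4" .
  then have Hfin: "AE x in lborel. H x \<noteq> \<infinity>"
    by (intro nn_integral_PInf_AE) (auto simp: top_unique)
  define w where "w x = norm (f 0 x) + sqrt (enn2real (H x))" for x
  have hH: "h N x \<le> sqrt (enn2real (H x))" if "H x \<noteq> \<infinity>" for N x
  proof -
    have "ennreal ((h N x)\<^sup>2) \<le> H x" unfolding H_def by (rule SUP_upper) simp
    then have "(h N x)\<^sup>2 \<le> enn2real (H x)"
      using that enn2real_mono[of "ennreal ((h N x)\<^sup>2)" "H x"] by (simp add: top.not_eq_extremum)
    then show ?thesis by (rule real_le_rsqrt)
  qed
  have fw: "norm (f n x) \<le> w x" and conv: "convergent (\<lambda>n. f n x)" if "H x \<noteq> \<infinity>" for n x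
  proof -
    have tel: "f n x = f 0 x + (\<Sum>k<n. f (Suc k) x - f k x)" for n
      using sum_lessThan_telescope[of "\<lambda>k. f k x" n] by simp
    have "norm (\<Sum>k<n. f (Suc k) x - f k x) \<le> h n x"
      unfolding h_def u_def by (rule norm_sum)
    then show "norm (f n x) \<le> w x"
      using hH[OF that, of n] norm_triangle_ineq[of "f 0 x" "\<Sum>k<n. f (Suc k) x - f k x"] tel[of n]
      by (simp add: w_def)
    have "summable (\<lambda>k. norm (f (Suc k) x - f k x))"
    proof (rule bounded_imp_summable)
      show "(\<Sum>k\<le>n. norm (f (Suc k) x - f k x)) \<le> sqrt (enn2real (H x))" for n
        using hH[OF that, of "Suc n"] by (simp add: h_def u_def lessThan_Suc_atMost)
    qed simp
    then have "summable (\<lambda>k. f (Suc k) x - f k x)"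
      by (rule summable_norm_cancel)
    then have "(\<lambda>n. f 0 x + (\<Sum>k<n. f (Suc k) x - f k x)) \<longlonglongrightarrow> f 0 x + (\<Sum>k. f (Suc k) x - f k x)"
      by (intro tendsto_intros summable_LIMSEQ)
    then show "convergent (\<lambda>n. f n x)"
      unfolding tel[symmetric] by (rule convergentI)
  qed
  have w2: "integrable lborel (\<lambda>x. (w x)\<^sup>2)"
  proof (rule Bochner_Integration.integrable_bound)
    have "integrable lborel (\<lambda>x. enn2real (H x))"
    proof (rule integrableI_nonneg)
      show "(\<integral>\<^sup>+x. ennreal (enn2real (H x)) \<partial>lborel) < \<infinity>"
      proof -
        have "(\<integral>\<^sup>+x. ennreal (enn2real (H x)) \<partial>lborel) \<le> (\<integral>\<^sup>+x. H x \<partial>lborel)"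
          by (rule nn_integral_mono) (simp add: ennreal_enn2real_if)
        also note H4
        finally show ?thesis by (rule order_le_less_trans) simp
      qed
    qed simp_all
    then show "integrable lborel (\<lambda>x. 2 * ((norm (f 0 x))\<^sup>2 + enn2real (H x)))"
      using f[of 0] by (auto simp: square_integrable_def)
    show "AE x in lborel. norm ((w x)\<^sup>2) \<le> norm (2 * ((norm (f 0 x))\<^sup>2 + enn2real (H x)))"
    proof (rule AE_I2)
      fix x
      have "(w x)\<^sup>2 \<le> 2 * ((norm (f 0 x))\<^sup>2 + (sqrt (enn2real (H x)))\<^sup>2)"
        unfolding w_def by (rule add_power2_le)
      then show "norm ((w x)\<^sup>2) \<le> norm (2 * ((norm (f 0 x))\<^sup>2 + enn2real (H x)))"
        by simp
    qed
    show "(\<lambda>x. (w x)\<^sup>2) \<in> borel_measurable lborel"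
      unfolding w_def by measurable
  qed
  define g where "g x = lim (\<lambda>n. f n x)" for x
  have "(\<lambda>n. l2_class (f n)) \<longlonglongrightarrow> l2_class g"
  proof (rule l2_class_dominated_convergence(3)[OF _ _ w2])
    show "g \<in> borel_measurable borel"
      unfolding g_def[abs_def] by measurable
    show "AE x in lborel. (\<lambda>i. f i x) \<longlonglongrightarrow> g x"
      using Hfin by eventually_elim (simp add: g_def conv convergent_LIMSEQ_iff[symmetric])
    show "AE x in lborel. norm (f i x) \<le> w x" for i
      using Hfin by eventually_elim (rule fw)
  qed (rule fm)
  then have "(X \<circ> r) \<longlonglongrightarrow> l2_class g"
    by (simp add: o_def Xf)
  with X r have "X \<longlonglongrightarrow> l2_class g"
    by (auto intro: Cauchy_converges_subseq simp: o_def)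
  then show "convergent X" by (rule convergentI)
qed


lemma l2_countable_dense: "\<exists>D :: 'a::euclidean_space l2 set. countable D \<and> closure D = UNIV"
proof -
  obtain B :: "'a set set" where B: "countable B" "topological_basis B"
    using ex_countable_basis by blast
  define G where "G = (\<lambda>F. \<Inter>F) ` {F. finite F \<and> F \<subseteq> B}"
  have cG: "countable G"
    unfolding G_def by (intro countable_image countable_Collect_finite_subset B)
  have UG: "UNIV \<in> G"
    unfolding G_def by (rule image_eqI[of _ _ "{}"]) auto
  have BG: "B \<subseteq> G"
  proof
    fix b assume "b \<in> B"
    then show "b \<in> G" unfolding G_def by (intro image_eqI[of _ _ "{b}"]) auto
  qed
  have stable: "Int_stable G"
  proof (rule Int_stableI)
    fix a b assume "a \<in> G" "b \<in> G"
    then obtain F F' where "finite F" "F \<subseteq> B" "a = \<Inter>F" "finite F'" "F' \<subseteq> B" "b = \<Inter>F'"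
      unfolding G_def by blast
    then show "a \<inter> b \<in> G"
      unfolding G_def by (intro image_eqI[of _ _ "F \<union> F'"]) auto
  qed
  have openB: "open b" if "b \<in> B" for b
    using that B(2) topological_basis_open by blast
  have openG: "open b" if "b \<in> G" for b
    using that openB unfolding G_def by auto
  have sets_G: "A \<in> sigma_sets UNIV G" if "A \<in> sets borel" for A
  proof -
    have "A \<in> sigma_sets UNIV B"
      using that by (subst (asm) borel_eq_countable_basis[OF B]) simp
    then show ?thesis using sigma_sets_mono'[OF BG] by blast
  qed
  have borel_G: "A \<in> sets borel" if "A \<in> sigma_sets UNIV G" for A
    using that sets.sigma_sets_subset[of G borel] borel_open[OF openG] by auto

  define e where "e c n A = l2_class (\<lambda>x. c * of_real (indicator (A \<inter> ball 0 (real n)) x))"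
    for c :: complex and n :: nat and A :: "'a set"
  have w_int: "integrable lborel (\<lambda>x::'a. (norm c * indicator (ball 0 (real n)) x)\<^sup>2)"
    for c :: complex and n :: nat
  proof -
    have "(\<lambda>x::'a. (norm c * indicator (ball 0 (real n)) x)\<^sup>2)
        = (\<lambda>x. (norm c)\<^sup>2 * indicator (ball 0 (real n)) x)"
      by (auto simp: fun_eq_iff indicator_def)
    moreover have "integrable lborel (\<lambda>x::'a. (norm c)\<^sup>2 * indicator (ball 0 (real n)) x)"
      using emeasure_bounded_finite[OF bounded_ball, of "0::'a" "real n"]
      by (intro integrable_mult_right integrable_real_indicator) auto
    ultimately show ?thesis by (simp only:)
  qed
  have sq: "square_integrable (\<lambda>x. c * of_real (indicator (A \<inter> ball 0 (real n)) x))"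
    if "A \<in> sets borel" for c n and A :: "'a set"
    by (rule square_integrable_bound[OF _ w_int[of c n]])
       (use that in \<open>auto simp: indicator_def norm_mult\<close>)

  define T where "T = (\<lambda>(q, c, n, A). of_rat q *\<^sub>R e c n A)"
  define L where "L = lists ((UNIV :: rat set) \<times> {1, \<i>} \<times> (UNIV :: nat set) \<times> G)"
  define D where "D = (\<lambda>l. sum_list (map T l)) ` L"
  have cD: "countable D"
    unfolding D_def L_def by (intro countable_image countable_lists countable_SIGMA cG) auto
  have D_add: "x + y \<in> D" if xy: "x \<in> D" "y \<in> D" for x y
  proof -
    obtain l l' where l: "l \<in> L" "x = sum_list (map T l)"
      "l' \<in> L" "y = sum_list (map T l')"
      using xy unfolding D_def by blast
    have "x + y = sum_list (map T (l @ l'))" "l @ l' \<in> L"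
      using l by (auto simp: L_def)
    then show ?thesis unfolding D_def by blast
  qed
  have D_scale: "of_rat q *\<^sub>R x \<in> D" if x: "x \<in> D" for x q
  proof -
    obtain l where l: "l \<in> L" "x = sum_list (map T l)"
      using x unfolding D_def by blast
    have "of_rat q *\<^sub>R sum_list (map T l) = sum_list (map T (map (\<lambda>(p, z). (q * p, z)) l))"
      by (induction l) (auto simp: T_def scaleR_add_right of_rat_mult)
    moreover have "map (\<lambda>(p, z). (q * p, z)) l \<in> L"
      using l(1) unfolding L_def by (induction l) auto
    ultimately show ?thesis unfolding D_def l(2) by blast
  qed
  have D_e: "e c n A \<in> D" if "c \<in> {1, \<i>}" "A \<in> G" for c n A
  proof -
    have "e c n A = sum_list (map T [(1, c, n, A)])" by (simp add: T_def)
    moreover have "[(1, c, n, A)] \<in> L" using that by (auto simp: L_def)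
    ultimately show ?thesis unfolding D_def by blast
  qed
  have C_add: "x + y \<in> closure D" if "x \<in> closure D" "y \<in> closure D" for x y
  proof -
    obtain a b where "\<And>n. a n \<in> D" "a \<longlonglongrightarrow> x" "\<And>n. b n \<in> D" "b \<longlonglongrightarrow> y"
      using \<open>x \<in> closure D\<close> \<open>y \<in> closure D\<close> unfolding closure_sequential by blast
    then show ?thesis
      unfolding closure_sequential by (intro exI[of _ "\<lambda>n. a n + b n"]) (auto intro: D_add tendsto_add)
  qed
  have C_scale: "r *\<^sub>R x \<in> closure D" if x: "x \<in> closure D" for x r
  proof -
    obtain a where a: "\<And>n. a n \<in> D" "a \<longlonglongrightarrow> x"
      using x unfolding closure_sequential by blast
    have "\<exists>y\<in>\<rat>. dist y r < \<epsilon>" if "\<epsilon> > 0" for \<epsilon> :: real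
      using Rats_dense_in_real[of r "r + \<epsilon>"] that by (force simp: dist_real_def)
    then have "r \<in> closure \<rat>" by (simp add: closure_approachable)
    then obtain b where b: "\<And>n. b n \<in> \<rat>" "b \<longlonglongrightarrow> r"
      unfolding closure_sequential by blast
    have "b n *\<^sub>R a n \<in> D" for n
      using D_scale[OF a(1)] b(1)[of n] by (auto elim!: Rats_cases)
    moreover have "(\<lambda>n. b n *\<^sub>R a n) \<longlonglongrightarrow> r *\<^sub>R x"
      using a(2) b(2) by (rule tendsto_scaleR[rotated])
    ultimately show ?thesis
      unfolding closure_sequential by (intro exI[of _ "\<lambda>n. b n *\<^sub>R a n"]) auto
  qed
  have C_0: "0 \<in> closure D"
    using C_scale[of _ 0] D_e[OF _ UG, of 1] closure_subset[of D] by fastforce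
  have C_sum: "(\<Sum>i\<in>I. x i) \<in> closure D" if "\<And>i. i \<in> I \<Longrightarrow> x i \<in> closure D" for I :: "'b set" and x
    using that by (induction I rule: infinite_finite_induct) (auto intro: C_add C_0)
  have C_lim: "x \<in> closure D" if "\<And>n. a n \<in> closure D" "a \<longlonglongrightarrow> x" for a x
    using that closed_sequentially[OF closed_closure] by blast

  have GP: "G \<subseteq> Pow UNIV" by simp
  have C_e: "e c n A \<in> closure D" if c: "c \<in> {1, \<i>}" and A: "A \<in> sets borel" for c n A
    using stable GP sets_G[OF A]
  proof (induction rule: sigma_sets_induct_disjoint)
    case (basic A)
    then show ?case using D_e[OF c] closure_subset by blast
  next
    case empty
    show ?case by (simp add: e_def l2_class_0 C_0)
  next
    case (compl A)
    have "e c n (UNIV - A) = l2_class (\<lambda>x. c * of_real (indicator (UNIV \<inter> ball 0 (real n)) x)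
          - c * of_real (indicator (A \<inter> ball 0 (real n)) x))"
      unfolding e_def by (rule arg_cong[of _ _ l2_class]) (auto simp: fun_eq_iff indicator_def)
    also have "\<dots> = e c n UNIV - e c n A"
      unfolding e_def by (rule l2_class_diff[OF sq sq]) (use borel_G[OF compl(1)] in auto)
    also have "\<dots> = e c n UNIV + (-1) *\<^sub>R e c n A" by simp
    also have "\<dots> \<in> closure D"
      using D_e[OF c UG] closure_subset[of D] compl by (intro C_add C_scale) auto
    finally show ?case .
  next
    case (union F)
    have F: "F i \<in> sets borel" for i
      using union(2) by (intro borel_G) auto
    define H where "H N x = (\<Sum>i<N. c * of_real (indicator (F i \<inter> ball 0 (real n)) x))" for N x
    have H_eq: "H N x = c * of_real (indicator ((\<Union>i<N. F i) \<inter> ball 0 (real n)) x)" for N x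
    proof -
      have ind: "indicator (\<Union>i<N. F i) x = (\<Sum>i<N. indicator (F i) x :: real)"
        by (rule indicator_UN_disjoint) (use union(1) in \<open>auto simp: disjoint_family_on_def\<close>)
      show ?thesis
        unfolding H_def indicator_inter_arith ind
        by (simp only: of_real_mult of_real_sum sum_distrib_left sum_distrib_right mult.assoc)
    qed
    have "(\<lambda>N. l2_class (H N)) \<longlonglongrightarrow> e c n (\<Union>i. F i)"
      unfolding e_def
    proof (rule l2_class_dominated_convergence(3)[OF _ _ w_int[of c n]])
      show "AE x in lborel. (\<lambda>N. H N x) \<longlonglongrightarrow> c * of_real (indicator ((\<Union>i. F i) \<inter> ball 0 (real n)) x)"
      proof (rule AE_I2)
        fix x
        have "(\<lambda>N. indicator (\<Union>i<N. F i) x :: real) \<longlonglongrightarrow> indicator (\<Union>i. F i) x"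
          by (rule LIMSEQ_indicator_UN)
        then have "(\<lambda>N. c * of_real (indicator (\<Union>i<N. F i) x * indicator (ball 0 (real n)) x))
            \<longlonglongrightarrow> c * of_real (indicator (\<Union>i. F i) x * indicator (ball 0 (real n)) x)"
          by (intro tendsto_intros)
        then show "(\<lambda>N. H N x) \<longlonglongrightarrow> c * of_real (indicator ((\<Union>i. F i) \<inter> ball 0 (real n)) x)"
          by (simp only: H_eq indicator_inter_arith)
      qed
      show "AE x in lborel. norm (H N x) \<le> norm c * indicator (ball 0 (real n)) x" for N
        by (rule AE_I2) (auto simp: H_eq indicator_def norm_mult)
      show "(\<lambda>x. c * of_real (indicator ((\<Union>i. F i) \<inter> ball 0 (real n)) x)) \<in> borel_measurable borel"
        using sq[of "\<Union>i. F i" c n] F by blast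
      show "H N \<in> borel_measurable borel" for N
        unfolding H_def[abs_def]
        by (rule square_integrable_measurable, intro square_integrable_sum sq F)
    qed
    moreover have "l2_class (H N) \<in> closure D" for N
      unfolding H_def[abs_def]
      by (subst l2_class_sum) (use union F sq in \<open>auto intro!: C_sum simp: e_def[symmetric]\<close>)
    ultimately show ?case by (rule C_lim[rotated])
  qed

  have "x \<in> closure D" for x
  proof -
    obtain f where f: "square_integrable f" and x: "x = l2_class f"
      using l2_class_cases by blast
    have fm [measurable]: "f \<in> borel_measurable borel" using f by blast
    from borel_measurable_implies_sequence_metric[OF fm, of 0] obtain s where
      s: "\<And>i. simple_function borel (s i)" and
      s_lim: "\<And>x. (\<lambda>i. s i x) \<longlonglongrightarrow> f x" and
      s_bd: "\<And>i x. norm (s i x) \<le> 2 * norm (f x)"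
      by simp metis
    have sm [measurable]: "s i \<in> borel_measurable borel" for i
      using s by (rule borel_measurable_simple_function)
    define V where "V i y = s i -` {y}" for i y
    have V: "V i y \<in> sets borel" for i y
      unfolding V_def using measurable_sets[OF sm[of i], of "{y}"] by simp
    have fin: "finite (range (s i))" for i
      using s[of i] by (simp add: simple_function_def)
    define g where "g i x = (\<Sum>y\<in>range (s i).
        Re y *\<^sub>R (1 * of_real (indicator (V i y \<inter> ball 0 (real i)) x)) +
        Im y *\<^sub>R (\<i> * of_real (indicator (V i y \<inter> ball 0 (real i)) x)))" for i x
    have g_eq: "g i x = s i x * indicator (ball 0 (real i)) x" for i x
    proof -
      have "g i x = (\<Sum>y\<in>range (s i). if y = s i x then y * indicator (ball 0 (real i)) x else 0)"
        unfolding g_def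
      proof (rule sum.cong[OF refl])
        fix y
        show "Re y *\<^sub>R (1 * of_real (indicator (V i y \<inter> ball 0 (real i)) x)) +
            Im y *\<^sub>R (\<i> * of_real (indicator (V i y \<inter> ball 0 (real i)) x))
          = (if y = s i x then y * indicator (ball 0 (real i)) x else 0)"
          by (auto simp: V_def indicator_def complex_eq_iff)
      qed
      then show ?thesis using fin by (simp add: sum.delta)
    qed
    have "l2_class (g i) \<in> closure D" for i
    proof -
      have sR: "square_integrable (\<lambda>x. r *\<^sub>R (c * of_real (indicator (V i y \<inter> ball 0 (real i)) x)))" for r c y
        using square_integrable_cmult[OF sq[OF V], of "of_real r"] by (simp add: scaleR_conv_of_real)
      have "l2_class (g i) = (\<Sum>y\<in>range (s i). Re y *\<^sub>R e 1 i (V i y) + Im y *\<^sub>R e \<i> i (V i y))"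
        unfolding g_def[abs_def] e_def
        by (subst l2_class_sum, intro square_integrable_add sR, intro sum.cong refl,
            subst l2_class_add[OF sR sR], simp only: l2_class_scaleR[OF sq[OF V]])
      also have "\<dots> \<in> closure D"
        by (intro C_sum C_add C_scale C_e V) auto
      finally show ?thesis .
    qed
    moreover have "(\<lambda>i. l2_class (g i)) \<longlonglongrightarrow> l2_class f"
    proof (rule l2_class_dominated_convergence(3)[OF fm])
      show "g i \<in> borel_measurable borel" for i
        unfolding g_eq[abs_def]
        by (intro borel_measurable_times borel_measurable_indicator sm) simp
      show "integrable lborel (\<lambda>x. (2 * norm (f x))\<^sup>2)"
        using f by (simp add: square_integrable_def power_mult_distrib)
      show "AE x in lborel. norm (g i x) \<le> 2 * norm (f x)" for i
        by (rule AE_I2) (use s_bd in \<open>auto simp: g_eq indicator_def\<close>)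
      show "AE x in lborel. (\<lambda>i. g i x) \<longlonglongrightarrow> f x"
      proof (rule AE_I2)
        fix x :: 'a
        obtain N :: nat where N: "norm x < N" using reals_Archimedean2 by blast
        have "\<forall>\<^sub>F i in sequentially. s i x = g i x"
          using eventually_ge_at_top[of N]
        proof eventually_elim
          case (elim i)
          then have "norm x < real i" using N by linarith
          then show ?case by (simp add: g_eq)
        qed
        then show "(\<lambda>i. g i x) \<longlonglongrightarrow> f x"
          using s_lim[of x] by (rule Lim_transform_eventually[rotated])
      qed
    qed
    ultimately show ?thesis unfolding x by (rule C_lim)
  qed
  then have "closure D = UNIV" by blast
  with cD show ?thesis by blast
qed

instance l2 :: (euclidean_space) second_countable_topology
proof
  obtain D :: "'a l2 set" where D: "countable D" "closure D = UNIV"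
    using l2_countable_dense by blast
  define B where "B = (\<lambda>(d, q). ball d (of_rat q)) ` (D \<times> (UNIV :: rat set))"
  have "topological_basis B"
  proof (rule topological_basisI)
    show "open b" if "b \<in> B" for b
      using that by (auto simp: B_def)
    fix U :: "'a l2 set" and x assume "open U" "x \<in> U"
    then obtain r where r: "r > 0" "ball x r \<subseteq> U"
      using open_contains_ball by blast
    obtain q where q: "0 < real_of_rat q" "real_of_rat q < r / 2"
      using of_rat_dense[of 0 "r / 2"] r(1) by auto
    obtain d where d: "d \<in> D" "dist d x < of_rat q"
      using D(2) closure_approachable[of x D] q(1) by blast
    have "ball d (of_rat q) \<subseteq> ball x r"
    proof
      fix y assume "y \<in> ball d (of_rat q)"
      then show "y \<in> ball x r"
        using d(2) q(2) dist_triangle[of x y d] by (simp add: dist_commute)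
    qed
    then show "\<exists>b\<in>B. x \<in> b \<and> b \<subseteq> U"
      using d q r unfolding B_def by (intro bexI[of _ "ball d (of_rat q)"]) auto
  qed
  moreover have "countable B"
    unfolding B_def using D(1) by (intro countable_image countable_SIGMA) auto
  ultimately show "\<exists>B :: 'a l2 set set. countable B \<and> open = generate_topology B"
    using topological_basis_imp_subbasis by blast
qed

lift_definition scaleC :: "complex \<Rightarrow> 'a::euclidean_space l2 \<Rightarrow> 'a l2" (infixr \<open>*\<^sub>C\<close> 75)
  is "\<lambda>c f x. c * f x"
  by (auto simp: l2_rel_def square_integrable_cmult)

interpretation l2: vector_space "scaleC :: complex \<Rightarrow> 'a::euclidean_space l2 \<Rightarrow> 'a l2"
proof
  fix a b :: complex and x y :: "'a l2"
  show "a *\<^sub>C (x + y) = a *\<^sub>C x + a *\<^sub>C y"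
    by transfer
       (auto simp: l2_rel_def algebra_simps intro!: square_integrable_add square_integrable_cmult)
  show "(a + b) *\<^sub>C x = a *\<^sub>C x + b *\<^sub>C x"
    by transfer
       (auto simp: l2_rel_def algebra_simps intro!: square_integrable_add square_integrable_cmult)
  show "a *\<^sub>C b *\<^sub>C x = (a * b) *\<^sub>C x"
    by transfer (auto simp: l2_rel_def mult.assoc intro!: square_integrable_cmult)
  show "1 *\<^sub>C x = x"
    by transfer (auto simp: l2_rel_def)
qed

definition bounded_operator :: "('a::euclidean_space l2 \<Rightarrow> 'a l2) \<Rightarrow> bool" where
  "bounded_operator T \<longleftrightarrow> bounded_linear T \<and> (\<forall>c \<xi>. T (c *\<^sub>C \<xi>) = c *\<^sub>C T \<xi>)"

definition compact_operator :: "('a::euclidean_space l2 \<Rightarrow> 'a l2) \<Rightarrow> bool" where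
  "compact_operator T \<longleftrightarrow> bounded_operator T \<and> compact (closure (T ` cball 0 1))"

definition rank_at_most :: "nat \<Rightarrow> ('a::euclidean_space l2 \<Rightarrow> 'a l2) \<Rightarrow> bool" where
  "rank_at_most k R \<longleftrightarrow> (\<exists>B. finite B \<and> card B \<le> k \<and> range R \<subseteq> l2.span B)"

definition singular_value :: "nat \<Rightarrow> ('a::euclidean_space l2 \<Rightarrow> 'a l2) \<Rightarrow> real" where
  "singular_value k T =
     (INF R\<in>{R. bounded_operator R \<and> rank_at_most k R}. onorm (\<lambda>\<xi>. T \<xi> - R \<xi>))"

definition weak_schatten :: "real \<Rightarrow> ('a::euclidean_space l2 \<Rightarrow> 'a l2) set" where
  "weak_schatten p = {T. compact_operator T \<and>
     bdd_above (range (\<lambda>k. real (k + 1) powr (1 / p) * singular_value k T))}"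

definition directional_deriv ::
    "'a::euclidean_space \<Rightarrow> ('a \<Rightarrow> complex) \<Rightarrow> 'a \<Rightarrow> complex" where
  "directional_deriv v f x = vector_derivative (\<lambda>h. f (x + h *\<^sub>R v)) (at 0)"

text \<open>
  The Schwartz space of a linear subspace \<open>V\<close>, stated without choosing coordinates on \<open>V\<close>: all
  iterated directional derivatives along \<open>V\<close> are differentiable on \<open>V\<close>, and they decay
  there faster than any polynomial. Only the values of \<open>f\<close> on \<open>V\<close> matter. Under any linear
  isometry of \<open>V\<close> with a coordinate space this is the usual Schwartz space; for \<open>V = {0}\<close> every
  \<open>f\<close> qualifies and represents the scalar \<open>f 0\<close>.
\<close>

definition schwartz_on :: "'a::euclidean_space set \<Rightarrow> ('a \<Rightarrow> complex) \<Rightarrow> bool" where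
  "schwartz_on V f \<longleftrightarrow> (\<forall>vs\<in>lists V.
     fold directional_deriv vs f differentiable_on V \<and>
     (\<forall>k::nat. bdd_above ((\<lambda>x. norm x ^ k * norm (fold directional_deriv vs f x)) ` V)))"

abbreviation schwartz :: "('a::euclidean_space \<Rightarrow> complex) \<Rightarrow> bool" where
  "schwartz \<equiv> schwartz_on UNIV"

text \<open>
  For a subspace \<open>V\<close>, the function \<open>u + v \<mapsto> f u * g v\<close> (\<open>u \<in> V\<close>, \<open>v\<close> orthogonal to \<open>V\<close>);
  the two closest points are the orthogonal projections.
\<close>

definition tensor_along ::
    "'a::euclidean_space set \<Rightarrow> ('a \<Rightarrow> complex) \<Rightarrow> ('a \<Rightarrow> complex) \<Rightarrow> 'a \<Rightarrow> complex" where
  "tensor_along V f g t = f (closest_point V t) * g (closest_point (V\<^sup>\<bottom>) t)"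

lemma closest_point_subspace_add:
  fixes V :: "'a::euclidean_space set"
  assumes V: "subspace V" and u: "u \<in> V" and v: "\<And>y. y \<in> V \<Longrightarrow> y \<bullet> v = 0"
  shows "closest_point V (u + v) = u"
proof (rule closest_point_unique[OF subspace_imp_convex[OF V] closed_subspace[OF V] u, symmetric])
  show "\<forall>z\<in>V. dist (u + v) u \<le> dist (u + v) z"
  proof
    fix z assume z: "z \<in> V"
    have "(u - z) \<bullet> v = 0"
      using V u z by (intro v subspace_diff)
    then have "(norm ((u - z) + v))\<^sup>2 = (norm (u - z))\<^sup>2 + (norm v)\<^sup>2"
      by (intro norm_add_Pythagorean) (simp add: orthogonal_def)
    then have "(norm v)\<^sup>2 \<le> (norm ((u - z) + v))\<^sup>2" by simp
    then have "norm v \<le> norm ((u - z) + v)" by (rule power2_le_imp_le) simp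
    then show "dist (u + v) u \<le> dist (u + v) z"
      by (simp add: dist_norm algebra_simps)
  qed
qed

lemma tensor_along_add:
  assumes V: "subspace V" and u: "u \<in> V" and v: "v \<in> V\<^sup>\<bottom>"
  shows "tensor_along V f g (u + v) = f u * g v"
proof -
  have "closest_point V (u + v) = u"
    using v by (intro closest_point_subspace_add V u) (auto simp: orthogonal_comp_def orthogonal_def)
  moreover have "closest_point (V\<^sup>\<bottom>) (v + u) = v"
    using u by (intro closest_point_subspace_add subspace_orthogonal_comp v)
      (auto simp: orthogonal_comp_def orthogonal_def inner_commute)
  ultimately show ?thesis by (simp add: tensor_along_def add.commute)
qed

lemma square_integrable_translation:
  assumes "square_integrable f"
  shows "square_integrable (\<lambda>r. f (r - t))"
proof -
  have [measurable]: "f \<in> borel_measurable borel"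
    using assms by blast
  have "integrable (distr lborel borel ((+) (- t))) (\<lambda>r. (norm (f r))\<^sup>2)"
    using assms by (simp add: lborel_distr_plus square_integrable_def)
  then have "integrable lborel (\<lambda>r. (norm (f (r - t)))\<^sup>2)"
    by (subst (asm) integrable_distr_eq) auto
  then show ?thesis by (simp add: square_integrable_def)
qed

lemma AE_lborel_translation:
  fixes t :: "'a::euclidean_space"
  assumes "AE r in lborel. P r" shows "AE r in lborel. P (r - t)"
proof -
  have "AE r in distr lborel borel ((+) (- t)). P r"
    using assms by (subst lborel_distr_plus)
  then have "AE r in lborel. P (- t + r)"
    by (rule AE_distrD[rotated]) simp
  then show ?thesis by simp
qed

lift_definition U_point :: "real^'n^'n \<Rightarrow> real^'n \<Rightarrow> (real^'n) l2 \<Rightarrow> (real^'n) l2"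
  is "\<lambda>\<theta> t \<xi> r. exp (- (\<i> / 2) * of_real (t \<bullet> (\<theta> *v r))) * \<xi> (r - t)"
proof -
  fix \<theta> :: "real^'n^'n" and t and f g :: "real^'n \<Rightarrow> complex"
  let ?e = "\<lambda>r. exp (- (\<i> / 2) * of_real (t \<bullet> (\<theta> *v r)))"
  assume *: "l2_rel f g"
  have "square_integrable (\<lambda>r. ?e r * h (r - t))" if h: "square_integrable h" for h
  proof (rule square_integrable_bound)
    have "continuous_on UNIV ?e"
      by (intro continuous_intros linear_continuous_on_compose[OF continuous_on_id]
            matrix_vector_mul_linear)
    then have e: "?e \<in> borel_measurable borel"
      by (rule borel_measurable_continuous_onI)
    show "(\<lambda>r. ?e r * h (r - t)) \<in> borel_measurable borel"
      by (rule borel_measurable_times[OF e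
            square_integrable_measurable[OF square_integrable_translation[OF h]]])
    show "integrable lborel (\<lambda>r. (norm (h (r - t)))\<^sup>2)"
      using square_integrable_translation[OF h] by (simp add: square_integrable_def)
  qed (simp add: norm_mult)
  then show "l2_rel (\<lambda>r. ?e r * f (r - t)) (\<lambda>r. ?e r * g (r - t))"
    using * AE_lborel_translation[of "\<lambda>r. f r = g r" t]
    by (auto simp: l2_rel_def elim!: eventually_mono)
qed

text \<open>The strong integral: for each \<open>\<xi>\<close> a Bochner integral in the Banach space of type \<^typ>\<open>(real^'n) l2\<close>.\<close>

definition U_op :: "real^'n^'n \<Rightarrow> (real^'n \<Rightarrow> complex) \<Rightarrow> (real^'n) l2 \<Rightarrow> (real^'n) l2" where
  "U_op \<theta> f \<xi> = (\<integral>t. f t *\<^sub>C U_point \<theta> t \<xi> \<partial>lborel)"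

text \<open>
  Writing \<open>\<theta>\<close> in block form in an orthonormal basis adapted to \<open>K = ker \<theta>\<close> and its orthogonal
  complement splits the coordinates into those of \<open>K\<close> and those of \<open>K\<^sup>\<bottom>\<close>, so the algebra can
  be stated through this splitting. If \<open>\<theta> = 0\<close> or \<open>det \<theta> \<noteq> 0\<close>, one of the factors is a scalar.
\<close>

definition algebra_A :: "real^'n^'n \<Rightarrow> ((real^'n) l2 \<Rightarrow> (real^'n) l2) set" where
  "algebra_A \<theta> = (let K = {v. \<theta> *v v = 0} in
     {\<lambda>\<xi>. \<Sum>j<m. c j *\<^sub>C U_op \<theta> (tensor_along K (f j) (g j)) \<xi> | (m::nat) c f g.
        \<forall>j<m. schwartz_on K (f j) \<and> schwartz_on (K\<^sup>\<bottom>) (g j)})"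

text \<open>
  Outside the natural domain of this multiplication operator, which contains all Schwartz
  functions, the value is set to 0.
\<close>

lift_definition J_power :: "real \<Rightarrow> 'a::euclidean_space l2 \<Rightarrow> 'a l2"
  is "\<lambda>\<alpha> \<xi>. let \<eta> = (\<lambda>t. of_real ((1 + (norm t)\<^sup>2) powr (\<alpha> / 2)) * \<xi> t)
             in if square_integrable \<eta> then \<eta> else (\<lambda>t. 0)"
proof -
  fix \<alpha> and f g :: "'a \<Rightarrow> complex"
  define w where "w = (\<lambda>t::'a. complex_of_real ((1 + (norm t)\<^sup>2) powr (\<alpha> / 2)))"
  assume *: "l2_rel f g"
  have [measurable]: "f \<in> borel_measurable borel" "g \<in> borel_measurable borel"
    using * by (auto simp: l2_rel_def)
  have [measurable]: "w \<in> borel_measurable borel"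
    unfolding w_def by measurable
  have ae: "AE t in lborel. w t * f t = w t * g t"
    using * by (auto simp: l2_rel_def elim!: eventually_mono)
  then have "integrable lborel (\<lambda>t. (norm (w t * f t))\<^sup>2) \<longleftrightarrow>
      integrable lborel (\<lambda>t. (norm (w t * g t))\<^sup>2)"
    by (intro integrable_cong_AE) (auto elim!: eventually_mono)
  then have "square_integrable (\<lambda>t. w t * f t) \<longleftrightarrow> square_integrable (\<lambda>t. w t * g t)"
    by (simp add: square_integrable_def)
  with ae have "l2_rel
      (let \<eta> = (\<lambda>t. w t * f t) in if square_integrable \<eta> then \<eta> else (\<lambda>t. 0))
      (let \<eta> = (\<lambda>t. w t * g t) in if square_integrable \<eta> then \<eta> else (\<lambda>t. 0))"
    by (auto simp: l2_rel_def)
  then show "l2_rel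
      (let \<eta> = (\<lambda>t. of_real ((1 + (norm t)\<^sup>2) powr (\<alpha> / 2)) * f t)
         in if square_integrable \<eta> then \<eta> else (\<lambda>t. 0))
      (let \<eta> = (\<lambda>t. of_real ((1 + (norm t)\<^sup>2) powr (\<alpha> / 2)) * g t)
         in if square_integrable \<eta> then \<eta> else (\<lambda>t. 0))"
    by (simp only: w_def)
qed

definition commutator :: "('b \<Rightarrow> 'b) \<Rightarrow> ('b \<Rightarrow> 'b) \<Rightarrow> 'b \<Rightarrow> 'b::minus" where
  "commutator S T = (\<lambda>\<xi>. S (T \<xi>) - T (S \<xi>))"

text \<open>\<open>S\<close> is regarded as defined on the (classes of) Schwartz functions only.\<close>

definition has_extension_in ::
    "('a::euclidean_space l2 \<Rightarrow> 'a l2) \<Rightarrow> ('a l2 \<Rightarrow> 'a l2) set \<Rightarrow> bool" where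
  "has_extension_in S \<I> \<longleftrightarrow>
     (\<exists>T\<in>\<I>. \<forall>\<phi>. schwartz \<phi> \<longrightarrow> T (l2_class \<phi>) = S (l2_class \<phi>))"

end

theory Submission
  imports Defs
begin

text \<open>
  Write \<open>w r = (1 + |r|\<^sup>2)\<^sup>1\<^sup>/\<^sup>2\<close>, let \<open>d\<close> be the dimension and \<open>a = \<beta> - \<alpha> + 1\<close>. The whole proof takes place on
  the level of integral kernels. An element of the algebra is \<open>U(F)\<close> for one smooth function \<open>F\<close>,
  all of whose derivatives decay rapidly, and \<open>U(F)\<close> has the kernel
  \<open>F(r - s) exp(- (i/2) (r - s, \<theta> r))\<close> (\<open>U_op_eq_kernel_op\<close>). The powers of \<open>J\<close> are multiplications by powers
  of \<open>w\<close>, so the operator of the theorem has on Schwartz functions (\<open>commutator_on_schwartz\<close>) the kernel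
  \<open>K(r, s) = (w(r)^\<alpha> - w(s)^\<alpha>) w(s)^(-\<beta>) F(r - s) exp(- (i/2) (r - s, \<theta> r))\<close>.

  By the mean value theorem and Peetre's inequality the difference of the weights is at most
  \<open>w(s)^(\<alpha>-1)\<close> times a power of \<open>w(r - s)\<close>, and the decay of \<open>F\<close> absorbs that power. Hence
  \<open>|K(r, s)| \<le> C w(s)^(-a) w(r - s)^(-2d)\<close>. The last factor is integrable, so Schur's test
  (\<open>schur_bound\<close>) makes the operator bounded whenever \<open>a \<ge> 0\<close>, which settles \<open>\<alpha> = \<beta> + 1\<close>.

  Let \<open>a > 0\<close>. It suffices to find, for every \<open>R \<ge> 1\<close>, an operator of rank \<open>O(R^d)\<close> at distance
  \<open>O(R^(-a))\<close> (\<open>weak_schattenI\<close>). The obstacle is the phase, which oscillates the faster the larger \<open>r\<close> is. But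
  relative to a base point \<open>q\<close> it is the product of a unimodular function of \<open>r\<close>, a unimodular function
  of \<open>s\<close>, and \<open>exp((i/2) (s - q, \<theta> (r - q)))\<close>, whose frequency \<open>|r - q|\<close> is again absorbed by \<open>F\<close>. So, up
  to a factor that depends on \<open>s\<close> only, \<open>K(r, \<cdot>)\<close> is smooth near \<open>q\<close>, with all derivatives obeying the bound
  of \<open>K\<close> itself, uniformly in \<open>q\<close> and \<open>r\<close> (\<open>local_symbol_derivs_bounded\<close>). On a cell of side \<open>1/L\<close> a Taylor
  polynomial of degree below \<open>M\<close> in \<open>s\<close> then has an error of the size \<open>L^(-M) w(s)^(-a) w(r - s)^(-2d)\<close>. With
  the variable scale \<open>L = \<lfloor>(R/w(s))^(1/3)\<rfloor>\<close>, no approximation at all where \<open>L = 0\<close>, and \<open>M \<ge> 3a\<close> this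
  is \<open>O(R^(-a)) w(r - s)^(-2d)\<close> everywhere, while the number of cells is at most a sum of \<open>O((R/L\<^sup>2)^d)\<close> over
  \<open>L\<close>, that is \<open>O(R^d)\<close> (\<open>smooth_kernel_separably_approximable\<close>).

  It remains to pass from the approximation of \<open>K\<close> to one of the operator \<open>T\<close>
  (\<open>kernel_op_in_weak_schatten\<close>). The Taylor coefficients depend on \<open>r\<close> in an uncontrolled way, so the
  approximating kernel is never used as an operator. Instead \<open>T\<close> is compared with \<open>T P\<close>, where \<open>P\<close>
  projects orthogonally onto the span of the conjugates of the \<open>O(R^d)\<close> functions of \<open>s\<close> involved: on the
  range of \<open>1 - P\<close> the approximating kernel vanishes, so \<open>T - T P\<close> only sees the error, and Schur's test bounds
  its norm by \<open>O(R^(-a))\<close>.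
\<close>

section \<open>Polynomial weights\<close>

text \<open>The power \<open>\<langle>x\<rangle>^\<gamma>\<close> of the Japanese bracket, so that \<^term>\<open>J_power \<gamma>\<close> is multiplication by \<open>wt \<gamma>\<close>.\<close>

definition wt :: "real \<Rightarrow> 'a::euclidean_space \<Rightarrow> real" where
  "wt \<gamma> x = (1 + (norm x)\<^sup>2) powr (\<gamma> / 2)"

lemma one_plus_norm2_pos [simp]: "0 < 1 + (norm x)\<^sup>2" for x :: "'a::real_normed_vector"
  by (simp add: add_pos_nonneg)

lemma wt_pos [simp]: "0 < wt \<gamma> x"
  using one_plus_norm2_pos[of x] unfolding wt_def powr_gt_zero by (metis less_irrefl)

lemma wt_nonneg [simp]: "0 \<le> wt \<gamma> x"
  using wt_pos less_imp_le by blast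

lemma wt_0 [simp]: "wt 0 x = 1"
  using one_plus_norm2_pos[of x] by (simp add: wt_def del: one_plus_norm2_pos)

lemma wt_zero [simp]: "wt \<gamma> 0 = 1"
  by (simp add: wt_def)

lemma wt_add: "wt (a + b) x = wt a x * wt b x"
  by (simp add: wt_def powr_add add_divide_distrib)

lemma wt_minus [simp]: "wt \<gamma> (- x) = wt \<gamma> x"
  by (simp add: wt_def)

lemma wt_minus_commute: "wt \<gamma> (x - y) = wt \<gamma> (y - x)"
  by (simp add: wt_def norm_minus_commute)

lemma wt_mono: "a \<le> b \<Longrightarrow> wt a x \<le> wt b x"
  unfolding wt_def by (rule powr_mono) auto

lemma wt_ge_1: "0 \<le> a \<Longrightarrow> 1 \<le> wt a x"
  using wt_mono[of 0 a x] by simp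

lemma wt_uminus: "wt (- a) x = inverse (wt a x)"
  by (simp add: wt_def powr_minus)

lemma wt_powr: "wt a x powr b = wt (a * b) x"
  by (simp add: wt_def powr_powr)

lemma wt_even: "wt (2 * real n) x = (1 + (norm x)\<^sup>2) ^ n"
  by (simp add: wt_def powr_realpow)

lemma norm_le_wt_1: "norm x \<le> wt 1 x"
proof -
  have "norm x = sqrt ((norm x)\<^sup>2)" by simp
  also have "\<dots> \<le> sqrt (1 + (norm x)\<^sup>2)" by (rule real_sqrt_le_mono) simp
  also have "\<dots> = wt 1 x" by (simp add: wt_def powr_half_sqrt)
  finally show ?thesis .
qed

lemma wt_le_of_norm_le: "norm x \<le> norm y \<Longrightarrow> 0 \<le> \<gamma> \<Longrightarrow> wt \<gamma> x \<le> wt \<gamma> y"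
  unfolding wt_def by (rule powr_mono2) (auto intro!: power_mono)

lemma continuous_on_wt [continuous_intros]:
  assumes "continuous_on S f" shows "continuous_on S (\<lambda>x. wt \<gamma> (f x))"
proof -
  have "1 + (norm (f x))\<^sup>2 \<noteq> 0" for x
    using one_plus_norm2_pos[of "f x"] by (metis less_irrefl)
  then show ?thesis unfolding wt_def using assms by (intro continuous_intros) auto
qed

lemma measurable_wt [measurable]: "wt \<gamma> \<in> borel_measurable borel"
  by (intro borel_measurable_continuous_onI continuous_intros)

text \<open>
  Peetre's inequality. Moving the base point of a weight costs only a weight in the displacement. This
  is what lets the rapid decay in \<open>r - s\<close> pay for comparing weights at \<open>r\<close>, at \<open>s\<close>, and at nearby points.
  For \<open>\<gamma> < 0\<close> it is the inequality for \<open>- \<gamma>\<close> applied to \<open>x = (x + y) - y\<close>.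
\<close>

lemma peetre: "wt \<gamma> (x + y) \<le> 2 powr (\<bar>\<gamma>\<bar> / 2) * wt \<gamma> x * wt \<bar>\<gamma>\<bar> y"
proof -
  have step: "1 + (norm (u + v))\<^sup>2 \<le> 2 * (1 + (norm u)\<^sup>2) * (1 + (norm v)\<^sup>2)" for u v :: 'a
  proof -
    have "(norm (u + v))\<^sup>2 \<le> (norm u + norm v)\<^sup>2"
      by (intro power_mono norm_triangle_ineq) simp
    also have "\<dots> \<le> 2 * ((norm u)\<^sup>2 + (norm v)\<^sup>2)" by (rule add_power2_le)
    finally have "1 + (norm (u + v))\<^sup>2 \<le> 1 + 2 * ((norm u)\<^sup>2 + (norm v)\<^sup>2)" by simp
    also have "\<dots> \<le> 2 * (1 + (norm u)\<^sup>2) * (1 + (norm v)\<^sup>2)"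
      by (simp add: algebra_simps)
    finally show ?thesis .
  qed
  have pos: "wt c (u + v) \<le> 2 powr (c / 2) * wt c u * wt c v" if "0 \<le> c" for c and u v :: 'a
  proof -
    have "wt c (u + v) \<le> (2 * (1 + (norm u)\<^sup>2) * (1 + (norm v)\<^sup>2)) powr (c / 2)"
      unfolding wt_def by (rule powr_mono2) (use step that in auto)
    also have "\<dots> = 2 powr (c / 2) * wt c u * wt c v"
      unfolding wt_def by (simp only: powr_mult)
    finally show ?thesis .
  qed
  show ?thesis
  proof (cases "0 \<le> \<gamma>")
    case True
    then show ?thesis using pos[of \<gamma> x y] by simp
  next
    case False
    define c where "c = - \<gamma>"
    have c: "0 \<le> c" "\<bar>\<gamma>\<bar> = c" "\<gamma> = - c" using False by (auto simp: c_def)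
    have "wt c x \<le> 2 powr (c / 2) * wt c (x + y) * wt c y"
      using pos[OF c(1), of "x + y" "- y"] by simp
    then have "wt (-c) x * wt (-c) (x + y) * wt c x
        \<le> wt (-c) x * wt (-c) (x + y) * (2 powr (c / 2) * wt c (x + y) * wt c y)"
      by (intro mult_left_mono) simp_all
    moreover have inv: "wt (-c) u * wt c u = 1" for u :: 'a
      by (simp flip: wt_add)
    have "wt (-c) x * wt (-c) (x + y) * wt c x = (wt (-c) x * wt c x) * wt (-c) (x + y)"
      by simp
    moreover have "wt (-c) x * wt (-c) (x + y) * (2 powr (c / 2) * wt c (x + y) * wt c y)
        = (wt (-c) (x + y) * wt c (x + y)) * (2 powr (c / 2) * wt (-c) x * wt c y)"
      by simp
    ultimately have "wt (-c) (x + y) \<le> 2 powr (c / 2) * wt (-c) x * wt c y"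
      unfolding inv by simp
    then show ?thesis using c by simp
  qed
qed

lemma integrable_inverse_one_plus_square:
  "integrable lborel (\<lambda>x::real. inverse (1 + x\<^sup>2))"
proof (rule Bochner_Integration.integrable_bound)
  let ?f = "\<lambda>x::real. inverse (1 + x\<^sup>2) * indicator {0..} x"
  have meas: "(\<lambda>x::real. inverse (1 + x\<^sup>2)) \<in> borel_measurable borel"
    by measurable
  have f: "integrable lborel ?f"
  proof (rule integrableI_nonneg)
    have "(\<integral>\<^sup>+x. ennreal (inverse (1 + x\<^sup>2)) * indicator {0..} x \<partial>lborel) = ennreal (pi / 2 - arctan 0)"
    proof (rule nn_integral_FTC_atLeast[OF meas])
      show "DERIV arctan x :> inverse (1 + x\<^sup>2)" for x by (rule DERIV_arctan)
      show "(arctan \<longlongrightarrow> pi / 2) at_top" by (rule tendsto_arctan_at_top)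
    qed (auto simp: add_nonneg_nonneg)
    moreover have "ennreal (inverse (1 + x\<^sup>2)) * indicator {0..} x = ennreal (?f x)" for x :: real
      by (simp add: indicator_def)
    ultimately show "(\<integral>\<^sup>+x. ennreal (?f x) \<partial>lborel) < \<infinity>" by simp
  qed (auto simp: add_nonneg_nonneg)
  have "integrable lborel (\<lambda>x. ?f (0 + (-1) * x))"
    by (rule lborel_integrable_real_affine[OF f]) simp
  then have "integrable lborel (\<lambda>x. ?f (- x))" by simp
  with f show "integrable lborel (\<lambda>x. ?f x + ?f (- x))" by (rule Bochner_Integration.integrable_add)
  show "AE x in lborel. norm (inverse (1 + x\<^sup>2)) \<le> norm (?f x + ?f (- x))"
    by (intro AE_I2) (auto simp: indicator_def)
qed simp

text \<open>
  The weight is dominated by the product of \<open>1 / (1 + x\<^sub>b\<^sup>2)\<close> over the coordinates \<open>x\<^sub>b\<close>, since each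
  \<open>|x\<^sub>b|\<close> is at most \<open>|x|\<close>. This reduces integrability to dimension one.
\<close>

lemma integrable_wt:
  "integrable lborel (wt (- (2 * real DIM('a))) :: 'a::euclidean_space \<Rightarrow> real)"
proof (rule integrableI_nonneg)
  let ?I = "\<integral>\<^sup>+x. ennreal (inverse (1 + x\<^sup>2)) \<partial>(lborel :: real measure)"
  have I: "?I < \<infinity>"
    using integrable_inverse_one_plus_square by (auto simp: integrable_iff_bounded)
  have "(\<integral>\<^sup>+x. ennreal (wt (- (2 * real DIM('a))) x) \<partial>(lborel :: 'a measure))
      \<le> (\<integral>\<^sup>+x. (\<Prod>b\<in>Basis. ennreal (inverse (1 + (x \<bullet> b)\<^sup>2))) \<partial>(lborel :: 'a measure))"
  proof (rule nn_integral_mono)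
    fix x :: 'a
    have "wt (- (2 * real DIM('a))) x = inverse (wt (2 * real DIM('a)) x)"
      by (rule inverse_unique[symmetric]) (simp flip: wt_add)
    also have "\<dots> = (\<Prod>b\<in>(Basis::'a set). inverse (1 + (norm x)\<^sup>2))"
      by (simp add: wt_even power_inverse)
    also have "\<dots> \<le> (\<Prod>b\<in>Basis. inverse (1 + (x \<bullet> b)\<^sup>2))"
    proof (intro prod_mono conjI le_imp_inverse_le)
      fix b :: 'a assume b: "b \<in> Basis"
      have "\<bar>x \<bullet> b\<bar>\<^sup>2 \<le> (norm x)\<^sup>2" by (intro power_mono Basis_le_norm b) simp
      then show "1 + (x \<bullet> b)\<^sup>2 \<le> 1 + (norm x)\<^sup>2" by simp
    qed (auto simp: add_nonneg_nonneg add_pos_nonneg)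
    finally show "ennreal (wt (- (2 * real DIM('a))) x) \<le> (\<Prod>b\<in>Basis. ennreal (inverse (1 + (x \<bullet> b)\<^sup>2)))"
      by (subst prod_ennreal) (auto intro: ennreal_leI simp: add_nonneg_nonneg)
  qed
  also have "\<dots> = (\<Prod>b\<in>(Basis::'a set). ?I)"
    by (subst nn_integral_lborel_prod[where f = "\<lambda>b x. ennreal (inverse (1 + x\<^sup>2))"]) (auto)
  also have "\<dots> < \<infinity>" using I by (simp add: power_less_top_ennreal)
  finally show "(\<integral>\<^sup>+x. ennreal (wt (- (2 * real DIM('a))) x) \<partial>(lborel :: 'a measure)) < \<infinity>" .
qed auto

section \<open>Schur's test and integral operators\<close>

text \<open>The fixed integrable profile in \<open>r - s\<close> against which all kernels are measured.\<close>

definition decay :: "'a::euclidean_space \<Rightarrow> real" where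
  "decay = wt (- (2 * real DIM('a)))"

text \<open>The summand 1 makes the constant positive without any lower bound for the integral.\<close>

definition schur_const :: "'a::euclidean_space itself \<Rightarrow> real" where
  "schur_const _ = 1 + (\<integral>x. decay (x::'a) \<partial>lborel)"

lemma decay_nonneg [simp]: "0 \<le> decay x"
  by (simp add: decay_def)

lemma decay_le_1: "decay (x :: 'a::euclidean_space) \<le> 1"
  using wt_mono[of "- (2 * real DIM('a))" 0 x] by (simp add: decay_def)

lemma decay_minus_commute: "decay (x - y) = decay (y - x)"
  by (simp add: decay_def wt_minus_commute)

lemma measurable_decay [measurable]: "decay \<in> borel_measurable borel"
  by (simp add: decay_def)

lemma integrable_decay: "integrable lborel (decay :: 'a::euclidean_space \<Rightarrow> real)"
  unfolding decay_def by (rule integrable_wt)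

lemma schur_const_ge_1: "1 \<le> schur_const TYPE('a::euclidean_space)"
  by (simp add: schur_const_def)

lemma nn_integral_lborel_translation:
  fixes f :: "'a::euclidean_space \<Rightarrow> ennreal"
  assumes [measurable]: "f \<in> borel_measurable borel"
  shows "(\<integral>\<^sup>+x. f (x - t) \<partial>lborel) = (\<integral>\<^sup>+x. f x \<partial>lborel)"
proof -
  have "(\<integral>\<^sup>+x. f x \<partial>lborel) = (\<integral>\<^sup>+x. f x \<partial>distr lborel borel ((+) (- t)))"
    by (simp add: lborel_distr_plus)
  also have "\<dots> = (\<integral>\<^sup>+x. f (- t + x) \<partial>lborel)"
    by (subst nn_integral_distr) auto
  finally show ?thesis by simp
qed

lemma nn_integral_decay_shift:
  fixes s :: "'a::euclidean_space"
  shows "(\<integral>\<^sup>+r. ennreal (decay (r - s)) \<partial>lborel) = ennreal (\<integral>x. decay (x::'a) \<partial>lborel)"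
  using nn_integral_eq_integral[OF integrable_decay]
  by (subst nn_integral_lborel_translation[of "\<lambda>x. ennreal (decay x)"]) auto

lemma integrable_decay_shift:
  fixes r :: "'a::euclidean_space"
  shows "integrable lborel (\<lambda>s. decay (r - s))"
    and "(\<integral>s. decay (r - s) \<partial>lborel) = (\<integral>x. decay (x::'a) \<partial>lborel)"
proof -
  have nn: "(\<integral>\<^sup>+s. ennreal (decay (r - s)) \<partial>lborel) = ennreal (\<integral>x. decay (x::'a) \<partial>lborel)"
    using nn_integral_decay_shift[of r] by (simp add: decay_minus_commute)
  show 1: "integrable lborel (\<lambda>s. decay (r - s))"
    by (rule integrableI_nonneg) (auto simp: nn)
  show "(\<integral>s. decay (r - s) \<partial>lborel) = (\<integral>x. decay (x::'a) \<partial>lborel)"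
    using nn nn_integral_eq_integral[OF 1] by simp
qed

lemma integrable_decay_times:
  fixes r :: "'a::euclidean_space"
  assumes f: "square_integrable f"
  shows "integrable lborel (\<lambda>s. decay (r - s) * norm (f s))"
    and "integrable lborel (\<lambda>s. decay (r - s) * (norm (f s))\<^sup>2)"
proof -
  have [measurable]: "f \<in> borel_measurable borel" using f by blast
  have f2: "integrable lborel (\<lambda>s. (norm (f s))\<^sup>2)" using f by (simp add: square_integrable_def)
  show "integrable lborel (\<lambda>s. decay (r - s) * norm (f s))"
  proof (rule Bochner_Integration.integrable_bound)
    show "integrable lborel (\<lambda>s. decay (r - s) + (norm (f s))\<^sup>2)"
      by (intro Bochner_Integration.integrable_add integrable_decay_shift f2)
    have "decay (r - s) * norm (f s) \<le> decay (r - s) + (norm (f s))\<^sup>2" for s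
    proof (cases "norm (f s) \<le> 1")
      case True
      have "decay (r - s) * norm (f s) \<le> decay (r - s) * 1"
        using True by (intro mult_left_mono) auto
      then show ?thesis using zero_le_power2[of "norm (f s)"] by linarith
    next
      case False
      have "decay (r - s) * norm (f s) \<le> norm (f s) * norm (f s)"
        using False decay_le_1[of "r - s"] by (intro mult_right_mono) auto
      then show ?thesis using decay_nonneg[of "r - s"] unfolding power2_eq_square by linarith
    qed
    then show "AE s in lborel. norm (decay (r - s) * norm (f s)) \<le> norm (decay (r - s) + (norm (f s))\<^sup>2)"
      by (intro AE_I2) simp
  qed simp
  show "integrable lborel (\<lambda>s. decay (r - s) * (norm (f s))\<^sup>2)"
    by (rule Bochner_Integration.integrable_bound[OF f2])
       (auto intro!: AE_I2 mult_left_le_one_le decay_le_1)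
qed

text \<open>
  The integral of \<open>decay (r - s) (|f s| - l)\<^sup>2\<close> is nonnegative for every real \<open>l\<close>; a suitable \<open>l\<close>
  gives the Cauchy-Schwarz inequality for the measure with density \<open>decay (r - s)\<close>.
\<close>

lemma decay_convolution_Cauchy_Schwarz:
  fixes r :: "'a::euclidean_space"
  assumes f: "square_integrable f"
  shows "(\<integral>s. decay (r - s) * norm (f s) \<partial>lborel)\<^sup>2
    \<le> schur_const TYPE('a) * (\<integral>s. decay (r - s) * (norm (f s))\<^sup>2 \<partial>lborel)"
proof -
  let ?S = "schur_const TYPE('a)"
  define A where "A = (\<integral>s. decay (r - s) * norm (f s) \<partial>lborel)"
  define B where "B = (\<integral>s. decay (r - s) * (norm (f s))\<^sup>2 \<partial>lborel)"
  \<comment> \<open>the minimiser of \<open>B - 2 l A + l\<^sup>2 S\<close>\<close>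
  define l where "l = A / ?S"
  have S: "0 < ?S" using schur_const_ge_1[where 'a='a] by simp
  have "0 \<le> (\<integral>s. decay (r - s) * (norm (f s) - l)\<^sup>2 \<partial>lborel)"
    by simp
  also have "\<dots> = (\<integral>s. decay (r - s) * (norm (f s))\<^sup>2 - 2 * l * (decay (r - s) * norm (f s))
      + l\<^sup>2 * decay (r - s) \<partial>lborel)"
    by (intro Bochner_Integration.integral_cong refl) (simp add: power2_eq_square algebra_simps)
  also have "\<dots> = B - 2 * l * A + l\<^sup>2 * (?S - 1)"
    using integrable_decay_times[OF f, of r] integrable_decay_shift[of r]
    by (simp add: A_def B_def schur_const_def)
  also have "\<dots> \<le> B - 2 * l * A + l\<^sup>2 * ?S"
    by (intro add_left_mono mult_left_mono) auto
  also have "\<dots> = B - A\<^sup>2 / ?S"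
    using S by (simp add: l_def power2_eq_square)
  finally show ?thesis
    using S unfolding A_def[symmetric] B_def[symmetric] by (simp add: field_simps)
qed

text \<open>
  Schur's test. The hypothesis is a pointwise bound on \<open>g\<close> rather than on a kernel that produces \<open>g\<close> from \<open>f\<close>.
  This matters later, where \<open>g\<close> is the image of \<open>f\<close> under a kernel minus
  an approximation whose coefficients are chosen separately for each \<open>r\<close>.
\<close>

lemma schur_bound:
  fixes f g :: "'a::euclidean_space \<Rightarrow> complex"
  assumes f: "square_integrable f" and g [measurable]: "g \<in> borel_measurable borel" and c: "0 \<le> c"
    and bound: "\<And>r. norm (g r) \<le> c * (\<integral>s. decay (r - s) * norm (f s) \<partial>lborel)"
  shows "square_integrable g"
    and "norm (l2_class g) \<le> c * schur_const TYPE('a) * norm (l2_class f)"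
proof -
  let ?S = "schur_const TYPE('a)"
  have [measurable]: "f \<in> borel_measurable borel" using f by blast
  have S: "1 \<le> ?S" by (rule schur_const_ge_1)
  have f2: "integrable lborel (\<lambda>s. (norm (f s))\<^sup>2)" using f by (simp add: square_integrable_def)
  define F where "F = (\<integral>s. (norm (f s))\<^sup>2 \<partial>lborel)"
  define B where "B r = (\<integral>s. decay (r - s) * (norm (f s))\<^sup>2 \<partial>lborel)" for r
  have F0: "0 \<le> F" by (simp add: F_def)
  have B0: "0 \<le> B r" for r by (simp add: B_def)
  have [measurable]: "B \<in> borel_measurable borel"
    unfolding B_def by measurable
  have "(\<integral>\<^sup>+r. ennreal (B r) \<partial>lborel)
      = (\<integral>\<^sup>+r. (\<integral>\<^sup>+s. ennreal (decay (r - s) * (norm (f s))\<^sup>2) \<partial>lborel) \<partial>lborel)"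
    unfolding B_def
    by (intro nn_integral_cong nn_integral_eq_integral[symmetric] integrable_decay_times f) auto
  also have "\<dots> = (\<integral>\<^sup>+s. (\<integral>\<^sup>+r. ennreal (decay (r - s) * (norm (f s))\<^sup>2) \<partial>lborel) \<partial>lborel)"
    by (rule lborel_pair.Fubini') simp
  also have "\<dots> = (\<integral>\<^sup>+s. ennreal (\<integral>x. decay (x::'a) \<partial>lborel) * ennreal ((norm (f s))\<^sup>2) \<partial>lborel)"
    by (simp add: ennreal_mult nn_integral_multc nn_integral_decay_shift)
  also have "\<dots> = ennreal (\<integral>x. decay (x::'a) \<partial>lborel) * ennreal F"
    by (simp add: nn_integral_cmult nn_integral_eq_integral[OF f2] F_def)
  also have "\<dots> \<le> ennreal (?S * F)"
    using F0 by (simp add: schur_const_def ennreal_mult[symmetric] mult_right_mono)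
  finally have BF: "(\<integral>\<^sup>+r. ennreal (B r) \<partial>lborel) \<le> ennreal (?S * F)" .
  have Bi: "integrable lborel B"
    by (rule integrableI_nonneg) (use BF B0 in \<open>auto intro: order_le_less_trans\<close>)
  have BI: "(\<integral>r. B r \<partial>lborel) \<le> ?S * F"
    using BF nn_integral_eq_integral[OF Bi] B0 F0 S by simp
  have g2: "(norm (g r))\<^sup>2 \<le> c\<^sup>2 * ?S * B r" for r
  proof -
    have "(norm (g r))\<^sup>2 \<le> (c * (\<integral>s. decay (r - s) * norm (f s) \<partial>lborel))\<^sup>2"
      by (intro power_mono bound) simp
    also have "\<dots> \<le> c\<^sup>2 * (?S * B r)"
      unfolding power_mult_distrib B_def
      by (intro mult_left_mono decay_convolution_Cauchy_Schwarz f) simp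
    finally show ?thesis by (simp add: mult.assoc)
  qed
  show sg: "square_integrable g"
    by (rule square_integrable_bound[where w = "\<lambda>r. c\<^sup>2 * ?S * B r"]) (use Bi g2 in auto)
  have "(\<integral>r. (norm (g r))\<^sup>2 \<partial>lborel) \<le> (\<integral>r. c\<^sup>2 * ?S * B r \<partial>lborel)"
    by (rule integral_mono) (use sg Bi g2 in \<open>auto simp: square_integrable_def\<close>)
  also have "\<dots> = c\<^sup>2 * ?S * (\<integral>r. B r \<partial>lborel)" by simp
  also have "\<dots> \<le> c\<^sup>2 * ?S * (?S * F)"
    using S BI by (intro mult_left_mono) auto
  finally have "(\<integral>r. (norm (g r))\<^sup>2 \<partial>lborel) \<le> (c * ?S)\<^sup>2 * F"
    by (simp add: power2_eq_square mult_ac)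
  then have "sqrt (\<integral>r. (norm (g r))\<^sup>2 \<partial>lborel) \<le> sqrt ((c * ?S)\<^sup>2 * F)"
    by (rule real_sqrt_le_mono)
  also have "\<dots> = c * ?S * sqrt F"
    using c S by (simp add: real_sqrt_mult)
  finally show "norm (l2_class g) \<le> c * ?S * norm (l2_class f)"
    by (simp add: norm_l2_class f sg F_def)
qed

text \<open>A representative of a class; integrals of a class against a kernel do not depend on this choice.\<close>

definition l2_fun :: "'a::euclidean_space l2 \<Rightarrow> 'a \<Rightarrow> complex" where
  "l2_fun x = (SOME f. square_integrable f \<and> x = l2_class f)"

lemma square_integrable_l2_fun: "square_integrable (l2_fun x)" and l2_class_l2_fun: "l2_class (l2_fun x) = x"
proof -
  have "\<exists>f. square_integrable f \<and> x = l2_class f" using l2_class_cases by blast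
  from someI_ex[OF this] show "square_integrable (l2_fun x)" "l2_class (l2_fun x) = x"
    unfolding l2_fun_def[symmetric] by auto
qed

lemma l2_class_eq_imp_AE:
  "square_integrable f \<Longrightarrow> square_integrable g \<Longrightarrow> l2_class f = l2_class g \<Longrightarrow> AE x in lborel. f x = g x"
  by transfer (simp add: l2_rel_def)

lemma scaleC_l2_class: "square_integrable f \<Longrightarrow> c *\<^sub>C l2_class f = l2_class (\<lambda>x. c * f x)"
  using square_integrable_cmult[of f c] by transfer (auto simp: l2_rel_def)

definition decaying_kernel :: "real \<Rightarrow> ('a::euclidean_space \<Rightarrow> 'a \<Rightarrow> complex) \<Rightarrow> bool" where
  "decaying_kernel c K \<longleftrightarrow> (\<lambda>(r, s). K r s) \<in> borel_measurable borel \<and> 0 \<le> c \<and>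
     (\<forall>r s. norm (K r s) \<le> c * decay (r - s))"

definition kernel_op :: "('a::euclidean_space \<Rightarrow> 'a \<Rightarrow> complex) \<Rightarrow> 'a l2 \<Rightarrow> 'a l2" where
  "kernel_op K x = l2_class (\<lambda>r. \<integral>s. K r s * l2_fun x s \<partial>lborel)"

context
  fixes K :: "'a::euclidean_space \<Rightarrow> 'a \<Rightarrow> complex" and c :: real
  assumes K: "decaying_kernel c K"
begin

lemma decaying_kernel_measurable [measurable]:
  "(\<lambda>(r, s). K r s) \<in> borel_measurable (borel \<Otimes>\<^sub>M borel)"
  using K by (simp add: decaying_kernel_def borel_prod)

lemma decaying_kernel_bound: "norm (K r s) \<le> c * decay (r - s)" and decaying_kernel_nonneg: "0 \<le> c"
  using K by (auto simp: decaying_kernel_def)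

lemma integrable_kernel:
  assumes f: "square_integrable f"
  shows "integrable lborel (\<lambda>s. K r s * f s)"
proof (rule Bochner_Integration.integrable_bound)
  have [measurable]: "f \<in> borel_measurable borel" using f by blast
  show "integrable lborel (\<lambda>s. c * (decay (r - s) * norm (f s)))"
    using integrable_decay_times[OF f, of r] by simp
  show "(\<lambda>s. K r s * f s) \<in> borel_measurable lborel" by measurable
  have "norm (K r s * f s) \<le> c * (decay (r - s) * norm (f s))" for s
    unfolding norm_mult mult.assoc[symmetric]
    by (intro mult_right_mono decaying_kernel_bound) simp
  then show "AE s in lborel. norm (K r s * f s) \<le> norm (c * (decay (r - s) * norm (f s)))"
    using decaying_kernel_nonneg by (intro AE_I2) simp
qed

lemma norm_kernel_integral_le:
  assumes f: "square_integrable f"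
  shows "norm (\<integral>s. K r s * f s \<partial>lborel) \<le> c * (\<integral>s. decay (r - s) * norm (f s) \<partial>lborel)"
proof -
  have "norm (\<integral>s. K r s * f s \<partial>lborel) \<le> (\<integral>s. c * (decay (r - s) * norm (f s)) \<partial>lborel)"
  proof (rule Bochner_Integration.integral_norm_bound_integral[OF integrable_kernel[OF f]])
    show "integrable lborel (\<lambda>s. c * (decay (r - s) * norm (f s)))"
      using integrable_decay_times[OF f, of r] by simp
    show "norm (K r s * f s) \<le> c * (decay (r - s) * norm (f s))" for s
      unfolding norm_mult mult.assoc[symmetric]
      by (intro mult_right_mono decaying_kernel_bound) simp
  qed
  then show ?thesis by simp
qed

lemma kernel_integral_measurable:
  assumes f: "square_integrable f"
  shows "(\<lambda>r. \<integral>s. K r s * f s \<partial>lborel) \<in> borel_measurable borel"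
proof -
  have [measurable]: "f \<in> borel_measurable borel" using f by blast
  show ?thesis by measurable
qed

lemma square_integrable_kernel_integral:
  assumes f: "square_integrable f"
  shows "square_integrable (\<lambda>r. \<integral>s. K r s * f s \<partial>lborel)"
  by (rule schur_bound(1)[OF f kernel_integral_measurable[OF f] decaying_kernel_nonneg
        norm_kernel_integral_le[OF f]])

lemma kernel_op_l2_class:
  assumes f: "square_integrable f"
  shows "kernel_op K (l2_class f) = l2_class (\<lambda>r. \<integral>s. K r s * f s \<partial>lborel)"
proof -
  note [measurable] = square_integrable_measurable[OF f]
    square_integrable_measurable[OF square_integrable_l2_fun[of "l2_class f"]]
  have "AE s in lborel. l2_fun (l2_class f) s = f s"
    by (rule l2_class_eq_imp_AE) (simp_all add: f square_integrable_l2_fun l2_class_l2_fun)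
  then have "(\<integral>s. K r s * l2_fun (l2_class f) s \<partial>lborel) = (\<integral>s. K r s * f s \<partial>lborel)" for r
    by (intro integral_cong_AE) auto
  then show ?thesis by (simp add: kernel_op_def)
qed

lemma norm_kernel_op_le: "norm (kernel_op K x) \<le> c * schur_const TYPE('a) * norm x"
  using schur_bound(2)[OF square_integrable_l2_fun kernel_integral_measurable[OF square_integrable_l2_fun]
      decaying_kernel_nonneg norm_kernel_integral_le[OF square_integrable_l2_fun], of x]
  by (simp add: kernel_op_def l2_class_l2_fun)

lemma bounded_operator_kernel_op: "bounded_operator (kernel_op K)"
  unfolding bounded_operator_def
proof (intro conjI allI)
  have add: "kernel_op K (x + y) = kernel_op K x + kernel_op K y" for x y
  proof -
    obtain f where f: "square_integrable f" "x = l2_class f" by (rule l2_class_cases)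
    obtain g where g: "square_integrable g" "y = l2_class g" by (rule l2_class_cases)
    have "kernel_op K (l2_class (\<lambda>s. f s + g s)) = l2_class (\<lambda>r. \<integral>s. K r s * (f s + g s) \<partial>lborel)"
      by (rule kernel_op_l2_class) (rule square_integrable_add[OF f(1) g(1)])
    also have "\<dots> = l2_class (\<lambda>r. (\<integral>s. K r s * f s \<partial>lborel) + (\<integral>s. K r s * g s \<partial>lborel))"
      by (simp add: distrib_left integrable_kernel f g)
    also have "\<dots> = kernel_op K x + kernel_op K y"
      by (simp add: kernel_op_l2_class f g l2_class_add square_integrable_kernel_integral)
    finally show ?thesis by (simp add: f g l2_class_add)
  qed
  show C: "kernel_op K (z *\<^sub>C x) = z *\<^sub>C kernel_op K x" for z x
  proof -
    obtain f where f: "square_integrable f" "x = l2_class f" by (rule l2_class_cases)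
    have "kernel_op K (l2_class (\<lambda>s. z * f s)) = l2_class (\<lambda>r. \<integral>s. K r s * (z * f s) \<partial>lborel)"
      by (rule kernel_op_l2_class) (rule square_integrable_cmult[OF f(1)])
    also have "(\<lambda>r. \<integral>s. K r s * (z * f s) \<partial>lborel) = (\<lambda>r. z * (\<integral>s. K r s * f s \<partial>lborel))"
      by (simp add: mult.left_commute[of _ z])
    finally show ?thesis
      by (simp add: f scaleC_l2_class kernel_op_l2_class square_integrable_kernel_integral)
  qed
  have R: "r *\<^sub>R x = complex_of_real r *\<^sub>C x" for r and x :: "'a l2"
    by transfer (auto simp: l2_rel_def scaleR_conv_of_real intro!: square_integrable_cmult)
  show "bounded_linear (kernel_op K)"
    by (rule bounded_linear_intro[where K = "c * schur_const TYPE('a)"])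
       (simp_all add: add R C norm_kernel_op_le mult.commute[of "norm _"])
qed

end

section \<open>Finite-dimensional subspaces and orthogonal projections\<close>

lemma inner_scaleC: "(c *\<^sub>C x) \<bullet> y = x \<bullet> (cnj c *\<^sub>C (y :: 'a::euclidean_space l2))"
proof transfer
  fix c and f g :: "'a \<Rightarrow> complex"
  have "(c * u) \<bullet> v = u \<bullet> (cnj c * v)" for u v :: complex
    by (simp add: inner_complex_def algebra_simps)
  then show "(\<integral>x. (c * f x) \<bullet> g x \<partial>lborel) = (\<integral>x. f x \<bullet> (cnj c * g x) \<partial>lborel)" by simp
qed

lemma scaleR_eq_scaleC: "r *\<^sub>R x = complex_of_real r *\<^sub>C (x :: 'a::euclidean_space l2)"
  by transfer (auto simp: l2_rel_def scaleR_conv_of_real intro!: square_integrable_cmult)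

lemma scaleC_eq_scaleR: "c *\<^sub>C x = Re c *\<^sub>R x + Im c *\<^sub>R (\<i> *\<^sub>C (x :: 'a::euclidean_space l2))"
  unfolding scaleR_eq_scaleC l2.scale_scale
  by (metis complex_eq l2.scale_left_distrib mult.commute)

text \<open>
  Orthogonalization and compactness arguments are carried out in real spans. They apply to complex spans
  because adjoining the multiples by \<open>\<i>\<close> to a set turns its real span into its complex span.
\<close>

lemma span_insert_i_scaleC:
  fixes B :: "'a::euclidean_space l2 set"
  assumes "x \<in> span (B \<union> (\<lambda>b. \<i> *\<^sub>C b) ` B)"
  shows "c *\<^sub>C x \<in> span (B \<union> (\<lambda>b. \<i> *\<^sub>C b) ` B)"
proof -
  let ?B = "B \<union> (\<lambda>b. \<i> *\<^sub>C b) ` B"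
  have i: "\<i> *\<^sub>C x \<in> span ?B"
    using assms
  proof (induction rule: span_induct_alt)
    case base
    then show ?case by (simp add: l2.scale_zero_right span_zero)
  next
    case (step r b y)
    have "\<i> *\<^sub>C b \<in> span ?B"
    proof (cases "b \<in> B")
      case True
      then show ?thesis by (intro span_base) auto
    next
      case False
      then obtain a where a: "a \<in> B" "b = \<i> *\<^sub>C a" using step(1) by auto
      have "\<i> *\<^sub>C b = (-1) *\<^sub>R a" unfolding a scaleR_eq_scaleC by simp
      then show ?thesis using a(1) by (metis UnI1 span_base span_scale)
    qed
    then have "r *\<^sub>R (\<i> *\<^sub>C b) + \<i> *\<^sub>C y \<in> span ?B"
      by (intro span_add span_scale step)
    moreover have "\<i> *\<^sub>C (r *\<^sub>R b + y) = r *\<^sub>R (\<i> *\<^sub>C b) + \<i> *\<^sub>C y"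
      by (simp add: scaleR_eq_scaleC l2.scale_right_distrib mult.commute)
    ultimately show ?case by simp
  qed
  show ?thesis unfolding scaleC_eq_scaleR[of c x]
    by (intro span_add span_scale i assms)
qed

lemma span_insert_i_subset:
  fixes B :: "'a::euclidean_space l2 set"
  shows "span (B \<union> (\<lambda>b. \<i> *\<^sub>C b) ` B) \<subseteq> l2.span B"
proof
  fix x assume "x \<in> span (B \<union> (\<lambda>b. \<i> *\<^sub>C b) ` B)"
  then show "x \<in> l2.span B"
  proof (induction rule: span_induct_alt)
    case base
    then show ?case by (rule l2.span_zero)
  next
    case (step r b y)
    have "b \<in> l2.span B"
      using step(1) by (auto intro: l2.span_base l2.span_scale)
    then show ?case unfolding scaleR_eq_scaleC by (intro l2.span_add l2.span_scale step)
  qed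
qed

lemma l2_span_subset:
  fixes B :: "'a::euclidean_space l2 set"
  shows "l2.span B \<subseteq> span (B \<union> (\<lambda>b. \<i> *\<^sub>C b) ` B)"
proof
  fix x assume "x \<in> l2.span B"
  then show "x \<in> span (B \<union> (\<lambda>b. \<i> *\<^sub>C b) ` B)"
  proof (induction rule: l2.span_induct_alt)
    case base
    then show ?case by (rule span_zero)
  next
    case (step c b y)
    have "b \<in> span (B \<union> (\<lambda>b. \<i> *\<^sub>C b) ` B)"
      using step(1) by (intro span_base) auto
    then show ?case by (intro span_add span_insert_i_scaleC step)
  qed
qed

lemma bounded_operatorD:
  assumes "bounded_operator T"
  shows "bounded_linear T" "T (c *\<^sub>C x) = c *\<^sub>C T x"
  using assms by (auto simp: bounded_operator_def)

lemma bounded_operator_compose: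
  "bounded_operator S \<Longrightarrow> bounded_operator T \<Longrightarrow> bounded_operator (\<lambda>x. S (T x))"
  by (auto simp: bounded_operator_def intro: bounded_linear_compose)

text \<open>
  Gram-Schmidt for the real inner product, applied to \<open>B\<close> together with \<open>\<i> B\<close>. The resulting real projection is
  complex linear because both its range and the orthogonal complement are invariant under complex scalars.
  Orthogonality to \<open>b\<close> and to \<open>\<i> b\<close> with respect to the real inner product is orthogonality for the
  complex one.
\<close>

lemma orthogonal_projection_ex:
  fixes B :: "'a::euclidean_space l2 set"
  assumes "finite B"
  obtains P where "bounded_operator P" "range P \<subseteq> l2.span B"
    "\<And>x b. b \<in> B \<Longrightarrow> (x - P x) \<bullet> b = 0" "\<And>x b. b \<in> B \<Longrightarrow> (x - P x) \<bullet> (\<i> *\<^sub>C b) = 0"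
    "\<And>x. norm (x - P x) \<le> norm x"
proof -
  let ?B = "B \<union> (\<lambda>b. \<i> *\<^sub>C b) ` B"
  have "finite ?B" using assms by simp
  from basis_orthogonal[OF this] obtain C where
    C: "finite C" "span C = span ?B" "pairwise orthogonal C" by blast
  define P where "P x = (\<Sum>c\<in>C. ((x \<bullet> c) / (c \<bullet> c)) *\<^sub>R c)" for x
  have P_span: "P x \<in> span C" for x
    unfolding P_def by (intro span_sum span_scale span_base)
  have orth_C: "(x - P x) \<bullet> c = 0" if c: "c \<in> C" for x c
  proof -
    have "P x \<bullet> c = (\<Sum>b\<in>C. ((x \<bullet> b) / (b \<bullet> b)) * (b \<bullet> c))"
      by (simp add: P_def inner_sum_left)
    also have "\<dots> = (\<Sum>b\<in>C. if b = c then ((x \<bullet> b) / (b \<bullet> b)) * (b \<bullet> c) else 0)"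
      using C(3) c by (intro sum.cong refl) (auto simp: pairwise_def orthogonal_def)
    also have "\<dots> = ((x \<bullet> c) / (c \<bullet> c)) * (c \<bullet> c)"
      using C(1) c by simp
    also have "\<dots> = x \<bullet> c" by simp
    finally show ?thesis by (simp add: inner_diff_left)
  qed
  have orth: "(x - P x) \<bullet> y = 0" if "y \<in> span C" for x y
    using that
  proof (induction rule: span_induct_alt)
    case base
    then show ?case by simp
  next
    case (step r b y)
    then show ?case using orth_C by (simp add: inner_add_right)
  qed
  have unique: "P x = y" if y: "y \<in> span C" and o: "\<And>z. z \<in> span C \<Longrightarrow> (x - y) \<bullet> z = 0" for x y
  proof -
    have "(P x - y) \<bullet> (P x - y) = (x - y) \<bullet> (P x - y) - (x - P x) \<bullet> (P x - y)"
      by (simp add: inner_diff_left)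
    also have "\<dots> = 0"
      using o orth span_diff[OF P_span y] by simp
    finally show ?thesis by simp
  qed
  have P_C: "P (c *\<^sub>C x) = c *\<^sub>C P x" for c x
  proof (rule unique)
    show "c *\<^sub>C P x \<in> span C"
      using P_span[of x] span_insert_i_scaleC[of "P x" B c] by (simp add: C(2))
    fix z assume z: "z \<in> span C"
    then have "cnj c *\<^sub>C z \<in> span C"
      using span_insert_i_scaleC[of z B] by (simp add: C(2))
    then show "(c *\<^sub>C x - c *\<^sub>C P x) \<bullet> z = 0"
      unfolding l2.scale_right_diff_distrib[symmetric] inner_scaleC by (rule orth)
  qed
  have "bounded_linear P"
    unfolding P_def
    by (intro bounded_linear_sum bounded_linear_intros bounded_linear_scaleR_const
        bounded_linear_compose[OF bounded_linear_divide] bounded_linear_inner_left)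
  with P_C have 1: "bounded_operator P" by (simp add: bounded_operator_def)
  have 2: "range P \<subseteq> l2.span B"
    using P_span span_insert_i_subset[of B] C(2) by auto
  have 3: "norm (x - P x) \<le> norm x" for x
  proof -
    have "(norm ((x - P x) + P x))\<^sup>2 = (norm (x - P x))\<^sup>2 + (norm (P x))\<^sup>2"
      by (rule norm_add_Pythagorean) (simp add: orthogonal_def orth P_span)
    then have "(norm (x - P x))\<^sup>2 \<le> (norm x)\<^sup>2" by simp
    then show ?thesis by (rule power2_le_imp_le) simp
  qed
  have "b \<in> span C" "\<i> *\<^sub>C b \<in> span C" if "b \<in> B" for b
    using that by (auto simp: C(2) intro!: span_base)
  then show ?thesis using that[OF 1 2] orth 3 by blast
qed

text \<open>
  With respect to an orthogonal spanning set the coefficients of the vectors in a ball are bounded, so these vectors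
  lie in a sum of finitely many compact segments.
\<close>

lemma finite_span_bounded_subset_compact:
  fixes B :: "'a::real_inner set"
  assumes "finite B"
  shows "\<exists>K. compact K \<and> span B \<inter> cball 0 M \<subseteq> K"
proof -
  from basis_orthogonal[OF assms] obtain C where
    C: "finite C" "span C = span B" "pairwise orthogonal C" by blast
  define K where "K D = {\<Sum>c\<in>D. a c *\<^sub>R c | a. \<forall>c\<in>D. \<bar>a c\<bar> \<le> M / norm c}" for D :: "'a set"
  have comp: "compact (K D)" if "finite D" for D
    using that
  proof induction
    case empty
    then show ?case by (simp add: K_def)
  next
    case (insert d D)
    have "K (insert d D) = {x + y | x y. x \<in> (\<lambda>t. t *\<^sub>R d) ` {- (M / norm d)..M / norm d} \<and> y \<in> K D}"
      (is "_ = ?R")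
    proof (intro set_eqI iffI)
      fix z assume "z \<in> K (insert d D)"
      then obtain a where a: "z = (\<Sum>c\<in>insert d D. a c *\<^sub>R c)" "\<forall>c\<in>insert d D. \<bar>a c\<bar> \<le> M / norm c"
        by (auto simp: K_def)
      have "z = a d *\<^sub>R d + (\<Sum>c\<in>D. a c *\<^sub>R c)" using insert(1,2) a(1) by simp
      moreover have "a d *\<^sub>R d \<in> (\<lambda>t. t *\<^sub>R d) ` {- (M / norm d)..M / norm d}"
        using a(2) by (auto simp: abs_le_iff)
      moreover have "(\<Sum>c\<in>D. a c *\<^sub>R c) \<in> K D" using a(2) by (auto simp: K_def)
      ultimately show "z \<in> ?R" by blast
    next
      fix z assume "z \<in> ?R"
      then obtain t k where t: "z = t *\<^sub>R d + k" "t \<in> {- (M / norm d)..M / norm d}" and k: "k \<in> K D"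
        by blast
      from k obtain a where "k = (\<Sum>c\<in>D. a c *\<^sub>R c)" "\<forall>c\<in>D. \<bar>a c\<bar> \<le> M / norm c"
        unfolding K_def by blast
      with t have z: "\<bar>t\<bar> \<le> M / norm d" "\<forall>c\<in>D. \<bar>a c\<bar> \<le> M / norm c"
          "z = t *\<^sub>R d + (\<Sum>c\<in>D. a c *\<^sub>R c)"
        by auto
      have "(\<Sum>c\<in>D. a c *\<^sub>R c) = (\<Sum>c\<in>D. (a(d := t)) c *\<^sub>R c)"
        using insert(2) by (intro sum.cong) auto
      then have "z = (\<Sum>c\<in>insert d D. (a(d := t)) c *\<^sub>R c)"
        using insert(1,2) z(3) by simp
      then show "z \<in> K (insert d D)"
        using z unfolding K_def by (intro CollectI exI[of _ "a(d := t)"]) auto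
    qed
    also have "compact \<dots>"
      by (intro compact_sums insert compact_continuous_image continuous_intros) auto
    finally show ?case .
  qed
  have "span B \<inter> cball 0 M \<subseteq> K C"
  proof
    fix x assume "x \<in> span B \<inter> cball 0 M"
    then have x: "x \<in> span C" "norm x \<le> M" by (auto simp: C(2))
    then obtain a where a: "x = (\<Sum>c\<in>C. a c *\<^sub>R c)" using span_finite[OF C(1)] by auto
    have bound: "\<bar>a c\<bar> \<le> M / norm c" if c: "c \<in> C" "c \<noteq> 0" for c
    proof -
      have "x \<bullet> c = (\<Sum>b\<in>C. a b * (b \<bullet> c))"
        by (simp add: a inner_sum_left)
      also have "\<dots> = (\<Sum>b\<in>C. if b = c then a b * (b \<bullet> c) else 0)"
        using C(3) c by (intro sum.cong refl) (auto simp: pairwise_def orthogonal_def)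
      also have "\<dots> = a c * (norm c * norm c)"
        using C(1) c by (simp add: dot_square_norm power2_eq_square)
      finally have "\<bar>a c\<bar> * (norm c * norm c) \<le> norm x * norm c"
        using Cauchy_Schwarz_ineq2[of x c] by (simp add: abs_mult)
      also have "\<dots> \<le> M * norm c" using x by (intro mult_right_mono) auto
      finally have "\<bar>a c\<bar> * norm c * norm c \<le> M * norm c" by (simp add: mult.assoc)
      then have "\<bar>a c\<bar> * norm c \<le> M" using c by simp
      then show ?thesis using c by (simp add: field_simps)
    qed
    define a' where "a' c = (if c = 0 then 0 else a c)" for c
    have "x = (\<Sum>c\<in>C. a' c *\<^sub>R c)"
      unfolding a a'_def by (intro sum.cong) auto
    moreover have "\<forall>c\<in>C. \<bar>a' c\<bar> \<le> M / norm c"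
      using bound by (auto simp: a'_def)
    ultimately show "x \<in> K C" unfolding K_def by blast
  qed
  with comp[OF C(1)] show ?thesis by blast
qed

section \<open>A criterion for weak Schatten ideals\<close>

lemma rank_at_most_mono: "rank_at_most k S \<Longrightarrow> k \<le> k' \<Longrightarrow> rank_at_most k' S"
  by (auto simp: rank_at_most_def)

lemma bounded_operator_0: "bounded_operator (\<lambda>x. 0)"
  by (simp add: bounded_operator_def l2.scale_zero_right)

lemma rank_at_most_0: "rank_at_most k (\<lambda>x. 0)"
  unfolding rank_at_most_def by (rule exI[of _ "{}"]) (simp add: l2.span_zero)

lemma finite_rank_image_compact:
  fixes S :: "'a::euclidean_space l2 \<Rightarrow> 'a l2"
  assumes S: "bounded_operator S" "rank_at_most k S"
  shows "\<exists>K. compact K \<and> S ` cball 0 1 \<subseteq> K"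
proof -
  from S(2) obtain B where B: "finite B" "range S \<subseteq> l2.span B"
    unfolding rank_at_most_def by blast
  let ?B = "B \<union> (\<lambda>b. \<i> *\<^sub>C b) ` B"
  have "finite ?B" using B by simp
  from finite_span_bounded_subset_compact[OF this] obtain K
    where K: "compact K" "span ?B \<inter> cball 0 (onorm S) \<subseteq> K" by blast
  have "S ` cball 0 1 \<subseteq> span ?B \<inter> cball 0 (onorm S)"
  proof
    fix y assume "y \<in> S ` cball 0 1"
    then obtain x where x: "norm x \<le> 1" "y = S x" by auto
    have "norm (S x) \<le> onorm S * norm x"
      by (rule onorm[OF bounded_operatorD(1)[OF S(1)]])
    also have "\<dots> \<le> onorm S * 1"
      using x onorm_pos_le[OF bounded_operatorD(1)[OF S(1)]] by (intro mult_left_mono) auto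
    finally show "y \<in> span ?B \<inter> cball 0 (onorm S)"
      using x B l2_span_subset[of B] by auto
  qed
  with K show ?thesis by blast
qed

text \<open>
  The image of the unit ball is within \<open>\<epsilon>\<close> of the image under a finite-rank operator, which is contained in a compact
  set; so it is totally bounded.
\<close>

lemma compact_operator_approx:
  fixes T :: "'a::euclidean_space l2 \<Rightarrow> 'a l2"
  assumes T: "bounded_operator T"
    and approx: "\<And>\<epsilon>. 0 < \<epsilon> \<Longrightarrow>
      \<exists>S k. bounded_operator S \<and> rank_at_most k S \<and> onorm (\<lambda>x. T x - S x) \<le> \<epsilon>"
  shows "compact_operator T"
proof -
  have "compact (closure (T ` cball 0 1))"
    unfolding compact_eq_totally_bounded
  proof (intro conjI allI impI)
    show "complete (closure (T ` cball 0 1))"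
      by (simp add: complete_eq_closed)
    fix e :: real assume e: "0 < e"
    then obtain S k where S: "bounded_operator S" "rank_at_most k S" "onorm (\<lambda>x. T x - S x) \<le> e / 4"
      using approx[of "e / 4"] by auto
    from finite_rank_image_compact[OF S(1,2)] obtain K
      where K: "compact K" "S ` cball 0 1 \<subseteq> K" by blast
    from K(1) e obtain F where F: "finite F" "K \<subseteq> (\<Union>x\<in>F. ball x (e / 4))"
      unfolding compact_eq_totally_bounded by (meson zero_less_divide_iff zero_less_numeral)
    have TS: "bounded_linear (\<lambda>x. T x - S x)"
      using T S by (intro bounded_linear_sub bounded_operatorD)
    have "closure (T ` cball 0 1) \<subseteq> (\<Union>x\<in>F. ball x e)"
    proof
      fix y assume "y \<in> closure (T ` cball 0 1)"
      then obtain x where x: "norm x \<le> 1" "dist (T x) y < e / 4"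
        using e unfolding closure_approachable by (metis (no_types, opaque_lifting) divide_pos_pos
            imageE mem_cball_0 zero_less_numeral)
      have "norm (T x - S x) \<le> onorm (\<lambda>x. T x - S x) * norm x"
        by (rule onorm[OF TS])
      also have "\<dots> \<le> e / 4 * 1"
        using x S(3) e by (intro mult_mono) auto
      finally have TSx: "dist (T x) (S x) \<le> e / 4" by (simp add: dist_norm)
      have "S x \<in> K" using K(2) x(1) by auto
      then obtain z where z: "z \<in> F" "dist z (S x) < e / 4" using F(2) by auto
      have "dist z y \<le> dist z (S x) + dist (S x) (T x) + dist (T x) y"
        by (meson add_right_mono dist_triangle order_trans)
      then have "dist z y < e" using e z(2) x(2) TSx dist_commute[of "S x" "T x"] by linarith
      then show "y \<in> (\<Union>x\<in>F. ball x e)" using z by auto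
    qed
    with F(1) show "\<exists>k. finite k \<and> closure (T ` cball 0 1) \<subseteq> (\<Union>x\<in>k. ball x e)" by blast
  qed
  with T show ?thesis by (simp add: compact_operator_def)
qed

lemma singular_value_le:
  assumes "bounded_operator T" "bounded_operator S" "rank_at_most k S"
  shows "singular_value k T \<le> onorm (\<lambda>x. T x - S x)"
  unfolding singular_value_def
proof (rule cINF_lower)
  show "bdd_below ((\<lambda>R. onorm (\<lambda>x. T x - R x)) ` {R. bounded_operator R \<and> rank_at_most k R})"
    using bounded_operatorD(1)[OF assms(1)]
    by (intro bdd_belowI[where m = 0]) (auto intro!: onorm_pos_le bounded_linear_sub dest!: bounded_operatorD(1))
qed (use assms in auto)

text \<open>
  The rank is allowed to be anything below \<open>C R^d\<close>, and \<open>R\<close> is a real parameter, so that it can be adjusted to the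
  index of a given singular value.
\<close>

lemma weak_schattenI:
  fixes T :: "'a::euclidean_space l2 \<Rightarrow> 'a l2"
  assumes T: "bounded_operator T" and pos: "0 < a" "0 < d" "0 < C" and E: "0 \<le> E"
    and approx: "\<And>R. 1 \<le> R \<Longrightarrow> \<exists>S k. bounded_operator S \<and> rank_at_most k S \<and>
      real k < C * R powr d \<and> onorm (\<lambda>x. T x - S x) \<le> E * R powr (- a)"
  shows "T \<in> weak_schatten (d / a)"
proof -
  have "compact_operator T"
  proof (rule compact_operator_approx[OF T])
    fix e :: real assume e: "0 < e"
    define R where "R = max 1 ((E / e) powr (1 / a))"
    have R: "1 \<le> R" by (simp add: R_def)
    have "E / e = ((E / e) powr (1 / a)) powr a"
      using pos E e by (simp add: powr_powr)
    also have "\<dots> \<le> R powr a"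
      unfolding R_def using pos by (intro powr_mono2) auto
    finally have "E * R powr (- a) \<le> e"
      using e R by (simp add: powr_minus field_simps)
    then show "\<exists>S k. bounded_operator S \<and> rank_at_most k S \<and> onorm (\<lambda>x. T x - S x) \<le> e"
      using approx[OF R] by (meson order_trans)
  qed
  moreover have "bdd_above (range (\<lambda>k. real (k + 1) powr (1 / (d / a)) * singular_value k T))"
  proof (rule bdd_aboveI2)
    fix k :: nat
    have ad: "1 / (d / a) = a / d" by simp
    let ?b = "C powr (a / d) * max E (onorm T)"
    show "real (k + 1) powr (1 / (d / a)) * singular_value k T \<le> ?b"
    proof (cases "C \<le> real (k + 1)")
      case True
      \<comment> \<open>chosen so that \<open>C R^d = k + 1\<close>; then a rank below \<open>C R^d\<close> is at most \<open>k\<close>\<close>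
      define R where "R = (real (k + 1) / C) powr (1 / d)"
      have "1 \<le> real (k + 1) / C" using True pos by (simp add: field_simps)
      then have R: "1 \<le> R" unfolding R_def using pos by (intro ge_one_powr_ge_zero) auto
      have Rd: "C * R powr d = real (k + 1)"
        using pos by (simp add: R_def powr_powr)
      have Ra: "R powr (- a) = C powr (a / d) * real (k + 1) powr (- (a / d))"
        using pos by (simp add: R_def powr_powr powr_divide powr_minus field_simps)
      from approx[OF R] obtain S k' where S: "bounded_operator S" "rank_at_most k' S"
        "real k' < real (k + 1)" "onorm (\<lambda>x. T x - S x) \<le> E * R powr (- a)"
        unfolding Rd by blast
      have "rank_at_most k S" by (rule rank_at_most_mono[OF S(2)]) (use S(3) in auto)
      then have "singular_value k T \<le> E * R powr (- a)"
        using singular_value_le[OF T S(1)] S(4) by (meson order_trans)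
      then have "real (k + 1) powr (a / d) * singular_value k T
          \<le> real (k + 1) powr (a / d) * (E * R powr (- a))"
        by (rule mult_left_mono) simp
      also have "\<dots> = (real (k + 1) powr (a / d) * real (k + 1) powr (- (a / d))) * (C powr (a / d) * E)"
        unfolding Ra by (simp only: mult_ac)
      also have "\<dots> = C powr (a / d) * E"
        by (simp flip: powr_add)
      also have "\<dots> \<le> ?b" by (intro mult_left_mono) auto
      finally show ?thesis unfolding ad .
    next
      case False
      \<comment> \<open>only finitely many \<open>k\<close> are left, and for them the zero operator suffices\<close>
      have "singular_value k T \<le> onorm (\<lambda>x. T x - 0)"
        by (rule singular_value_le[OF T bounded_operator_0 rank_at_most_0])
      then have "real (k + 1) powr (a / d) * singular_value k T \<le> real (k + 1) powr (a / d) * onorm T"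
        by (intro mult_left_mono) auto
      also have "\<dots> \<le> C powr (a / d) * onorm T"
        using False pos onorm_pos_le[OF bounded_operatorD(1)[OF T]]
        by (intro mult_right_mono powr_mono2) auto
      also have "\<dots> \<le> ?b" by (intro mult_left_mono) auto
      finally show ?thesis unfolding ad .
    qed
  qed
  ultimately show ?thesis by (simp add: weak_schatten_def)
qed

section \<open>Functions with bounded derivatives and Taylor polynomials\<close>

abbreviation gradient :: "('a::euclidean_space \<Rightarrow> 'a \<Rightarrow> complex) \<Rightarrow> 'a \<Rightarrow> 'a \<Rightarrow> complex" where
  "gradient D x \<equiv> \<lambda>h. \<Sum>e\<in>Basis. of_real (h \<bullet> e) * D e x"

text \<open>
  All partial derivatives of order at most \<open>m\<close> exist and are bounded by the same function \<open>B\<close>. The common bound is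
  no real loss here, since differentiation never makes the weights grow, and it makes the estimates closed under products
  by a simple induction.
\<close>

primrec derivs_bounded :: "nat \<Rightarrow> ('a::euclidean_space \<Rightarrow> complex) \<Rightarrow> ('a \<Rightarrow> real) \<Rightarrow> bool" where
  "derivs_bounded 0 f B \<longleftrightarrow> (\<forall>x. norm (f x) \<le> B x)"
| "derivs_bounded (Suc m) f B \<longleftrightarrow> (\<forall>x. norm (f x) \<le> B x) \<and>
     (\<exists>D. (\<forall>x. (f has_derivative (gradient D x)) (at x)) \<and>
          (\<forall>e\<in>Basis. derivs_bounded m (D e) B))"

lemma derivs_boundedD: "derivs_bounded m f B \<Longrightarrow> norm (f x) \<le> B x"
  by (cases m) auto

lemma derivs_bounded_SucI:
  assumes "\<And>x. norm (f x) \<le> B x"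
    and "\<And>x. (f has_derivative (gradient D x)) (at x)"
    and "\<And>e. e \<in> Basis \<Longrightarrow> derivs_bounded m (D e) B"
  shows "derivs_bounded (Suc m) f B"
  using assms by auto

lemma derivs_bounded_SucE:
  assumes "derivs_bounded (Suc m) f B"
  obtains D where "\<And>x. (f has_derivative (gradient D x)) (at x)"
    "\<And>e. e \<in> Basis \<Longrightarrow> derivs_bounded m (D e) B"
  using assms by auto

lemma derivs_bounded_mono:
  "derivs_bounded m f A \<Longrightarrow> (\<And>x. A x \<le> B x) \<Longrightarrow> derivs_bounded m f B"
proof (induction m arbitrary: f)
  case 0
  have "norm (f x) \<le> B x" for x
    using derivs_boundedD[OF "0.prems"(1), of x] "0.prems"(2)[of x] by linarith
  then show ?case by simp
next
  case (Suc m)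
  from Suc.prems(1) obtain D where
    D: "\<And>x. (f has_derivative (gradient D x)) (at x)"
      "\<And>e. e \<in> Basis \<Longrightarrow> derivs_bounded m (D e) A" using derivs_bounded_SucE by blast
  show ?case
    by (rule derivs_bounded_SucI[OF _ D(1) Suc.IH[OF D(2) Suc.prems(2)]])
       (auto intro: order_trans[OF derivs_boundedD[OF Suc.prems(1)] Suc.prems(2)])
qed

lemma derivs_bounded_Suc_imp: "derivs_bounded (Suc m) f B \<Longrightarrow> derivs_bounded m f B"
proof (induction m arbitrary: f)
  case 0
  then show ?case by auto
next
  case (Suc m)
  from Suc.prems obtain D where
    D: "\<And>x. (f has_derivative (gradient D x)) (at x)"
      "\<And>e. e \<in> Basis \<Longrightarrow> derivs_bounded (Suc m) (D e) B" using derivs_bounded_SucE by blast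
  show ?case
    by (rule derivs_bounded_SucI[OF derivs_boundedD[OF Suc.prems] D(1) Suc.IH[OF D(2)]])
qed

lemma derivs_bounded_zero:
  "(\<And>x. 0 \<le> B x) \<Longrightarrow> derivs_bounded m (\<lambda>x. 0) B"
proof (induction m)
  case (Suc m)
  then show ?case
    by (intro derivs_bounded_SucI[where D = "\<lambda>e x. 0"]) auto
qed simp

lemma derivs_bounded_constant:
  assumes "\<And>x. norm c \<le> B x"
  shows "derivs_bounded m (\<lambda>x. c) B"
proof (cases m)
  case (Suc k)
  have "0 \<le> B x" for x using assms[of x] norm_ge_zero[of c] by linarith
  then show ?thesis
    unfolding Suc using assms by (intro derivs_bounded_SucI[where D = "\<lambda>e x. 0"] derivs_bounded_zero) auto
qed (use assms in simp)

lemma derivs_bounded_add: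
  "derivs_bounded m f A \<Longrightarrow> derivs_bounded m g B \<Longrightarrow> derivs_bounded m (\<lambda>x. f x + g x) (\<lambda>x. A x + B x)"
proof (induction m arbitrary: f g)
  case 0
  then show ?case by (auto intro: norm_triangle_le add_mono)
next
  case (Suc m)
  from Suc.prems(1) obtain D where
    D: "\<And>x. (f has_derivative (gradient D x)) (at x)"
      "\<And>e. e \<in> Basis \<Longrightarrow> derivs_bounded m (D e) A" using derivs_bounded_SucE by blast
  from Suc.prems(2) obtain D' where
    D': "\<And>x. (g has_derivative (gradient D' x)) (at x)"
      "\<And>e. e \<in> Basis \<Longrightarrow> derivs_bounded m (D' e) B" using derivs_bounded_SucE by blast
  show ?case
  proof (rule derivs_bounded_SucI)
    show "norm (f x + g x) \<le> A x + B x" for x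
      using Suc.prems by (intro norm_triangle_le add_mono derivs_boundedD)
    show "((\<lambda>x. f x + g x) has_derivative (\<lambda>h. \<Sum>e\<in>Basis. of_real (h \<bullet> e) * (D e x + D' e x))) (at x)" for x
      using has_derivative_add[OF D(1) D'(1)] by (simp add: algebra_simps sum.distrib)
    show "derivs_bounded m (\<lambda>x. D e x + D' e x) (\<lambda>x. A x + B x)" if "e \<in> Basis" for e
      by (rule Suc.IH[OF D(2) D'(2)]) (use that in auto)
  qed
qed

text \<open>The factor \<open>2 ^ m\<close> counts the terms of the Leibniz rule without binomial coefficients: each differentiation doubles them.\<close>

lemma derivs_bounded_mult:
  "derivs_bounded m f A \<Longrightarrow> derivs_bounded m g B \<Longrightarrow>
    derivs_bounded m (\<lambda>x. f x * g x) (\<lambda>x. 2 ^ m * (A x * B x))"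
proof (induction m arbitrary: f g)
  case 0
  have "norm (f x * g x) \<le> A x * B x" for x
  proof -
    have "norm (f x) \<le> A x" "norm (g x) \<le> B x"
      using "0.prems" by (auto dest: derivs_boundedD)
    then show ?thesis
      unfolding norm_mult using norm_ge_zero[of "f x"] norm_ge_zero[of "g x"] by (intro mult_mono) linarith+
  qed
  then show ?case by simp
next
  case (Suc m)
  from Suc.prems(1) obtain D where
    D: "\<And>x. (f has_derivative (gradient D x)) (at x)"
      "\<And>e. e \<in> Basis \<Longrightarrow> derivs_bounded m (D e) A" using derivs_bounded_SucE by blast
  from Suc.prems(2) obtain D' where
    D': "\<And>x. (g has_derivative (gradient D' x)) (at x)"
      "\<And>e. e \<in> Basis \<Longrightarrow> derivs_bounded m (D' e) B" using derivs_bounded_SucE by blast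
  have f: "derivs_bounded m f A" and g: "derivs_bounded m g B"
    using Suc.prems by (auto intro: derivs_bounded_Suc_imp simp del: derivs_bounded.simps)
  show ?case
  proof (rule derivs_bounded_SucI)
    fix x
    have A: "0 \<le> A x" and B: "0 \<le> B x"
      using derivs_boundedD[OF f, of x] derivs_boundedD[OF g, of x] norm_ge_zero[of "f x"] norm_ge_zero[of "g x"]
      by linarith+
    have "norm (f x * g x) \<le> 1 * (A x * B x)"
      using derivs_boundedD[OF f, of x] derivs_boundedD[OF g, of x] A
      by (auto simp: norm_mult intro!: mult_mono)
    also have "\<dots> \<le> 2 ^ Suc m * (A x * B x)"
      using A B by (intro mult_right_mono one_le_power) auto
    finally show "norm (f x * g x) \<le> 2 ^ Suc m * (A x * B x)" .
    have "(\<lambda>h. f x * (\<Sum>e\<in>Basis. of_real (h \<bullet> e) * D' e x) + (\<Sum>e\<in>Basis. of_real (h \<bullet> e) * D e x) * g x)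
      = (\<lambda>h. \<Sum>e\<in>Basis. of_real (h \<bullet> e) * (D e x * g x + f x * D' e x))"
      by (simp add: fun_eq_iff sum_distrib_left sum_distrib_right algebra_simps sum.distrib)
    then show "((\<lambda>x. f x * g x) has_derivative
        (\<lambda>h. \<Sum>e\<in>Basis. of_real (h \<bullet> e) * (D e x * g x + f x * D' e x))) (at x)"
      using has_derivative_mult[OF D(1)[of x] D'(1)[of x]] by simp
  next
    fix e :: 'a assume e: "e \<in> Basis"
    have "derivs_bounded m (\<lambda>x. D e x * g x + f x * D' e x)
        (\<lambda>x. 2 ^ m * (A x * B x) + 2 ^ m * (A x * B x))"
      by (rule derivs_bounded_add[OF Suc.IH[OF D(2)[OF e] g] Suc.IH[OF f D'(2)[OF e]]])
    then show "derivs_bounded m (\<lambda>x. D e x * g x + f x * D' e x) (\<lambda>x. 2 ^ Suc m * (A x * B x))"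
      by (simp add: algebra_simps)
  qed
qed

lemma derivs_bounded_cmult:
  assumes "derivs_bounded m f A"
  shows "derivs_bounded m (\<lambda>x. c * f x) (\<lambda>x. norm c * A x)"
  using assms
proof (induction m arbitrary: f)
  case 0
  then show ?case by (auto simp: norm_mult intro!: mult_left_mono)
next
  case (Suc m)
  from Suc.prems(1) obtain D where
    D: "\<And>x. (f has_derivative (gradient D x)) (at x)"
      "\<And>e. e \<in> Basis \<Longrightarrow> derivs_bounded m (D e) A" using derivs_bounded_SucE by blast
  show ?case
  proof (rule derivs_bounded_SucI[OF _ _ Suc.IH[OF D(2)]])
    show "norm (c * f x) \<le> norm c * A x" for x
      using derivs_boundedD[OF Suc.prems] by (auto simp: norm_mult intro!: mult_left_mono)
    show "((\<lambda>x. c * f x) has_derivative (\<lambda>h. \<Sum>e\<in>Basis. of_real (h \<bullet> e) * (c * D e x))) (at x)" for x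
      using has_derivative_mult_right[OF D(1)[of x], of c]
      by (simp add: sum_distrib_left mult.left_commute)
  qed
qed

lemma derivs_bounded_reflect:
  assumes "derivs_bounded m f A"
  shows "derivs_bounded m (\<lambda>x. f (r - x)) (\<lambda>x. A (r - x))"
  using assms
proof (induction m arbitrary: f)
  case (Suc m)
  from Suc.prems(1) obtain D where
    D: "\<And>x. (f has_derivative (gradient D x)) (at x)"
      "\<And>e. e \<in> Basis \<Longrightarrow> derivs_bounded m (D e) A" using derivs_bounded_SucE by blast
  show ?case
  proof (rule derivs_bounded_SucI)
    show "norm (f (r - x)) \<le> A (r - x)" for x by (rule derivs_boundedD[OF Suc.prems])
    have "((\<lambda>x. f (r - x)) has_derivative (\<lambda>h. \<Sum>e\<in>Basis. of_real ((0 - h) \<bullet> e) * D e (r - x))) (at x)" for x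
      by (rule has_derivative_compose[of "\<lambda>x. r - x" "\<lambda>h. 0 - h", OF _ D(1)])
         (intro derivative_intros)
    then show "((\<lambda>x. f (r - x)) has_derivative (\<lambda>h. \<Sum>e\<in>Basis. of_real (h \<bullet> e) * ((- 1) * D e (r - x)))) (at x)" for x
      by simp
    show "derivs_bounded m (\<lambda>x. (- 1) * D e (r - x)) (\<lambda>x. A (r - x))" if "e \<in> Basis" for e
      using derivs_bounded_cmult[OF Suc.IH[OF D(2)[OF that]], of "-1"] by simp
  qed
qed simp

text \<open>
  Words in the basis vectors serve as multi-indices. Different words may give the same monomial, which only
  affects constants.
\<close>

definition basis_words :: "nat \<Rightarrow> 'a::euclidean_space list set" where
  "basis_words m = {l. set l \<subseteq> Basis \<and> length l < m}"

definition monomial :: "'a::euclidean_space list \<Rightarrow> 'a \<Rightarrow> real" where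
  "monomial l y = prod_list (map (\<lambda>e. y \<bullet> e) l)"

abbreviation word_poly :: "nat \<Rightarrow> ('a::euclidean_space list \<Rightarrow> complex) \<Rightarrow> 'a \<Rightarrow> complex" where
  "word_poly m c y \<equiv> \<Sum>l\<in>basis_words m. c l * of_real (monomial l y)"

lemma finite_basis_words: "finite (basis_words m)"
proof -
  have "basis_words m \<subseteq> {l. set l \<subseteq> Basis \<and> length l \<le> m}" by (auto simp: basis_words_def)
  then show ?thesis using finite_lists_length_le[OF finite_Basis] finite_subset by blast
qed

lemma basis_words_0: "basis_words 0 = {}"
  by (simp add: basis_words_def)

lemma basis_words_Suc:
  "basis_words (Suc m) = insert [] ((\<lambda>(e, l). e # l) ` (Basis \<times> basis_words m))"
proof (intro set_eqI iffI)
  fix l :: "'a list" assume "l \<in> basis_words (Suc m)"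
  then show "l \<in> insert [] ((\<lambda>(e, l). e # l) ` (Basis \<times> basis_words m))"
    by (cases l) (auto simp: basis_words_def)
qed (auto simp: basis_words_def)

lemma sum_basis_words_Suc:
  "(\<Sum>l\<in>basis_words (Suc m). f l) = f [] + (\<Sum>e\<in>Basis. \<Sum>l\<in>basis_words m. f (e # l))"
proof -
  have "(\<Sum>l\<in>basis_words (Suc m). f l) = f [] + (\<Sum>l\<in>(\<lambda>(e, l). e # l) ` (Basis \<times> basis_words m). f l)"
    unfolding basis_words_Suc by (subst sum.insert) (auto simp: finite_basis_words)
  also have "(\<Sum>l\<in>(\<lambda>(e, l). e # l) ` (Basis \<times> basis_words m). f l)
      = (\<Sum>(e, l)\<in>Basis \<times> basis_words m. f (e # l))"
    by (subst sum.reindex) (auto simp: inj_on_def case_prod_unfold)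
  finally show ?thesis by (simp add: sum.cartesian_product)
qed

lemma monomial_Cons: "monomial (e # l) y = (y \<bullet> e) * monomial l y"
  by (simp add: monomial_def)

lemma monomial_scaleR: "monomial l (t *\<^sub>R y) = t ^ length l * monomial l y"
  by (induction l) (auto simp: monomial_def)

text \<open>
  Taylor's theorem in the form that is needed: the existence of coefficients that work for all \<open>x\<close>
  simultaneously. By induction each first derivative \<open>D e\<close> has such an approximation of lower degree. Integrating these
  along the segment from \<open>q\<close> to \<open>x\<close> divides the coefficient of a monomial of degree \<open>n\<close> by \<open>n + 1\<close>, and
  the error is then controlled by the mean value inequality on the segment. The dimension enters as the number of
  first derivatives.
\<close>

lemma taylor_bound:
  fixes f :: "'a::euclidean_space \<Rightarrow> complex"
  assumes "derivs_bounded m f B"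
  shows "\<exists>c. \<forall>x h b. (\<forall>z\<in>closed_segment q x. B z \<le> b) \<longrightarrow> (\<forall>e\<in>Basis. \<bar>(x - q) \<bullet> e\<bar> \<le> h) \<longrightarrow>
    norm (f x - word_poly m c (x - q)) \<le> b * (real DIM('a) * h) ^ m"
  using assms
proof (induction m arbitrary: f)
  case 0
  have "norm (f x) \<le> b" if "\<forall>z\<in>closed_segment q x. B z \<le> b" for x b
    using that[rule_format, of x] derivs_boundedD[OF 0, of x] by simp
  then show ?case by (auto simp: basis_words_0)
next
  case (Suc m)
  from Suc.prems(1) obtain D where
    D: "\<And>x. (f has_derivative (gradient D x)) (at x)"
      "\<And>e. e \<in> Basis \<Longrightarrow> derivs_bounded m (D e) B" using derivs_bounded_SucE by blast
  have "\<forall>e\<in>Basis. \<exists>c. \<forall>x h b. (\<forall>z\<in>closed_segment q x. B z \<le> b) \<longrightarrow> (\<forall>e\<in>Basis. \<bar>(x - q) \<bullet> e\<bar> \<le> h) \<longrightarrow>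
    norm (D e x - word_poly m c (x - q)) \<le> b * (real DIM('a) * h) ^ m"
    by (intro ballI Suc.IH D(2))
  from bchoice[OF this] obtain c where c: "\<forall>e\<in>Basis. \<forall>x h b. (\<forall>z\<in>closed_segment q x. B z \<le> b) \<longrightarrow>
      (\<forall>e\<in>Basis. \<bar>(x - q) \<bullet> e\<bar> \<le> h) \<longrightarrow>
      norm (D e x - word_poly m (c e) (x - q)) \<le> b * (real DIM('a) * h) ^ m" ..
  define c' where "c' l = (if l = [] then f q else c (hd l) (tl l) / of_nat (length l))" for l
  show ?case
  proof (intro exI[of _ c'] allI impI)
    fix x h b
    assume b: "\<forall>z\<in>closed_segment q x. B z \<le> b" and h: "\<forall>e\<in>Basis. \<bar>(x - q) \<bullet> e\<bar> \<le> h"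
    define y where "y = x - q"
    define d where "d = real DIM('a)"
    have d: "0 \<le> d" by (simp add: d_def)
    have h0: "0 \<le> h" using h[rule_format, OF SOME_Basis] by linarith
    \<comment> \<open>\<open>P\<close> is the new polynomial and \<open>p e\<close> the one for \<open>D e\<close>, both restricted to the segment \<open>q + t y\<close>\<close>
    define p where "p e t = word_poly m (c e) (t *\<^sub>R y)" for e t
    define P where "P t = word_poly (Suc m) c' (t *\<^sub>R y)" for t :: real
    have P_eq: "P t = f q + (\<Sum>e\<in>Basis. \<Sum>l\<in>basis_words m.
        of_real (t ^ Suc (length l)) * (c e l / of_nat (Suc (length l)) * of_real ((y \<bullet> e) * monomial l y)))" for t
      unfolding P_def sum_basis_words_Suc
      by (simp add: c'_def monomial_scaleR monomial_Cons mult_ac del: of_nat_Suc power_Suc)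
         (simp add: monomial_def)
    have dP: "(P has_vector_derivative (\<Sum>e\<in>Basis. of_real (y \<bullet> e) * p e t)) (at t within T)" for t T
    proof -
      have dpow: "((\<lambda>t. complex_of_real (t ^ Suc n)) has_vector_derivative of_real (real (Suc n) * t ^ n)) (at t within T)" for n
        by (rule has_vector_derivative_of_real) (auto intro!: derivative_eq_intros simp del: power_Suc of_nat_Suc)
      have "(P has_vector_derivative 0 + (\<Sum>e\<in>Basis. \<Sum>l\<in>basis_words m. of_real (real (Suc (length l)) * t ^ length l) *
          (c e l / of_nat (Suc (length l)) * of_real ((y \<bullet> e) * monomial l y)))) (at t within T)"
        unfolding P_eq[abs_def]
        by (intro has_vector_derivative_add has_vector_derivative_const has_vector_derivative_sum
            has_vector_derivative_mult_left dpow)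
      also have "0 + (\<Sum>e\<in>Basis. \<Sum>l\<in>basis_words m. of_real (real (Suc (length l)) * t ^ length l) *
          (c e l / of_nat (Suc (length l)) * of_real ((y \<bullet> e) * monomial l y))) = (\<Sum>e\<in>Basis. of_real (y \<bullet> e) * p e t)"
        by (simp add: p_def sum_distrib_left monomial_scaleR mult_ac del: of_nat_Suc)
      finally show ?thesis .
    qed
    define u where "u t = f (q + t *\<^sub>R y) - P t" for t
    have du: "(u has_vector_derivative (\<Sum>e\<in>Basis. of_real (y \<bullet> e) * (D e (q + t *\<^sub>R y) - p e t))) (at t within T)" for t T
    proof -
      have "((\<lambda>t. f (q + t *\<^sub>R y)) has_derivative (\<lambda>s. \<Sum>e\<in>Basis. of_real ((s *\<^sub>R y) \<bullet> e) * D e (q + t *\<^sub>R y))) (at t within T)"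
        by (rule has_derivative_compose[of "\<lambda>t. q + t *\<^sub>R y" "\<lambda>s. s *\<^sub>R y", OF _ D(1)])
           (auto intro!: derivative_eq_intros)
      then have "((\<lambda>t. f (q + t *\<^sub>R y)) has_vector_derivative (\<Sum>e\<in>Basis. of_real (y \<bullet> e) * D e (q + t *\<^sub>R y))) (at t within T)"
        unfolding has_vector_derivative_def
        by (rule has_derivative_eq_rhs) (simp add: fun_eq_iff sum_distrib_left scaleR_conv_of_real mult.assoc)
      from has_vector_derivative_diff[OF this dP] show ?thesis
        unfolding u_def by (simp add: sum_subtractf right_diff_distrib)
    qed
    have "norm (u 1 - u 0) \<le> (b * (d * h) ^ Suc m) * norm (1 - 0 :: real)"
    proof (rule differentiable_bound[where S = "{0..1}"])
      show "(u has_derivative (\<lambda>s. s *\<^sub>R (\<Sum>e\<in>Basis. of_real (y \<bullet> e) * (D e (q + t *\<^sub>R y) - p e t)))) (at t within {0..1})" for t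
        using du unfolding has_vector_derivative_def .
      fix t :: real assume t: "t \<in> {0..1}"
      let ?z = "q + t *\<^sub>R y"
      have z: "?z \<in> closed_segment q x"
        using t by (auto simp: y_def closed_segment_def algebra_simps intro!: exI[of _ t])
      have zb: "\<forall>w\<in>closed_segment q ?z. B w \<le> b"
        using b closed_segment_subset[OF _ z convex_closed_segment] by auto
      have zh: "\<forall>e\<in>Basis. \<bar>(?z - q) \<bullet> e\<bar> \<le> h"
      proof
        fix e :: 'a assume e: "e \<in> Basis"
        have "\<bar>(?z - q) \<bullet> e\<bar> = t * \<bar>y \<bullet> e\<bar>" using t by (simp add: abs_mult)
        also have "\<dots> \<le> 1 * \<bar>y \<bullet> e\<bar>" using t by (intro mult_right_mono) auto
        finally show "\<bar>(?z - q) \<bullet> e\<bar> \<le> h" using h e by (auto simp: y_def)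
      qed
      have "norm (\<Sum>e\<in>Basis. of_real (y \<bullet> e) * (D e ?z - p e t)) \<le> (\<Sum>e\<in>(Basis::'a set). h * (b * (d * h) ^ m))"
      proof (rule sum_norm_le)
        fix e :: 'a assume e: "e \<in> Basis"
        have "norm (D e ?z - p e t) \<le> b * (d * h) ^ m"
          using c[rule_format, OF e zb[rule_format] zh[rule_format]] by (simp add: p_def d_def)
        moreover have "\<bar>y \<bullet> e\<bar> \<le> h" using h e by (simp add: y_def)
        ultimately show "norm (of_real (y \<bullet> e) * (D e ?z - p e t)) \<le> h * (b * (d * h) ^ m)"
          unfolding norm_mult norm_of_real using h0 by (intro mult_mono) auto
      qed
      then have "norm (\<Sum>e\<in>Basis. of_real (y \<bullet> e) * (D e ?z - p e t)) \<le> b * (d * h) ^ Suc m"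
        by (simp add: d_def mult_ac)
      then show "onorm (\<lambda>s. s *\<^sub>R (\<Sum>e\<in>Basis. of_real (y \<bullet> e) * (D e ?z - p e t))) \<le> b * (d * h) ^ Suc m"
        by (intro onorm_le) (auto simp: mult.commute[of "\<bar>_\<bar>"] intro: mult_right_mono)
    qed auto
    moreover have "u 0 = 0" by (simp add: u_def P_eq)
    moreover have "u 1 = f x - word_poly (Suc m) c' (x - q)"
      by (simp add: u_def P_def y_def)
    ultimately show "norm (f x - word_poly (Suc m) c' (x - q))
        \<le> b * (real DIM('a) * h) ^ Suc m"
      by (simp add: d_def)
  qed
qed

section \<open>Cells whose size is adapted to the weight\<close>

type_synonym 'a cell = "nat \<times> ('a \<Rightarrow> int)"

text \<open>
  A point \<open>s\<close> is placed in a cube of side \<open>1/L\<close> with \<open>L\<close> the scale at \<open>s\<close>: fine near the origin, where the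
  kernel is large, coarse further out, and \<open>L = 0\<close> as soon as \<open>wt 1 s > R\<close>. The exponent 1/3 makes the number of
  cells summable over \<open>L\<close> in every dimension; a larger Taylor degree compensates for it.
\<close>

definition cell_scale :: "real \<Rightarrow> 'a::euclidean_space \<Rightarrow> nat" where
  "cell_scale R s = nat \<lfloor>(R / wt 1 s) powr (1 / 3)\<rfloor>"

text \<open>
  The scale belongs to the key, so that the cells, being the sets on which the key is constant, are disjoint and need
  not be cubes: a cell is the part of a cube of side \<open>1/L\<close> on which the scale is \<open>L\<close>.
\<close>

definition cell_key :: "real \<Rightarrow> 'a::euclidean_space \<Rightarrow> nat \<times> ('a \<Rightarrow> int)" where
  "cell_key R s = (cell_scale R s, \<lambda>e\<in>Basis. \<lfloor>real (cell_scale R s) * (s \<bullet> e)\<rfloor>)"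

definition cell_corner :: "nat \<times> ('a \<Rightarrow> int) \<Rightarrow> 'a::euclidean_space" where
  "cell_corner k = (\<Sum>e\<in>Basis. (of_int (snd k e) / real (fst k)) *\<^sub>R e)"

text \<open>
  A superset, of controlled size, of the keys with nonzero scale. At scale \<open>L\<close> one has \<open>|s| \<le> wt 1 s \<le> R / L\<^sup>3\<close>, so
  the entries \<open>\<lfloor>L s\<^sub>e\<rfloor>\<close> are at most \<open>R / L\<^sup>2\<close> in absolute value up to the rounding error 1, and
  \<open>1 \<le> R / L\<^sup>2\<close>; this explains the factor 2.
\<close>

definition cell_keys :: "real \<Rightarrow> (nat \<times> ('a::euclidean_space \<Rightarrow> int)) set" where
  "cell_keys R = (SIGMA L : {L. 1 \<le> L \<and> real L ^ 3 \<le> R}.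
     Basis \<rightarrow>\<^sub>E {- \<lfloor>2 * R / (real L)\<^sup>2\<rfloor> .. \<lfloor>2 * R / (real L)\<^sup>2\<rfloor>})"

lemma powr_third_cube: "0 \<le> y \<Longrightarrow> (y powr (1 / 3)) ^ 3 = (y :: real)"
  by (cases "y = 0") (simp_all add: powr_powr flip: powr_realpow)

lemma cell_scale_cube_le:
  assumes "0 \<le> R" shows "real (cell_scale R s) ^ 3 \<le> R / wt 1 s"
proof -
  have "real (cell_scale R s) \<le> (R / wt 1 s) powr (1 / 3)"
    by (simp add: cell_scale_def)
  then have "real (cell_scale R s) ^ 3 \<le> ((R / wt 1 s) powr (1 / 3)) ^ 3"
    by (rule power_mono) simp
  then show ?thesis using assms by (subst (asm) powr_third_cube) auto
qed

lemma less_Suc_cell_scale_cube: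
  assumes "0 \<le> R" shows "R / wt 1 s < (real (cell_scale R s) + 1) ^ 3"
proof -
  have "(R / wt 1 s) powr (1 / 3) < real (cell_scale R s) + 1"
    by (simp add: cell_scale_def)
  then have "((R / wt 1 s) powr (1 / 3)) ^ 3 < (real (cell_scale R s) + 1) ^ 3"
    by (rule power_strict_mono) auto
  then show ?thesis using assms by (subst (asm) powr_third_cube) auto
qed

lemma cell_key_in_cell_keys:
  fixes s :: "'a::euclidean_space"
  assumes R: "0 \<le> R" and L: "1 \<le> cell_scale R s"
  shows "cell_key R s \<in> cell_keys R"
proof -
  define L where "L = real (cell_scale R s)"
  have L1: "1 \<le> L" using assms by (simp add: L_def)
  have w1: "1 \<le> wt 1 s" by (rule wt_ge_1) simp
  have Lw: "L ^ 3 \<le> R / wt 1 s" unfolding L_def by (rule cell_scale_cube_le[OF R])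
  also have "\<dots> \<le> R" using w1 R by (simp add: divide_le_eq mult_left_le_one_le mult_le_cancel_left1)
  finally have LR: "L ^ 3 \<le> R" .
  have "\<lfloor>L * (s \<bullet> e)\<rfloor> \<in> {- \<lfloor>2 * R / L\<^sup>2\<rfloor> .. \<lfloor>2 * R / L\<^sup>2\<rfloor>}" if e: "e \<in> Basis" for e
  proof -
    have "\<bar>s \<bullet> e\<bar> \<le> wt 1 s" using Basis_le_norm[OF e, of s] norm_le_wt_1[of s] by linarith
    also have "wt 1 s \<le> R / L ^ 3" using Lw L1 wt_pos[of 1 s] by (simp add: field_simps)
    finally have "L * \<bar>s \<bullet> e\<bar> \<le> L * (R / L ^ 3)" using L1 by (intro mult_left_mono) auto
    also have "\<dots> = R / L\<^sup>2" using L1 by (simp add: power2_eq_square power3_eq_cube)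
    finally have "\<bar>L * (s \<bullet> e)\<bar> \<le> R / L\<^sup>2" using L1 by (simp add: abs_mult)
    moreover have "1 \<le> R / L\<^sup>2"
    proof -
      have "L\<^sup>2 * 1 \<le> L\<^sup>2 * L" using L1 by (intro mult_left_mono) auto
      also have "\<dots> = L ^ 3" by (simp add: power2_eq_square power3_eq_cube)
      finally show ?thesis using LR L1 by (simp add: pos_le_divide_eq)
    qed
    ultimately have "L * (s \<bullet> e) \<le> 2 * R / L\<^sup>2" "- (2 * R / L\<^sup>2) \<le> L * (s \<bullet> e) - 1"
      by (simp_all add: abs_le_iff)
    then show ?thesis
      by (simp add: le_floor_iff floor_le_iff) linarith
  qed
  then show ?thesis
    using LR L1 by (auto simp: cell_key_def cell_keys_def L_def)
qed

lemma cell_corner_close: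
  fixes s :: "'a::euclidean_space"
  assumes L: "1 \<le> cell_scale R s" and e: "e \<in> Basis"
  shows "\<bar>(s - cell_corner (cell_key R s)) \<bullet> e\<bar> \<le> 1 / real (cell_scale R s)"
proof -
  define L where "L = real (cell_scale R s)"
  have L0: "0 < L" using assms by (simp add: L_def)
  have "cell_corner (cell_key R s) \<bullet> e = of_int \<lfloor>L * (s \<bullet> e)\<rfloor> / L"
    using e by (simp add: cell_corner_def cell_key_def inner_sum_left inner_Basis L_def if_distrib
        cong: if_cong)
  then have "(s - cell_corner (cell_key R s)) \<bullet> e = (L * (s \<bullet> e) - of_int \<lfloor>L * (s \<bullet> e)\<rfloor>) / L"
    using L0 by (simp add: inner_diff_left field_simps)
  moreover have "\<bar>L * (s \<bullet> e) - of_int \<lfloor>L * (s \<bullet> e)\<rfloor>\<bar> \<le> 1"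
    by linarith
  ultimately show ?thesis
    using L0 by (simp add: L_def[symmetric] divide_right_mono)
qed

lemma sum_inverse_squares_le: "(\<Sum>L\<in>{1..n}. 1 / (real L)\<^sup>2) \<le> 2"
proof -
  have "(\<Sum>L\<in>{1..n}. 1 / (real L)\<^sup>2) \<le> 2 - 1 / real n" if "1 \<le> n"
    using that
  proof (induction n rule: nat_induct_at_least)
    case base
    then show ?case by simp
  next
    case (Suc n)
    have "1 / (real (Suc n))\<^sup>2 \<le> 1 / (real n * real (Suc n))"
      using Suc(1) by (intro divide_left_mono) (auto simp: power2_eq_square mult_right_mono)
    also have "\<dots> = 1 / real n - 1 / real (Suc n)"
      using Suc(1) by (simp add: field_simps)
    finally show ?case using Suc.IH by simp
  qed
  then show ?thesis by (cases "1 \<le> n") (auto intro: order_trans simp: not_le)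
qed

text \<open>At scale \<open>L\<close> there are at most \<open>(5 R / L\<^sup>2)^d \<le> 5^d R^d / L\<^sup>2\<close> keys, and the sum of \<open>1 / L\<^sup>2\<close> is at most 2.\<close>

lemma card_cell_keys:
  assumes R: "1 \<le> R"
  shows "finite (cell_keys R :: (nat \<times> ('a::euclidean_space \<Rightarrow> int)) set)"
    and "real (card (cell_keys R :: 'a cell set)) \<le> 2 * 5 ^ DIM('a) * R powr real DIM('a)"
proof -
  define n where "n = nat \<lfloor>R\<rfloor>"
  let ?N = "\<lambda>L. \<lfloor>2 * R / (real L)\<^sup>2\<rfloor>"
  let ?F = "\<lambda>L. (Basis::'a set) \<rightarrow>\<^sub>E {- ?N L .. ?N L}"
  let ?A = "{L. 1 \<le> L \<and> real L ^ 3 \<le> R}"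
  have cube: "real L \<le> real L ^ 3" if "1 \<le> L" for L
    using power_increasing[of 1 3 "real L"] that by simp
  have An: "?A \<subseteq> {1..n}"
  proof
    fix L assume "L \<in> ?A"
    then have "1 \<le> L" "real L ^ 3 \<le> R" by auto
    then have "real L \<le> R" "1 \<le> L" using order_trans[OF cube] by blast+
    then show "L \<in> {1..n}" by (simp add: n_def le_nat_floor)
  qed
  then have A: "finite ?A" by (rule finite_subset) simp
  have fin: "finite (?F L)" for L
    by (intro finite_PiE) auto
  show "finite (cell_keys R :: 'a cell set)"
    unfolding cell_keys_def using A fin by (rule finite_SigmaI)
  have each: "real (card (?F L)) \<le> 5 ^ DIM('a) * R ^ DIM('a) * (1 / (real L)\<^sup>2)"
    if L: "L \<in> ?A" for L
  proof -
    have L1: "1 \<le> real L" using L by auto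
    have "(real L)\<^sup>2 \<le> real L ^ 3" using L1 by (intro power_increasing) auto
    also have "\<dots> \<le> R" using L by auto
    finally have RL: "1 \<le> R / (real L)\<^sup>2" using L1 by (simp add: pos_le_divide_eq)
    have N0: "0 \<le> ?N L" using RL by simp
    have "real (card {- ?N L .. ?N L}) = 2 * real_of_int (?N L) + 1"
      using N0 by simp
    also have "\<dots> \<le> 2 * (2 * R / (real L)\<^sup>2) + 1"
      using of_int_floor_le[of "2 * R / (real L)\<^sup>2"] by linarith
    also have "\<dots> \<le> 5 * (R / (real L)\<^sup>2)" using RL by simp
    finally have c: "real (card {- ?N L .. ?N L}) \<le> 5 * (R / (real L)\<^sup>2)" .
    have "real (card (?F L)) = real (card {- ?N L .. ?N L}) ^ DIM('a)"
      by (simp add: card_PiE)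
    also have "\<dots> \<le> (5 * (R / (real L)\<^sup>2)) ^ DIM('a)"
      by (intro power_mono c) simp
    also have "\<dots> = 5 ^ DIM('a) * R ^ DIM('a) * (1 / (real L)\<^sup>2) ^ DIM('a)"
      by (simp add: power_mult_distrib power_divide)
    also have "\<dots> \<le> 5 ^ DIM('a) * R ^ DIM('a) * (1 / (real L)\<^sup>2)"
    proof (intro mult_left_mono)
      have "1 / (real L)\<^sup>2 \<le> 1" using L1 by (simp add: divide_le_eq)
      then show "(1 / (real L)\<^sup>2) ^ DIM('a) \<le> 1 / (real L)\<^sup>2"
        using power_decreasing[of 1 "DIM('a)" "1 / (real L)\<^sup>2"] DIM_positive[where 'a='a] by simp
    qed (use R in auto)
    finally show ?thesis .
  qed
  have "real (card (cell_keys R :: 'a cell set))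
      = (\<Sum>L\<in>?A. real (card (?F L)))"
    unfolding cell_keys_def using A fin by (subst card_SigmaI) auto
  also have "\<dots> \<le> (\<Sum>L\<in>?A. 5 ^ DIM('a) * R ^ DIM('a) * (1 / (real L)\<^sup>2))"
    by (rule sum_mono) (rule each)
  also have "\<dots> \<le> (\<Sum>L\<in>{1..n}. 5 ^ DIM('a) * R ^ DIM('a) * (1 / (real L)\<^sup>2))"
    by (rule sum_mono2) (use An R in auto)
  also have "\<dots> = 5 ^ DIM('a) * R ^ DIM('a) * (\<Sum>L\<in>{1..n}. 1 / (real L)\<^sup>2)"
    by (simp only: sum_distrib_left)
  also have "\<dots> \<le> 5 ^ DIM('a) * R ^ DIM('a) * 2"
    using R by (intro mult_left_mono sum_inverse_squares_le) auto
  finally show "real (card (cell_keys R :: 'a cell set)) \<le> 2 * 5 ^ DIM('a) * R powr real DIM('a)"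
    using R by (simp add: powr_realpow)
qed

lemma measurable_cell:
  fixes k :: "nat \<times> ('a::euclidean_space \<Rightarrow> int)"
  shows "{s. cell_key R s = k} \<in> sets borel"
proof (cases "snd k \<in> extensional Basis")
  case True
  have "cell_key R s = k \<longleftrightarrow> cell_scale R s = fst k \<and> (\<forall>e\<in>Basis. \<lfloor>real (fst k) * (s \<bullet> e)\<rfloor> = snd k e)" for s
  proof -
    have "(\<lambda>e\<in>Basis. \<lfloor>real (fst k) * (s \<bullet> e)\<rfloor>) = snd k \<longleftrightarrow> (\<forall>e\<in>Basis. \<lfloor>real (fst k) * (s \<bullet> e)\<rfloor> = snd k e)"
      using True by (auto simp: fun_eq_iff extensional_def restrict_def)
    then show ?thesis unfolding cell_key_def prod_eq_iff by auto
  qed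
  then have "{s. cell_key R s = k} = {s. nat \<lfloor>(R / wt 1 s) powr (1 / 3)\<rfloor> = fst k} \<inter>
      (\<Inter>e\<in>Basis. {s. \<lfloor>real (fst k) * (s \<bullet> e)\<rfloor> = snd k e})"
    by (auto simp: cell_scale_def)
  also have "\<dots> \<in> sets borel"
  proof (intro sets.Int sets.finite_INT)
    show "{s::'a. nat \<lfloor>(R / wt 1 s) powr (1 / 3)\<rfloor> = fst k} \<in> sets borel" by measurable
    show "{s. \<lfloor>real (fst k) * (s \<bullet> e)\<rfloor> = snd k e} \<in> sets borel" for e :: 'a by measurable
  qed auto
  finally show ?thesis .
next
  case False
  then have "{s. cell_key R s = k} = {}" by (auto simp: cell_key_def)
  then show ?thesis by simp
qed

section \<open>Kernels that are approximable by separated ones\<close>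

text \<open>
  The kernel is approximated by sums of \<open>O(R^d)\<close> products \<open>c(r) h(s)\<close>. The coefficients are existentially
  quantified for each \<open>r\<close> separately, so no measurability in \<open>r\<close> is claimed. The index type, pairs of a cell key and a
  multi-index, is the one that occurs in the construction; any other would do.
\<close>

definition separably_approximable :: "real \<Rightarrow> ('a::euclidean_space \<Rightarrow> 'a \<Rightarrow> complex) \<Rightarrow> bool" where
  "separably_approximable a K \<longleftrightarrow> (\<exists>C E. 0 \<le> C \<and> 0 \<le> E \<and> (\<forall>R\<ge>1. \<exists>(I :: ('a cell \<times> 'a list) set) h.
     finite I \<and> real (card I) \<le> C * R powr real DIM('a) \<and> (\<forall>i\<in>I. square_integrable (h i)) \<and>
     (\<forall>r. \<exists>c. \<forall>s. norm (K r s - (\<Sum>i\<in>I. c i * h i s)) \<le> E * R powr (- a) * decay (r - s))))"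

lemma wt_near:
  assumes "norm (z - s) \<le> \<rho>"
  shows "wt \<gamma> z \<le> 2 powr (\<bar>\<gamma>\<bar> / 2) * (1 + \<rho>\<^sup>2) powr (\<bar>\<gamma>\<bar> / 2) * wt \<gamma> s"
proof -
  have "wt \<gamma> z = wt \<gamma> (s + (z - s))" by simp
  also have "\<dots> \<le> 2 powr (\<bar>\<gamma>\<bar> / 2) * wt \<gamma> s * wt \<bar>\<gamma>\<bar> (z - s)" by (rule peetre)
  also have "\<dots> \<le> 2 powr (\<bar>\<gamma>\<bar> / 2) * wt \<gamma> s * (1 + \<rho>\<^sup>2) powr (\<bar>\<gamma>\<bar> / 2)"
    unfolding wt_def[of "\<bar>\<gamma>\<bar>"]
    by (intro mult_left_mono powr_mono2 add_left_mono power_mono assms) (auto simp: less_imp_le)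
  finally show ?thesis by (simp add: mult_ac)
qed

text \<open>
  The functions of \<open>s\<close> are the monomials of degree below \<open>M\<close> restricted to a cell and multiplied by \<open>v\<close> for the base point
  \<open>q\<close> of the cell. Where the scale is 0 the trivial approximation is good enough since \<open>wt 1 s > R\<close>. Elsewhere the Taylor
  error is \<open>L^(-M) wt (-a) s\<close> up to constants, and \<open>R / wt 1 s \<le> (2 L)^3\<close> together with \<open>3 a \<le> M\<close> turns this into
  \<open>R^(-a)\<close>. Points of a cell are at distance at most \<open>d\<close> from \<open>q\<close>, so all weights in the derivative bounds
  may be replaced by their values at \<open>s\<close>.
\<close>

lemma smooth_kernel_separably_approximable:
  fixes K :: "'a::euclidean_space \<Rightarrow> 'a \<Rightarrow> complex"
  assumes a: "0 \<le> a" and M: "3 * a \<le> real M" and C: "0 \<le> C" and b: "0 \<le> b"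
    and K: "\<And>q r s. K r s = v q s * \<kappa> q r s"
    and v: "\<And>q s. norm (v q s) = 1" "\<And>q. v q \<in> borel_measurable borel"
    and \<kappa>: "\<And>q r. derivs_bounded M (\<kappa> q r) (\<lambda>s. C * (wt (- a) s * decay (r - s) * wt b (s - q)))"
  shows "separably_approximable a K"
proof -
  let ?n = "2 * 5 ^ DIM('a) * real (card (basis_words M :: 'a list set))"
  define d where "d = real DIM('a)"
  have d1: "1 \<le> d" using DIM_positive[where 'a='a] by (simp add: d_def Suc_leI)
  \<comment> \<open>the cost of moving a weight of order \<open>\<gamma>\<close> by at most \<open>d\<close>\<close>
  define C0 where "C0 \<gamma> = 2 powr (\<bar>\<gamma>\<bar> / 2) * (1 + d\<^sup>2) powr (\<bar>\<gamma>\<bar> / 2)" for \<gamma> :: real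
  have C0_nonneg: "0 \<le> C0 \<gamma>" for \<gamma> by (simp add: C0_def)
  define C1 where "C1 = C0 (- a) * C0 (- (2 * d)) * C0 b"
  have C1: "0 \<le> C1" by (simp add: C1_def C0_nonneg)
  define E where "E = C + C * C1 * (2 * d) ^ M"
  have K_bound: "norm (K r s) \<le> C * (wt (- a) s * decay (r - s))" for r s
    \<comment> \<open>the base point \<open>q = s\<close> makes the last weight 1\<close>
    using derivs_boundedD[OF \<kappa>, of s r s] v(1)[of s s] K[of r s s] by (simp add: norm_mult)
  show ?thesis
    unfolding separably_approximable_def
  proof (rule exI[of _ "?n"], rule exI[of _ E],
      intro conjI allI impI)
    show "0 \<le> E" using C C1 d1 by (simp add: E_def)
    fix R :: real assume R: "1 \<le> R"
    define I where "I = (cell_keys R :: 'a cell set) \<times> (basis_words M :: 'a list set)"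
    define h where "h = (\<lambda>(k, l) s. if cell_key R s = k then v (cell_corner k) s * of_real (monomial l (s - cell_corner k)) else 0)"
    have fin: "finite I" unfolding I_def using card_cell_keys(1)[OF R] finite_basis_words by blast
    have card: "real (card I) \<le> ?n * R powr real DIM('a)"
    proof -
      have "real (card I) = real (card (cell_keys R :: 'a cell set)) * real (card (basis_words M :: 'a list set))"
        by (simp add: I_def card_cartesian_product)
      also have "\<dots> \<le> (2 * 5 ^ DIM('a) * R powr real DIM('a)) * real (card (basis_words M :: 'a list set))"
        by (intro mult_right_mono card_cell_keys(2)[OF R]) simp
      finally show ?thesis by (simp add: mult_ac)
    qed
    have scale: "cell_key R s = k \<Longrightarrow> k \<in> cell_keys R \<Longrightarrow> 1 \<le> cell_scale R s" for s :: 'a and k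
      by (auto simp: cell_key_def cell_keys_def)
    have sq: "square_integrable (h i)" if i: "i \<in> I" for i
    proof -
      obtain k l where kl: "i = (k, l)" "k \<in> cell_keys R" "l \<in> basis_words M" using i by (auto simp: I_def)
      note [measurable] = measurable_cell[of R k] v(2)[of "cell_corner k"]
      have mm: "(\<lambda>s. monomial l (s - cell_corner k)) \<in> borel_measurable borel"
        unfolding monomial_def by (induction l) auto
      note [measurable] = mm
      show ?thesis
      proof (rule square_integrable_bound[where w = "\<lambda>s. indicator (cball 0 R) s"])
        have "Measurable.pred borel (\<lambda>s. cell_key R s = k)"
          using measurable_cell[of R k] by (simp add: pred_def)
        note [measurable] = this
        show "h i \<in> borel_measurable borel"
          unfolding h_def kl by simp
        show "integrable lborel (\<lambda>s::'a. indicator (cball 0 R) s :: real)"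
          using emeasure_bounded_finite[OF bounded_cball, of "0::'a" R]
          by (intro integrable_real_indicator) auto
        show "AE s in lborel. (norm (h i s))\<^sup>2 \<le> indicator (cball 0 R) s"
        proof (rule AE_I2)
          fix s
          show "(norm (h i s))\<^sup>2 \<le> indicator (cball 0 R) s"
          proof (cases "cell_key R s = k")
            case True
            have L: "1 \<le> cell_scale R s" by (rule scale[OF True kl(2)])
            have "1 \<le> real (cell_scale R s) ^ 3" using L by (intro one_le_power) auto
            also have "\<dots> \<le> R / wt 1 s" by (rule cell_scale_cube_le) (use R in simp)
            finally have "wt 1 s \<le> R" by (simp add: pos_le_divide_eq)
            then have sR: "norm s \<le> R" using norm_le_wt_1[of s] by simp
            have "\<bar>monomial l' (s - cell_corner k)\<bar> \<le> 1" if "set l' \<subseteq> Basis" for l'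
              using that
            proof (induction l')
              case (Cons e l')
              have "\<bar>(s - cell_corner k) \<bullet> e\<bar> \<le> 1 / real (cell_scale R s)"
                using cell_corner_close[OF L, of e] Cons.prems True by simp
              also have "\<dots> \<le> 1" using L by simp
              finally show ?case
                using Cons unfolding monomial_Cons abs_mult by (intro mult_le_one) auto
            qed (simp add: monomial_def)
            then have "\<bar>monomial l (s - cell_corner k)\<bar> \<le> 1" using kl(3) by (simp add: basis_words_def)
            then have "norm (h i s) \<le> 1"
              by (simp add: h_def kl True norm_mult v)
            then have "(norm (h i s))\<^sup>2 \<le> 1" by (simp add: power_le_one)
            then show ?thesis using sR by simp
          qed (simp add: h_def kl)
        qed
      qed
    qed
    have "\<exists>c. \<forall>s. norm (K r s - (\<Sum>i\<in>I. c i * h i s)) \<le> E * R powr (- a) * decay (r - s)" for r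
    proof -
      have "\<forall>q. \<exists>c. \<forall>s t b'. (\<forall>z\<in>closed_segment q s. C * (wt (- a) z * decay (r - z) * wt b (z - q)) \<le> b') \<longrightarrow>
          (\<forall>e\<in>Basis. \<bar>(s - q) \<bullet> e\<bar> \<le> t) \<longrightarrow>
          norm (\<kappa> q r s - word_poly M c (s - q)) \<le> b' * (d * t) ^ M"
        unfolding d_def by (intro allI taylor_bound \<kappa>)
      from choice[OF this] obtain c where c: "\<forall>q s t b'.
          (\<forall>z\<in>closed_segment q s. C * (wt (- a) z * decay (r - z) * wt b (z - q)) \<le> b') \<longrightarrow>
          (\<forall>e\<in>Basis. \<bar>(s - q) \<bullet> e\<bar> \<le> t) \<longrightarrow>
          norm (\<kappa> q r s - word_poly M (c q) (s - q)) \<le> b' * (d * t) ^ M" ..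
      show ?thesis
      proof (intro exI[of _ "\<lambda>(k, l). c (cell_corner k) l"] allI)
        fix s
        let ?sum = "\<Sum>i\<in>I. (case i of (k, l) \<Rightarrow> c (cell_corner k) l) * h i s"
        have sum: "?sum = (\<Sum>k\<in>cell_keys R. if k = cell_key R s then
            v (cell_corner k) s * word_poly M (c (cell_corner k)) (s - cell_corner k) else 0)"
        proof -
          have "?sum = (\<Sum>(k, l)\<in>cell_keys R \<times> basis_words M. c (cell_corner k) l * h (k, l) s)"
            unfolding I_def by (intro sum.cong) auto
          also have "\<dots> = (\<Sum>k\<in>cell_keys R. \<Sum>l\<in>basis_words M. c (cell_corner k) l * h (k, l) s)"
            by (rule sum.cartesian_product[symmetric])
          also have "\<dots> = (\<Sum>k\<in>cell_keys R. if k = cell_key R s then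
            v (cell_corner k) s * word_poly M (c (cell_corner k)) (s - cell_corner k) else 0)"
            by (intro sum.cong refl) (auto simp: h_def sum_distrib_left mult_ac)
          finally show ?thesis .
        qed
        have Ra: "0 \<le> R powr (- a)" by simp
        show "norm (K r s - ?sum) \<le> E * R powr (- a) * decay (r - s)"
        proof (cases "1 \<le> cell_scale R s")
          case False
          have "R / wt 1 s < 1"
            using less_Suc_cell_scale_cube[of R s] R False by (simp add: not_le)
          then have Rw: "R < wt 1 s" by (simp add: divide_less_eq)
          have "wt (- a) s = wt 1 s powr (- a)" by (simp add: wt_powr)
          also have "\<dots> \<le> R powr (- a)" using Rw R a by (intro powr_mono2') auto
          finally have wa: "wt (- a) s \<le> R powr (- a)" .
          have "cell_key R s \<notin> cell_keys R" using scale[OF refl] False by blast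
          then have "?sum = 0" unfolding sum by (auto intro!: sum.neutral)
          then have "norm (K r s - ?sum) \<le> C * (wt (- a) s * decay (r - s))" using K_bound by simp
          also have "\<dots> \<le> E * (R powr (- a) * decay (r - s))"
            using C C1 d1 wa by (intro mult_mono) (auto simp: E_def)
          finally show ?thesis by (simp add: mult.assoc)
        next
          case True
          define L where "L = real (cell_scale R s)"
          define q where "q = cell_corner (cell_key R s)"
          have L1: "1 \<le> L" using True by (simp add: L_def)
          have key: "cell_key R s \<in> cell_keys R" using cell_key_in_cell_keys[OF _ True] R by simp
          have sum': "?sum = v q s * word_poly M (c q) (s - q)"
            unfolding sum q_def using key card_cell_keys(1)[OF R, where 'a='a] by (simp add: sum.delta)
          have close: "\<forall>e\<in>Basis. \<bar>(s - q) \<bullet> e\<bar> \<le> 1 / L"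
            using cell_corner_close[OF True] by (simp add: q_def L_def)
          have "norm (s - q) \<le> (\<Sum>e\<in>Basis. \<bar>(s - q) \<bullet> e\<bar>)" by (rule norm_le_l1)
          also have "\<dots> \<le> (\<Sum>e\<in>(Basis::'a set). 1)"
            using close L1 by (intro sum_mono) (force intro: order_trans)
          finally have sq: "norm (s - q) \<le> d" by (simp add: d_def)
          have bound: "C * (wt (- a) z * decay (r - z) * wt b (z - q)) \<le> C * (C1 * wt (- a) s * decay (r - s))"
            if z: "z \<in> closed_segment q s" for z
          proof -
            have zs: "norm (z - s) \<le> d" and zq: "norm (z - q) \<le> d"
              using segment_bound[OF z] sq by (auto simp: norm_minus_commute intro: order_trans)
            have 1: "wt (- a) z \<le> C0 (- a) * wt (- a) s"
              unfolding C0_def by (rule wt_near[OF zs])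
            have 2: "decay (r - z) \<le> C0 (- (2 * d)) * decay (r - s)"
              unfolding C0_def decay_def d_def
              by (rule wt_near) (use zs in \<open>simp add: d_def norm_minus_commute\<close>)
            have 3: "wt b (z - q) \<le> C0 b * wt b (0::'a)"
              unfolding C0_def by (rule wt_near) (use zq in simp)
            have "wt (- a) z * decay (r - z) * wt b (z - q)
                \<le> (C0 (- a) * wt (- a) s) * (C0 (- (2 * d)) * decay (r - s)) * (C0 b * wt b (0::'a))"
              by (intro mult_mono 1 2 3 mult_nonneg_nonneg C0_nonneg) auto
            also have "\<dots> = C1 * wt (- a) s * decay (r - s)" by (simp add: C1_def)
            finally show ?thesis using C by (rule mult_left_mono)
          qed
          have "norm (K r s - ?sum) = norm (v q s * (\<kappa> q r s - word_poly M (c q) (s - q)))"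
            unfolding sum' K[of r s q] by (simp only: right_diff_distrib)
          also have "\<dots> = norm (\<kappa> q r s - word_poly M (c q) (s - q))"
            by (simp add: norm_mult v)
          also have "\<dots> \<le> C * (C1 * wt (- a) s * decay (r - s)) * (d * (1 / L)) ^ M"
            by (rule c[rule_format]) (use bound close in auto)
          also have "\<dots> = C * C1 * d ^ M * decay (r - s) * (wt (- a) s * (1 / L) ^ M)"
            by (simp add: power_mult_distrib power_divide)
          also have "\<dots> \<le> C * C1 * d ^ M * decay (r - s) * (2 ^ M * R powr (- a))"
          proof (intro mult_left_mono)
            have "R / wt 1 s \<le> (L + 1) ^ 3"
              using less_Suc_cell_scale_cube[of R s] R by (simp add: L_def)
            also have "\<dots> \<le> (2 * L) ^ 3" using L1 by (intro power_mono) auto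
            also have "\<dots> = (2 * L) powr 3" using L1 by simp
            finally have "(R / wt 1 s) powr a \<le> ((2 * L) powr 3) powr a"
              using R a by (intro powr_mono2) auto
            also have "\<dots> = (2 * L) powr (3 * a)" by (simp add: powr_powr)
            also have "\<dots> \<le> (2 * L) powr real M" using M L1 by (intro powr_mono) auto
            also have "\<dots> = 2 ^ M * L ^ M" using L1 by (simp add: powr_realpow power_mult_distrib)
            finally have "(R / wt 1 s) powr a \<le> 2 ^ M * L ^ M" .
            moreover have "(R / wt 1 s) powr a = R powr a * wt (- a) s"
              by (simp add: powr_divide wt_powr wt_uminus) (simp add: divide_inverse)
            ultimately have "R powr a * wt (- a) s \<le> 2 ^ M * L ^ M" by simp
            then show "wt (- a) s * (1 / L) ^ M \<le> 2 ^ M * R powr (- a)"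
              using L1 R by (simp add: powr_minus power_divide field_simps)
          qed (use C C1 d1 in auto)
          also have "\<dots> = (C * C1 * (2 * d) ^ M) * (R powr (- a) * decay (r - s))"
            by (simp add: power_mult_distrib mult_ac)
          also have "\<dots> \<le> E * (R powr (- a) * decay (r - s))"
            using C by (intro mult_right_mono) (auto simp: E_def)
          finally show ?thesis by (simp add: mult.assoc)
        qed
      qed
    qed
    with fin card sq show "\<exists>(I :: ('a cell \<times> 'a list) set) h. finite I \<and>
        real (card I) \<le> ?n * R powr real DIM('a) \<and>
        (\<forall>i\<in>I. square_integrable (h i)) \<and>
        (\<forall>r. \<exists>c. \<forall>s. norm (K r s - (\<Sum>i\<in>I. c i * h i s)) \<le> E * R powr (- a) * decay (r - s))"
      by blast
  qed simp
qed

lemma inner_l2_class: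
  "square_integrable f \<Longrightarrow> square_integrable g \<Longrightarrow> l2_class f \<bullet> l2_class g = (\<integral>x. f x \<bullet> g x \<partial>lborel)"
  by transfer simp

lemma square_integrable_cnj: "square_integrable f \<Longrightarrow> square_integrable (\<lambda>x. cnj (f x))"
  using measurable_compose[OF _ borel_measurable_continuous_onI[OF continuous_on_cnj[OF continuous_on_id]], of f borel]
  by (auto simp: square_integrable_def)

lemma integrable_mult_square_integrable:
  fixes f g :: "'a::euclidean_space \<Rightarrow> complex"
  assumes "square_integrable f" "square_integrable g"
  shows "integrable lborel (\<lambda>x. f x * g x)"
proof -
  have [measurable]: "f \<in> borel_measurable borel" "g \<in> borel_measurable borel" using assms by auto
  have "integrable lborel (\<lambda>x. complex_of_real (f x \<bullet> cnj (g x)) + \<i> * of_real (f x \<bullet> (\<i> * cnj (g x))))"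
    by (intro Bochner_Integration.integrable_add integrable_mult_right integrable_of_real
        integrable_inner_square_integrable square_integrable_cmult square_integrable_cnj assms)
  moreover have "complex_of_real (f x \<bullet> cnj (g x)) + \<i> * of_real (f x \<bullet> (\<i> * cnj (g x))) = f x * g x" for x
    by (simp add: complex_eq_iff inner_complex_def algebra_simps)
  ultimately show ?thesis by simp
qed

text \<open>
  The bilinear complex pairing in terms of the real inner product; it vanishes once \<open>f\<close> is orthogonal to the
  conjugate of \<open>g\<close> and to \<open>\<i>\<close> times it.
\<close>

lemma integral_mult_eq_inner:
  assumes f: "square_integrable f" and g: "square_integrable g"
  shows "(\<integral>x. f x * g x \<partial>lborel) = complex_of_real (l2_class f \<bullet> l2_class (\<lambda>x. cnj (g x))) +
    \<i> * of_real (l2_class f \<bullet> (\<i> *\<^sub>C l2_class (\<lambda>x. cnj (g x))))"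
proof -
  have "(\<integral>x. f x * g x \<partial>lborel) = (\<integral>x. complex_of_real (f x \<bullet> cnj (g x)) + \<i> * of_real (f x \<bullet> (\<i> * cnj (g x))) \<partial>lborel)"
    by (intro Bochner_Integration.integral_cong refl)
       (simp add: complex_eq_iff inner_complex_def algebra_simps)
  also have "\<dots> = complex_of_real (\<integral>x. f x \<bullet> cnj (g x) \<partial>lborel) + \<i> * of_real (\<integral>x. f x \<bullet> (\<i> * cnj (g x)) \<partial>lborel)"
    by (subst Bochner_Integration.integral_add)
       (auto intro!: integrable_mult_right integrable_of_real
        integrable_inner_square_integrable square_integrable_cmult square_integrable_cnj f g)
  finally show ?thesis
    by (simp add: inner_l2_class scaleC_l2_class square_integrable_cmult square_integrable_cnj f g)
qed

text \<open>
  Let \<open>P\<close> be the projection onto the span of the conjugates of the functions \<open>h i\<close>. A function \<open>f\<close> in the range of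
  \<open>1 - P\<close> integrates to zero against every \<open>h i\<close>. For each \<open>r\<close> one may therefore subtract the approximating sum from
  \<open>K r\<close> in the integral against \<open>f\<close>, whatever its coefficients are, and Schur's test sees only the error.
\<close>

theorem kernel_op_in_weak_schatten:
  fixes K :: "'a::euclidean_space \<Rightarrow> 'a \<Rightarrow> complex"
  assumes K: "decaying_kernel c K" and a: "0 < a" and approx: "separably_approximable a K"
  shows "kernel_op K \<in> weak_schatten (real DIM('a) / a)"
proof -
  from approx obtain C E where CE: "0 \<le> C" "0 \<le> E" and
    sep: "\<And>R. 1 \<le> R \<Longrightarrow> \<exists>(I :: ('a cell \<times> 'a list) set) h.
     finite I \<and> real (card I) \<le> C * R powr real DIM('a) \<and> (\<forall>i\<in>I. square_integrable (h i)) \<and>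
     (\<forall>r. \<exists>c. \<forall>s. norm (K r s - (\<Sum>i\<in>I. c i * h i s)) \<le> E * R powr (- a) * decay (r - s))"
    unfolding separably_approximable_def by blast
  let ?S = "schur_const TYPE('a)"
  have S: "1 \<le> ?S" by (rule schur_const_ge_1)
  have T: "bounded_operator (kernel_op K)" by (rule bounded_operator_kernel_op[OF K])
  show ?thesis
  proof (rule weak_schattenI[OF T a, where C = "C + 1" and E = "E * ?S"])
    fix R :: real assume R: "1 \<le> R"
    from sep[OF R] obtain I :: "('a cell \<times> 'a list) set" and h where I: "finite I"
      "real (card I) \<le> C * R powr real DIM('a)" and h: "\<And>i. i \<in> I \<Longrightarrow> square_integrable (h i)"
      and sepR: "\<And>r. \<exists>c. \<forall>s. norm (K r s - (\<Sum>i\<in>I. c i * h i s)) \<le> E * R powr (- a) * decay (r - s)"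
      by blast
    define B where "B = (\<lambda>i. l2_class (\<lambda>s. cnj (h i s))) ` I"
    have B: "finite B" "card B \<le> card I" using I(1) by (auto simp: B_def card_image_le)
    obtain P where P: "bounded_operator P" "range P \<subseteq> l2.span B"
      "\<And>x b. b \<in> B \<Longrightarrow> (x - P x) \<bullet> b = 0" "\<And>x b. b \<in> B \<Longrightarrow> (x - P x) \<bullet> (\<i> *\<^sub>C b) = 0"
      "\<And>x. norm (x - P x) \<le> norm x"
      using orthogonal_projection_ex[OF B(1)] by blast
    show "\<exists>S k. bounded_operator S \<and> rank_at_most k S \<and> real k < (C + 1) * R powr real DIM('a) \<and>
        onorm (\<lambda>x. kernel_op K x - S x) \<le> E * ?S * R powr (- a)"
    proof (intro exI[of _ "\<lambda>x. kernel_op K (P x)"] exI[of _ "card I"] conjI)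
      show "bounded_operator (\<lambda>x. kernel_op K (P x))" by (rule bounded_operator_compose[OF T P(1)])
      show "rank_at_most (card I) (\<lambda>x. kernel_op K (P x))"
        unfolding rank_at_most_def
      proof (intro exI[of _ "kernel_op K ` B"] conjI)
        have "kernel_op K y \<in> l2.span (kernel_op K ` B)" if "y \<in> l2.span B" for y
          using that
        proof (induction rule: l2.span_induct_alt)
          case base
          then show ?case
            using linear_0[OF bounded_linear.linear[OF bounded_operatorD(1)[OF T]]] by (simp add: l2.span_zero)
        next
          case (step z b y)
          have "kernel_op K (z *\<^sub>C b + y) = z *\<^sub>C kernel_op K b + kernel_op K y"
            by (simp add: linear_add[OF bounded_linear.linear[OF bounded_operatorD(1)[OF T]]]
                bounded_operatorD(2)[OF T])
          then show ?case using step by (simp add: l2.span_add l2.span_scale l2.span_base)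
        qed
        then show "range (\<lambda>x. kernel_op K (P x)) \<subseteq> l2.span (kernel_op K ` B)" using P(2) by blast
      qed (use B card_image_le[OF B(1), of "kernel_op K"] in auto)
      have "0 < R powr real DIM('a)" using R by simp
      then show "real (card I) < (C + 1) * R powr real DIM('a)" using I(2) unfolding distrib_right by linarith
      have lin: "linear (kernel_op K)" by (rule bounded_linear.linear[OF bounded_operatorD(1)[OF T]])
      show "onorm (\<lambda>x. kernel_op K x - kernel_op K (P x)) \<le> E * ?S * R powr (- a)"
      proof (rule onorm_bound)
        show "0 \<le> E * ?S * R powr (- a)" using CE S by simp
        fix x
        define f where "f = l2_fun (x - P x)"
        have f: "square_integrable f" "l2_class f = x - P x"
          by (simp_all add: f_def square_integrable_l2_fun l2_class_l2_fun)
        have orth: "(\<integral>s. h i s * f s \<partial>lborel) = 0" if i: "i \<in> I" for i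
        proof -
          have "(\<integral>s. f s * h i s \<partial>lborel) = 0"
            using P(3,4)[of "l2_class (\<lambda>s. cnj (h i s))"] i
            by (simp add: integral_mult_eq_inner f h B_def)
          then show ?thesis by (simp add: mult.commute)
        qed
        have bound: "norm (\<integral>s. K r s * f s \<partial>lborel) \<le> E * R powr (- a) * (\<integral>s. decay (r - s) * norm (f s) \<partial>lborel)" for r
        proof -
          from sepR obtain c where
            c: "\<And>s. norm (K r s - (\<Sum>i\<in>I. c i * h i s)) \<le> E * R powr (- a) * decay (r - s)" by blast
          have int: "integrable lborel (\<lambda>s. c i * (h i s * f s))" if "i \<in> I" for i
            using that by (intro integrable_mult_right integrable_mult_square_integrable f h)
          have "(\<integral>s. K r s * f s \<partial>lborel) = (\<integral>s. K r s * f s \<partial>lborel) - (\<Sum>i\<in>I. \<integral>s. c i * (h i s * f s) \<partial>lborel)"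
            using orth by simp
          also have "\<dots> = (\<integral>s. K r s * f s - (\<Sum>i\<in>I. c i * (h i s * f s)) \<partial>lborel)"
            using int integrable_kernel[OF K f(1), of r] by simp
          also have "norm \<dots> \<le> (\<integral>s. E * R powr (- a) * (decay (r - s) * norm (f s)) \<partial>lborel)"
          proof (rule Bochner_Integration.integral_norm_bound_integral)
            show "integrable lborel (\<lambda>s. K r s * f s - (\<Sum>i\<in>I. c i * (h i s * f s)))"
              using int integrable_kernel[OF K f(1), of r] by simp
            show "integrable lborel (\<lambda>s. E * R powr (- a) * (decay (r - s) * norm (f s)))"
              using integrable_decay_times(1)[OF f(1), of r] by simp
            fix s
            have "norm (K r s * f s - (\<Sum>i\<in>I. c i * (h i s * f s))) = norm ((K r s - (\<Sum>i\<in>I. c i * h i s)) * f s)"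
              by (simp add: left_diff_distrib sum_distrib_right mult.assoc)
            also have "\<dots> \<le> E * R powr (- a) * decay (r - s) * norm (f s)"
              unfolding norm_mult by (intro mult_right_mono c) simp
            finally show "norm (K r s * f s - (\<Sum>i\<in>I. c i * (h i s * f s))) \<le> E * R powr (- a) * (decay (r - s) * norm (f s))"
              by (simp only: mult.assoc)
          qed
          finally show ?thesis by simp
        qed
        have "kernel_op K x - kernel_op K (P x) = kernel_op K (x - P x)"
          by (simp add: linear_diff[OF lin])
        also have "\<dots> = l2_class (\<lambda>r. \<integral>s. K r s * f s \<partial>lborel)"
          by (simp only: f(2)[symmetric] kernel_op_l2_class[OF K f(1)])
        also have "norm \<dots> \<le> E * R powr (- a) * ?S * norm (l2_class f)"
          by (rule schur_bound(2)[OF f(1) kernel_integral_measurable[OF K f(1)] _ bound]) (use CE in simp)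
        also have "\<dots> \<le> E * R powr (- a) * ?S * norm x"
          unfolding f(2) using CE S by (intro mult_left_mono P(5)) auto
        finally show "norm (kernel_op K x - kernel_op K (P x)) \<le> E * ?S * R powr (- a) * norm x"
          by (simp add: mult_ac)
      qed
    qed
  qed (use CE S in auto)
qed

section \<open>Schwartz functions on a subspace\<close>

lemma closest_point_subspace:
  fixes V :: "'a::euclidean_space set"
  assumes V: "subspace V"
  shows closest_point_subspace_in: "closest_point V x \<in> V"
    and closest_point_orthogonal_comp: "closest_point (V\<^sup>\<bottom>) x = x - closest_point V x"
    and linear_closest_point_subspace: "linear (closest_point V)"
proof -
  have decomp: "\<exists>y z. x = y + z \<and> y \<in> V \<and> (\<forall>w\<in>V. w \<bullet> z = 0)" for x
  proof -
    from orthogonal_subspace_decomp_exists[of V x] obtain y z where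
      "y \<in> span V" "\<And>w. w \<in> span V \<Longrightarrow> orthogonal z w" "x = y + z" by blast
    moreover have "span V = V" using V by (simp add: span_eq_iff)
    ultimately show ?thesis
      by (intro exI[of _ y] exI[of _ z]) (auto simp: orthogonal_def inner_commute)
  qed
  have P: "closest_point V (y + z) = y" if "y \<in> V" "\<forall>w\<in>V. w \<bullet> z = 0" for y z
    by (rule closest_point_subspace_add[OF V]) (use that in auto)
  show "closest_point V x \<in> V" using decomp[of x] P by auto
  have Q: "closest_point (V\<^sup>\<bottom>) (z + y) = z" if "y \<in> V" "\<forall>w\<in>V. w \<bullet> z = 0" for y z
    by (rule closest_point_subspace_add[OF subspace_orthogonal_comp])
       (use that in \<open>auto simp: orthogonal_comp_def orthogonal_def inner_commute\<close>)
  show "closest_point (V\<^sup>\<bottom>) x = x - closest_point V x"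
    using decomp[of x] P Q by (auto simp: add.commute)
  show "linear (closest_point V)"
  proof (rule linearI)
    fix x x' :: 'a and c :: real
    obtain y z y' z' where d: "x = y + z" "y \<in> V" "\<forall>w\<in>V. w \<bullet> z = 0"
      "x' = y' + z'" "y' \<in> V" "\<forall>w\<in>V. w \<bullet> z' = 0" using decomp[of x] decomp[of x'] by blast
    have "closest_point V ((y + y') + (z + z')) = y + y'"
      by (rule P) (use d V in \<open>auto simp: subspace_add inner_add_right\<close>)
    then show "closest_point V (x + x') = closest_point V x + closest_point V x'"
      using d P by (simp add: algebra_simps)
    have "closest_point V (c *\<^sub>R y + c *\<^sub>R z) = c *\<^sub>R y"
      by (rule P) (use d V in \<open>auto simp: subspace_scale\<close>)
    then show "closest_point V (c *\<^sub>R x) = c *\<^sub>R closest_point V x"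
      using d P by (simp add: scaleR_add_right)
  qed
qed

text \<open>Powers of \<open>|x|\<close> dominate those of \<open>1 + |x|\<^sup>2\<close> up to \<open>2 ^ n\<close>, by distinguishing \<open>|x| \<le> 1\<close> and \<open>|x| > 1\<close>.\<close>

lemma schwartz_on_decay:
  assumes "schwartz_on V f"
  shows "\<exists>C\<ge>0. \<forall>x\<in>V. norm (f x) \<le> C * wt (- N) x"
proof -
  have "bdd_above ((\<lambda>x. norm x ^ k * norm (f x)) ` V)" for k :: nat
    using assms[unfolded schwartz_on_def, rule_format, OF lists.Nil] by simp
  then have "\<forall>k::nat. \<exists>A. \<forall>x\<in>V. norm x ^ k * norm (f x) \<le> A"
    by (auto simp: bdd_above_def)
  from choice[OF this] obtain A where A: "\<And>(k::nat) x. x \<in> V \<Longrightarrow> norm x ^ k * norm (f x) \<le> A k"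
    by auto
  obtain n :: nat where "N / 2 \<le> real n"
    using real_arch_simple[of "N / 2"] by auto
  then have n: "N \<le> 2 * real n" by simp
  define C where "C = 2 ^ n * (\<bar>A 0\<bar> + \<bar>A (2 * n)\<bar>)"
  show ?thesis
  proof (intro exI[of _ C] conjI ballI)
    show "0 \<le> C" by (simp add: C_def)
    fix x assume x: "x \<in> V"
    have "(1 + (norm x)\<^sup>2) ^ n \<le> 2 ^ n * (1 + (norm x) ^ (2 * n))"
    proof (cases "norm x \<le> 1")
      case True
      have "(norm x)\<^sup>2 \<le> 1" using True by (simp add: power_le_one)
      then have "(1 + (norm x)\<^sup>2) ^ n \<le> 2 ^ n * 1" by (auto intro!: power_mono)
      also have "\<dots> \<le> 2 ^ n * (1 + (norm x) ^ (2 * n))" by (intro mult_left_mono) auto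
      finally show ?thesis .
    next
      case False
      have "1 \<le> (norm x)\<^sup>2" using False by (simp add: one_le_power)
      then have "(1 + (norm x)\<^sup>2) ^ n \<le> (2 * (norm x)\<^sup>2) ^ n" by (intro power_mono) auto
      also have "\<dots> = 2 ^ n * (norm x) ^ (2 * n)" by (simp add: power_mult_distrib power_mult)
      also have "\<dots> \<le> 2 ^ n * (1 + (norm x) ^ (2 * n))" by (intro mult_left_mono) auto
      finally show ?thesis .
    qed
    then have "wt (2 * real n) x * norm (f x) \<le> 2 ^ n * (1 + (norm x) ^ (2 * n)) * norm (f x)"
      unfolding wt_even by (rule mult_right_mono) simp
    also have "\<dots> = 2 ^ n * (norm x ^ 0 * norm (f x) + norm x ^ (2 * n) * norm (f x))"
      by (simp add: algebra_simps)
    also have "\<dots> \<le> C"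
      unfolding C_def using A[OF x, of 0] A[OF x, of "2 * n"] by (intro mult_left_mono) auto
    finally have "wt (- (2 * real n)) x * (wt (2 * real n) x * norm (f x)) \<le> wt (- (2 * real n)) x * C"
      by (rule mult_left_mono) simp
    moreover have "wt (- (2 * real n)) x * wt (2 * real n) x = 1" by (simp flip: wt_add)
    ultimately have "norm (f x) \<le> wt (- (2 * real n)) x * C"
      by (simp only: mult.assoc[symmetric] mult_1)
    also have "\<dots> \<le> wt (- N) x * C"
      using n by (intro mult_right_mono wt_mono) (auto simp: C_def)
    finally show "norm (f x) \<le> C * wt (- N) x" by (simp add: mult.commute)
  qed
qed

lemma schwartz_on_directional_deriv:
  assumes f: "schwartz_on V f" and v: "v \<in> V"
  shows "schwartz_on V (directional_deriv v f)"
  unfolding schwartz_on_def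
proof
  fix vs assume "vs \<in> lists V"
  then have "v # vs \<in> lists V" using v by simp
  then show "fold directional_deriv vs (directional_deriv v f) differentiable_on V \<and>
      (\<forall>k::nat. bdd_above ((\<lambda>x. norm x ^ k * norm (fold directional_deriv vs (directional_deriv v f) x)) ` V))"
    using f[unfolded schwartz_on_def, rule_format, of "v # vs"] by simp
qed

text \<open>
  Differentiability on \<open>V\<close> is relative to \<open>V\<close>, but the projection takes all its values in \<open>V\<close>, so the composition is
  differentiable on the whole space. Its partial derivatives are directional derivatives along the projected
  basis vectors, which lie in \<open>V\<close>, composed with the projection; so the argument can be iterated.
\<close>

lemma has_derivative_compose_projection:
  fixes f :: "'a::euclidean_space \<Rightarrow> complex"
  assumes V: "subspace V" and f: "f differentiable_on V"
  shows "((\<lambda>x. f (closest_point V x)) has_derivative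
    (\<lambda>h. \<Sum>e\<in>Basis. of_real (h \<bullet> e) * directional_deriv (closest_point V e) f (closest_point V x))) (at x)"
proof -
  let ?P = "closest_point V"
  have lin: "linear ?P" by (rule linear_closest_point_subspace[OF V])
  have PV: "?P y \<in> V" for y by (rule closest_point_subspace_in[OF V])
  obtain f' where f': "(f has_derivative f') (at (?P x) within V)"
    using f PV unfolding differentiable_on_def differentiable_def by blast
  have linf': "linear f'" using f' by (rule has_derivative_linear)
  have "(?P has_derivative ?P) (at x)"
    by (rule bounded_linear_imp_has_derivative) (use lin in \<open>simp add: linear_conv_bounded_linear\<close>)
  then have comp: "((\<lambda>x. f (?P x)) has_derivative (\<lambda>h. f' (?P h))) (at x)"
    by (rule has_derivative_in_compose[where g = f])
       (rule has_derivative_subset[OF f'], use PV in auto)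
  have dir: "directional_deriv v f (?P x) = f' v" if v: "v \<in> V" for v
  proof -
    have "((\<lambda>t. f (?P x + t *\<^sub>R v)) has_derivative (\<lambda>t. f' (t *\<^sub>R v))) (at 0)"
    proof (rule has_derivative_in_compose[where g = f and f = "\<lambda>t. ?P x + t *\<^sub>R v"])
      show "((\<lambda>t. ?P x + t *\<^sub>R v) has_derivative (\<lambda>t. t *\<^sub>R v)) (at 0)"
        by (auto intro!: derivative_eq_intros)
      have "range (\<lambda>t. ?P x + t *\<^sub>R v) \<subseteq> V"
        using v PV by (auto intro!: subspace_add[OF V] subspace_scale[OF V])
      then show "(f has_derivative f') (at (?P x + 0 *\<^sub>R v) within range (\<lambda>t. ?P x + t *\<^sub>R v))"
        using has_derivative_subset[OF f'] by simp
    qed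
    then have "((\<lambda>t. f (?P x + t *\<^sub>R v)) has_vector_derivative f' v) (at 0)"
      unfolding has_vector_derivative_def by (simp add: linear_scale[OF linf'])
    then show ?thesis
      unfolding directional_deriv_def by (rule vector_derivative_at)
  qed
  have "f' (?P h) = (\<Sum>e\<in>Basis. of_real (h \<bullet> e) * directional_deriv (?P e) f (?P x))" for h
  proof -
    have "?P h = (\<Sum>e\<in>Basis. (h \<bullet> e) *\<^sub>R ?P e)"
      by (subst euclidean_representation[of h, symmetric])
         (simp only: linear_sum[OF lin] linear_scale[OF lin])
    then have "f' (?P h) = (\<Sum>e\<in>Basis. (h \<bullet> e) *\<^sub>R f' (?P e))"
      by (simp only: linear_sum[OF linf'] linear_scale[OF linf'])
    then show ?thesis by (simp add: dir[OF PV] scaleR_conv_of_real)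
  qed
  with comp show ?thesis by simp
qed

lemma schwartz_on_derivs_bounded:
  fixes f :: "'a::euclidean_space \<Rightarrow> complex"
  assumes V: "subspace V" and f: "schwartz_on V f"
  shows "\<exists>C\<ge>0. derivs_bounded m (\<lambda>x. f (closest_point V x)) (\<lambda>x. C * wt (- N) (closest_point V x))"
  using f
proof (induction m arbitrary: f)
  case 0
  then show ?case
    using schwartz_on_decay[OF 0, of N] closest_point_subspace_in[OF V] by simp blast
next
  case (Suc m)
  let ?P = "closest_point V"
  let ?D = "\<lambda>e x. directional_deriv (?P e) f (?P x)"
  have PV: "?P y \<in> V" for y by (rule closest_point_subspace_in[OF V])
  obtain C0 where C0: "0 \<le> C0" "\<And>x. norm (f (?P x)) \<le> C0 * wt (- N) (?P x)"
    using schwartz_on_decay[OF Suc.prems, of N] PV by blast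
  have "\<forall>e. \<exists>C\<ge>0. derivs_bounded m (?D e) (\<lambda>x. C * wt (- N) (?P x))"
    by (intro allI Suc.IH schwartz_on_directional_deriv Suc.prems PV)
  from choice[OF this] obtain C where
    "\<forall>e. 0 \<le> C e \<and> derivs_bounded m (?D e) (\<lambda>x. C e * wt (- N) (?P x))" ..
  then have C: "0 \<le> C e"
    "derivs_bounded m (?D e) (\<lambda>x. C e * wt (- N) (?P x))" for e
    by simp_all
  define A where "A = C0 + (\<Sum>e\<in>Basis. C e)"
  have A: "C0 \<le> A" "\<And>e. e \<in> Basis \<Longrightarrow> C e \<le> A"
    using C(1) C0(1) member_le_sum[of _ Basis C] unfolding A_def
    by (auto simp: sum_nonneg add_increasing)
  have diff: "f differentiable_on V"
    using Suc.prems[unfolded schwartz_on_def, rule_format, OF lists.Nil] by simp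
  show ?case
  proof (intro exI[of _ A] conjI derivs_bounded_SucI[OF _ has_derivative_compose_projection[OF V diff]])
    show "0 \<le> A" using A(1) C0(1) by simp
    show "norm (f (?P x)) \<le> A * wt (- N) (?P x)" for x
      by (rule order_trans[OF C0(2)]) (intro mult_right_mono A, simp)
    show "derivs_bounded m (?D e) (\<lambda>x. A * wt (- N) (?P x))"
      if "e \<in> Basis" for e
      by (rule derivs_bounded_mono[OF C(2)]) (intro mult_right_mono A that, simp)
  qed
qed

text \<open>
  The property of the symbol \<open>F\<close> on which all later estimates rest. It is the Schwartz property in terms of
  \<^const>\<open>derivs_bounded\<close>, and unlike that of a tensor product it makes no reference to the splitting of the space.
\<close>

definition rapidly_decreasing :: "('a::euclidean_space \<Rightarrow> complex) \<Rightarrow> bool" where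
  "rapidly_decreasing F \<longleftrightarrow> (\<forall>m N. \<exists>C\<ge>0. derivs_bounded m F (\<lambda>x. C * wt (- N) x))"

lemma rapidly_decreasing_schwartz:
  assumes "schwartz \<phi>" shows "rapidly_decreasing \<phi>"
proof -
  have "closest_point UNIV x = x" for x :: 'a by (rule closest_point_self) simp
  then show ?thesis
    using schwartz_on_derivs_bounded[OF subspace_UNIV assms] by (simp add: rapidly_decreasing_def)
qed

text \<open>
  Decay in the two components separately gives decay in \<open>x\<close>, by Peetre's inequality for \<open>P x = x - Q x\<close> with
  the projections \<open>P\<close>, \<open>Q\<close> onto \<open>V\<close> and its complement.
\<close>

lemma rapidly_decreasing_tensor_along:
  assumes V: "subspace V" and f: "schwartz_on V f" and g: "schwartz_on (V\<^sup>\<bottom>) g"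
  shows "rapidly_decreasing (tensor_along V f g)"
  unfolding rapidly_decreasing_def
proof (intro allI)
  fix m and N :: real
  let ?P = "closest_point V" and ?Q = "closest_point (V\<^sup>\<bottom>)"
  define M where "M = \<bar>N\<bar>"
  obtain C where C: "0 \<le> C" "derivs_bounded m (\<lambda>x. f (?P x)) (\<lambda>x. C * wt (- M) (?P x))"
    using schwartz_on_derivs_bounded[OF V f] by blast
  obtain C' where C': "0 \<le> C'" "derivs_bounded m (\<lambda>x. g (?Q x)) (\<lambda>x. C' * wt (- M) (?Q x))"
    using schwartz_on_derivs_bounded[OF subspace_orthogonal_comp g] by blast
  define A where "A = 2 ^ m * (C * C' * 2 powr (M / 2))"
  show "\<exists>C\<ge>0. derivs_bounded m (tensor_along V f g) (\<lambda>x. C * wt (- N) x)"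
  proof (intro exI[of _ A] conjI)
    show "0 \<le> A" using C C' by (simp add: A_def)
    have "derivs_bounded m (\<lambda>x. f (?P x) * g (?Q x)) (\<lambda>x. A * wt (- N) x)"
    proof (rule derivs_bounded_mono[OF derivs_bounded_mult[OF C(2) C'(2)]])
      fix x
      have "wt (- M) (?P x) = wt (- M) (x + - ?Q x)"
        by (simp add: closest_point_orthogonal_comp[OF V])
      also have "\<dots> \<le> 2 powr (M / 2) * wt (- M) x * wt M (?Q x)"
        using peetre[of "- M" x "- ?Q x"] by (simp add: M_def)
      finally have "wt (- M) (?P x) * wt (- M) (?Q x) \<le> 2 powr (M / 2) * wt (- M) x * wt M (?Q x) * wt (- M) (?Q x)"
        by (rule mult_right_mono) simp
      also have "\<dots> = 2 powr (M / 2) * wt (- M) x * (wt M (?Q x) * wt (- M) (?Q x))" by simp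
      also have "\<dots> = 2 powr (M / 2) * wt (- M) x" by (simp flip: wt_add)
      also have "\<dots> \<le> 2 powr (M / 2) * wt (- N) x"
        by (intro mult_left_mono wt_mono) (auto simp: M_def)
      finally have *: "wt (- M) (?P x) * wt (- M) (?Q x) \<le> 2 powr (M / 2) * wt (- N) x" .
      have "2 ^ m * (C * wt (- M) (?P x) * (C' * wt (- M) (?Q x)))
          = 2 ^ m * (C * C') * (wt (- M) (?P x) * wt (- M) (?Q x))" by (simp add: mult_ac)
      also have "\<dots> \<le> 2 ^ m * (C * C') * (2 powr (M / 2) * wt (- N) x)"
        using C C' by (intro mult_left_mono *) auto
      finally show "2 ^ m * (C * wt (- M) (?P x) * (C' * wt (- M) (?Q x))) \<le> A * wt (- N) x"
        by (simp add: A_def mult_ac)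
    qed
    then show "derivs_bounded m (tensor_along V f g) (\<lambda>x. A * wt (- N) x)"
      unfolding tensor_along_def[abs_def] .
  qed
qed

lemma rapidly_decreasing_cmult:
  assumes "rapidly_decreasing F" shows "rapidly_decreasing (\<lambda>x. c * F x)"
  unfolding rapidly_decreasing_def
proof (intro allI)
  fix m N
  obtain C where C: "0 \<le> C" "derivs_bounded m F (\<lambda>x. C * wt (- N) x)"
    using assms unfolding rapidly_decreasing_def by blast
  then show "\<exists>C\<ge>0. derivs_bounded m (\<lambda>x. c * F x) (\<lambda>x. C * wt (- N) x)"
    using derivs_bounded_cmult[OF C(2), of c]
    by (intro exI[of _ "norm c * C"]) (simp add: mult.assoc)
qed

lemma rapidly_decreasing_sum:
  "(\<And>i. i \<in> I \<Longrightarrow> rapidly_decreasing (F i)) \<Longrightarrow> rapidly_decreasing (\<lambda>x. \<Sum>i\<in>I. F i x)"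
proof (induction I rule: infinite_finite_induct)
  case (insert i I)
  show ?case unfolding rapidly_decreasing_def
  proof (intro allI)
    fix m N
    obtain C where C: "0 \<le> C" "derivs_bounded m (F i) (\<lambda>x. C * wt (- N) x)"
      using insert.prems[of i] unfolding rapidly_decreasing_def by blast
    obtain C' where C': "0 \<le> C'" "derivs_bounded m (\<lambda>x. \<Sum>i\<in>I. F i x) (\<lambda>x. C' * wt (- N) x)"
      using insert unfolding rapidly_decreasing_def by blast
    show "\<exists>C\<ge>0. derivs_bounded m (\<lambda>x. \<Sum>i\<in>insert i I. F i x) (\<lambda>x. C * wt (- N) x)"
      using derivs_bounded_add[OF C(2) C'(2)] C C' insert.hyps
      by (intro exI[of _ "C + C'"]) (simp add: distrib_right)
  qed
qed (auto simp: rapidly_decreasing_def intro!: exI[of _ 0] derivs_bounded_constant)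

section \<open>Symbol estimates for weights and characters\<close>

lemma wt_has_derivative:
  "(wt \<gamma> has_derivative (\<lambda>h. \<gamma> * (x \<bullet> h) * wt (\<gamma> - 2) x)) (at x within S)"
proof -
  have p: "0 < 1 + x \<bullet> x" by (simp add: add_pos_nonneg)
  have "((\<lambda>u. u powr (\<gamma> / 2)) has_real_derivative (\<gamma> / 2 * (1 + x \<bullet> x) powr (\<gamma> / 2 - 1))) (at (1 + x \<bullet> x))"
    using p by (auto intro!: derivative_eq_intros)
  moreover have "((\<lambda>x. 1 + x \<bullet> x) has_derivative (\<lambda>h. 2 * (x \<bullet> h))) (at x within S)"
    by (auto intro!: derivative_eq_intros simp: inner_commute)
  ultimately have "((\<lambda>x. (1 + x \<bullet> x) powr (\<gamma> / 2)) has_derivative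
      (\<lambda>h. 2 * (x \<bullet> h) * (\<gamma> / 2 * (1 + x \<bullet> x) powr (\<gamma> / 2 - 1)))) (at x within S)"
    by (rule DERIV_compose_FDERIV)
  moreover have "(1 + x \<bullet> x) powr (\<gamma> / 2 - 1) = wt (\<gamma> - 2) x"
    by (simp add: wt_def power2_norm_eq_inner diff_divide_distrib)
  ultimately show ?thesis
    by (simp add: wt_def[abs_def] power2_norm_eq_inner mult_ac)
qed

text \<open>The partial derivative of \<open>wt \<gamma>\<close> in the direction \<open>e\<close>.\<close>

definition wt_partial :: "real \<Rightarrow> 'a::euclidean_space \<Rightarrow> 'a \<Rightarrow> complex" where
  "wt_partial \<gamma> e s = of_real \<gamma> * (of_real (s \<bullet> e) * of_real (wt (\<gamma> - 2) s))"

lemma of_real_wt_has_derivative: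
  "((\<lambda>s. complex_of_real (wt \<gamma> s)) has_derivative (\<lambda>h. \<Sum>e\<in>Basis. of_real (h \<bullet> e) * wt_partial \<gamma> e x)) (at x)"
proof -
  have "(\<Sum>e\<in>Basis. complex_of_real (h \<bullet> e) * wt_partial \<gamma> e x) = of_real (\<gamma> * (x \<bullet> h) * wt (\<gamma> - 2) x)" for h
  proof -
    have "x \<bullet> h = (\<Sum>e\<in>Basis. (h \<bullet> e) * (x \<bullet> e))"
      by (subst euclidean_inner) (simp add: mult.commute)
    then show ?thesis by (simp add: wt_partial_def sum_distrib_left sum_distrib_right mult_ac)
  qed
  with has_derivative_of_real[OF wt_has_derivative[of \<gamma> x UNIV], where ?'a = complex] show ?thesis
    by simp
qed

lemma derivs_bounded_coordinate:
  fixes e :: "'a::euclidean_space"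
  assumes e: "e \<in> Basis"
  shows "derivs_bounded m (\<lambda>s. complex_of_real (s \<bullet> e)) (wt 1)"
proof (cases m)
  case 0
  then show ?thesis
    using order_trans[OF Basis_le_norm[OF e] norm_le_wt_1] by simp
next
  case (Suc k)
  show ?thesis
    unfolding Suc
  proof (rule derivs_bounded_SucI[where D = "\<lambda>b (s::'a). of_real (b \<bullet> e)"])
    show "norm (complex_of_real (x \<bullet> e)) \<le> wt 1 x" for x
      using Basis_le_norm[OF e, of x] norm_le_wt_1[of x] by simp
    have "(\<Sum>b\<in>Basis. complex_of_real (h \<bullet> b) * of_real (b \<bullet> e)) = of_real (h \<bullet> e)" for h
      using e by (simp add: inner_Basis if_distrib cong: if_cong)
    then show "((\<lambda>s. complex_of_real (s \<bullet> e)) has_derivative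
        (\<lambda>h. \<Sum>b\<in>Basis. complex_of_real (h \<bullet> b) * complex_of_real (b \<bullet> e))) (at x)" for x
      by (auto intro!: derivative_eq_intros)
    show "derivs_bounded k (\<lambda>s::'a. complex_of_real (b \<bullet> e)) (wt 1)" if "b \<in> Basis" for b
    proof (rule derivs_bounded_constant)
      fix x :: 'a
      have "norm (complex_of_real (b \<bullet> e)) \<le> 1" using that e by (simp add: inner_Basis)
      also have "\<dots> \<le> wt 1 x" by (rule wt_ge_1) simp
      finally show "norm (complex_of_real (b \<bullet> e)) \<le> wt 1 x" .
    qed
  qed
qed

lemma derivs_bounded_wt_partial_step:
  fixes e :: "'a::euclidean_space"
  assumes C: "derivs_bounded m (\<lambda>s::'a. complex_of_real (wt (\<gamma> - 2) s)) (\<lambda>s. C * wt (\<gamma> - 2) s)" and e: "e \<in> Basis"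
  shows "derivs_bounded m (wt_partial \<gamma> e) (\<lambda>s. \<bar>\<gamma>\<bar> * 2 ^ m * C * wt (\<gamma> - 1) s)"
proof -
  have w: "wt (\<gamma> - 1) s = wt 1 s * wt (\<gamma> - 2) s" for s :: 'a
    by (simp flip: wt_add)
  show ?thesis
    using derivs_bounded_cmult[OF derivs_bounded_mult[OF derivs_bounded_coordinate[OF e, of m] C], of "of_real \<gamma>"]
    unfolding wt_partial_def[abs_def] w by (simp add: mult_ac)
qed

text \<open>
  A derivative of \<open>wt \<gamma>\<close> is a coordinate times \<open>wt (\<gamma> - 2)\<close>, hence of order \<open>\<gamma> - 1\<close>, by the induction hypothesis
  for \<open>\<gamma> - 2\<close>.
\<close>

lemma derivs_bounded_wt:
  "\<exists>C\<ge>0. derivs_bounded m (\<lambda>s::'a::euclidean_space. complex_of_real (wt \<gamma> s)) (\<lambda>s. C * wt \<gamma> s)"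
proof (induction m arbitrary: \<gamma>)
  case 0
  show ?case by (intro exI[of _ 1]) simp
next
  case (Suc m)
  obtain C where C: "0 \<le> C" "derivs_bounded m (\<lambda>s::'a. complex_of_real (wt (\<gamma> - 2) s)) (\<lambda>s. C * wt (\<gamma> - 2) s)"
    using Suc[of "\<gamma> - 2"] by blast
  define A where "A = 1 + \<bar>\<gamma>\<bar> * 2 ^ m * C"
  have A: "0 \<le> \<bar>\<gamma>\<bar> * 2 ^ m * C" using C by simp
  show ?case
  proof (intro exI[of _ A] conjI derivs_bounded_SucI[OF _ of_real_wt_has_derivative])
    show "0 \<le> A" using A by (simp add: A_def)
    show "norm (complex_of_real (wt \<gamma> x)) \<le> A * wt \<gamma> x" for x :: 'a
      using A by (simp add: A_def distrib_right)
    show "derivs_bounded m (wt_partial \<gamma> e) (\<lambda>s. A * wt \<gamma> s)" if "e \<in> Basis" for e :: 'a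
    proof (rule derivs_bounded_mono[OF derivs_bounded_wt_partial_step[OF C(2) that]])
      show "\<bar>\<gamma>\<bar> * 2 ^ m * C * wt (\<gamma> - 1) x \<le> A * wt \<gamma> x" for x :: 'a
        using A by (intro mult_mono wt_mono) (auto simp: A_def)
    qed
  qed
qed

lemma derivs_bounded_wt_partial:
  "\<exists>C\<ge>0. \<forall>e\<in>Basis. derivs_bounded m (wt_partial \<gamma> e) (\<lambda>s::'a::euclidean_space. C * wt (\<gamma> - 1) s)"
proof -
  obtain C where C: "0 \<le> C" "derivs_bounded m (\<lambda>s::'a. complex_of_real (wt (\<gamma> - 2) s)) (\<lambda>s. C * wt (\<gamma> - 2) s)"
    using derivs_bounded_wt[of m "\<gamma> - 2"] by blast
  show ?thesis
    by (intro exI[of _ "\<bar>\<gamma>\<bar> * 2 ^ m * C"] conjI ballI derivs_bounded_wt_partial_step C) (use C in auto)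
qed

text \<open>
  The mean value inequality on the segment from \<open>s\<close> to \<open>r\<close>, with the weight at an intermediate point compared to that
  at \<open>s\<close> by Peetre's inequality. The gain of one order over either weight is what the commutator contributes to the
  exponent \<open>\<beta> - \<alpha> + 1\<close>.
\<close>

lemma wt_difference_le:
  "\<bar>wt \<alpha> r - wt \<alpha> s\<bar> \<le> \<bar>\<alpha>\<bar> * 2 powr (\<bar>\<alpha> - 1\<bar> / 2) * (wt (\<alpha> - 1) s * wt (\<bar>\<alpha> - 1\<bar> + 1) (r - s))"
proof -
  define B where "B = \<bar>\<alpha>\<bar> * (2 powr (\<bar>\<alpha> - 1\<bar> / 2) * wt (\<alpha> - 1) s * wt (\<bar>\<alpha> - 1\<bar>) (r - s))"
  have "norm (wt \<alpha> r - wt \<alpha> s) \<le> B * norm (r - s)"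
  proof (rule differentiable_bound[where S = "closed_segment s r"])
    show "(wt \<alpha> has_derivative (\<lambda>h. \<alpha> * (z \<bullet> h) * wt (\<alpha> - 2) z)) (at z within closed_segment s r)" for z
      by (rule wt_has_derivative)
    fix z assume z: "z \<in> closed_segment s r"
    show "onorm (\<lambda>h. \<alpha> * (z \<bullet> h) * wt (\<alpha> - 2) z) \<le> B"
    proof (rule onorm_bound)
      show "0 \<le> B" by (simp add: B_def)
      fix h
      have "norm (z - s) \<le> norm (r - s)" using segment_bound(1)[OF z] by simp
      then have zr: "wt (\<bar>\<alpha> - 1\<bar>) (z - s) \<le> wt (\<bar>\<alpha> - 1\<bar>) (r - s)" by (rule wt_le_of_norm_le) simp
      have "wt (\<alpha> - 1) (s + (z - s)) \<le> 2 powr (\<bar>\<alpha> - 1\<bar> / 2) * wt (\<alpha> - 1) s * wt (\<bar>\<alpha> - 1\<bar>) (r - s)"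
        by (rule order_trans[OF peetre]) (rule mult_left_mono[OF zr], simp)
      then have zs: "wt (\<alpha> - 1) z \<le> 2 powr (\<bar>\<alpha> - 1\<bar> / 2) * wt (\<alpha> - 1) s * wt (\<bar>\<alpha> - 1\<bar>) (r - s)" by simp
      have "norm (\<alpha> * (z \<bullet> h) * wt (\<alpha> - 2) z) \<le> \<bar>\<alpha>\<bar> * (norm z * norm h) * wt (\<alpha> - 2) z"
        by (auto simp: abs_mult intro!: mult_right_mono mult_left_mono Cauchy_Schwarz_ineq2)
      also have "\<dots> \<le> \<bar>\<alpha>\<bar> * (wt 1 z * norm h) * wt (\<alpha> - 2) z"
        by (intro mult_right_mono mult_left_mono norm_le_wt_1) auto
      also have "\<dots> = \<bar>\<alpha>\<bar> * wt (1 + (\<alpha> - 2)) z * norm h" unfolding wt_add by simp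
      also have "\<dots> = \<bar>\<alpha>\<bar> * wt (\<alpha> - 1) z * norm h" by simp
      also have "\<dots> \<le> B * norm h"
        unfolding B_def by (intro mult_right_mono mult_left_mono zs) auto
      finally show "norm (\<alpha> * (z \<bullet> h) * wt (\<alpha> - 2) z) \<le> B * norm h" .
    qed
  qed auto
  also have "\<dots> \<le> B * wt 1 (r - s)"
    by (intro mult_left_mono norm_le_wt_1) (simp add: B_def)
  also have "\<dots> = \<bar>\<alpha>\<bar> * 2 powr (\<bar>\<alpha> - 1\<bar> / 2) * (wt (\<alpha> - 1) s * wt (\<bar>\<alpha> - 1\<bar> + 1) (r - s))"
    unfolding B_def wt_add by simp
  finally show ?thesis by simp
qed

text \<open>
  Only the undifferentiated difference needs the mean value theorem; its derivatives are those of a single weight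
  and have order \<open>\<alpha> - 1\<close> anyway.
\<close>

lemma derivs_bounded_wt_difference:
  "\<exists>C\<ge>0. \<forall>r. derivs_bounded m (\<lambda>s. complex_of_real (wt \<alpha> r - wt \<alpha> s))
     (\<lambda>s::'a::euclidean_space. C * (wt (\<alpha> - 1) s * wt (\<bar>\<alpha> - 1\<bar> + 1) (r - s)))"
proof -
  obtain C where C: "0 \<le> C" "\<And>e. e \<in> Basis \<Longrightarrow> derivs_bounded m (wt_partial \<alpha> e) (\<lambda>s::'a. C * wt (\<alpha> - 1) s)"
    using derivs_bounded_wt_partial[where 'a = 'a, of m \<alpha>] by blast
  define C0 where "C0 = \<bar>\<alpha>\<bar> * 2 powr (\<bar>\<alpha> - 1\<bar> / 2)"
  have C0: "0 \<le> C0" by (simp add: C0_def)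
  have "derivs_bounded (Suc m) (\<lambda>s. complex_of_real (wt \<alpha> r - wt \<alpha> s))
     (\<lambda>s::'a. (C0 + C) * (wt (\<alpha> - 1) s * wt (\<bar>\<alpha> - 1\<bar> + 1) (r - s)))" for r
  proof (rule derivs_bounded_SucI[where D = "\<lambda>e s. (-1) * wt_partial \<alpha> e s"])
    show "norm (complex_of_real (wt \<alpha> r - wt \<alpha> x)) \<le> (C0 + C) * (wt (\<alpha> - 1) x * wt (\<bar>\<alpha> - 1\<bar> + 1) (r - x))" for x
    proof -
      have "\<bar>wt \<alpha> r - wt \<alpha> x\<bar> \<le> C0 * (wt (\<alpha> - 1) x * wt (\<bar>\<alpha> - 1\<bar> + 1) (r - x))"
        unfolding C0_def by (rule wt_difference_le)
      also have "\<dots> \<le> (C0 + C) * (wt (\<alpha> - 1) x * wt (\<bar>\<alpha> - 1\<bar> + 1) (r - x))"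
        using C by (intro mult_right_mono) auto
      finally show ?thesis by (simp only: norm_of_real)
    qed
    show "((\<lambda>s. complex_of_real (wt \<alpha> r - wt \<alpha> s)) has_derivative
        (\<lambda>h. \<Sum>e\<in>Basis. complex_of_real (h \<bullet> e) * (- 1 * wt_partial \<alpha> e x))) (at x)" for x
      using has_derivative_diff[OF has_derivative_const of_real_wt_has_derivative[of \<alpha> x], of "of_real (wt \<alpha> r)"]
      by (simp add: sum_negf)
    show "derivs_bounded m (\<lambda>s. - 1 * wt_partial \<alpha> e s)
        (\<lambda>s. (C0 + C) * (wt (\<alpha> - 1) s * wt (\<bar>\<alpha> - 1\<bar> + 1) (r - s)))" if e: "e \<in> Basis" for e
    proof (rule derivs_bounded_mono[OF derivs_bounded_cmult[OF C(2)[OF e]]])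
      fix s :: 'a
      have "wt (\<alpha> - 1) s * 1 \<le> wt (\<alpha> - 1) s * wt (\<bar>\<alpha> - 1\<bar> + 1) (r - s)"
        by (intro mult_left_mono wt_ge_1) auto
      then show "norm (- 1 :: complex) * (C * wt (\<alpha> - 1) s) \<le> (C0 + C) * (wt (\<alpha> - 1) s * wt (\<bar>\<alpha> - 1\<bar> + 1) (r - s))"
        using C C0 by (simp add: mult_mono)
    qed
  qed
  from derivs_bounded_Suc_imp[OF this] show ?thesis
    using C0 C by (intro exI[of _ "C0 + C"]) simp
qed

text \<open>The bound is uniform in the base point \<open>q\<close> and polynomial in the frequency \<open>y\<close>, which will be proportional to \<open>r - q\<close>.\<close>

lemma derivs_bounded_character:
  "derivs_bounded m (\<lambda>s. exp (\<i> * complex_of_real ((s - q) \<bullet> y))) (\<lambda>s. (1 + norm y) ^ m)"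
proof (induction m)
  case 0
  show ?case by simp
next
  case (Suc m)
  let ?\<chi> = "\<lambda>s. exp (\<i> * complex_of_real ((s - q) \<bullet> y))"
  have p: "(1 + norm y) ^ m \<le> (1 + norm y) ^ Suc m" by (intro power_increasing) auto
  show ?case
  proof (rule derivs_bounded_SucI[where D = "\<lambda>e s. (\<i> * of_real (e \<bullet> y)) * ?\<chi> s"])
    show "norm (?\<chi> x) \<le> (1 + norm y) ^ Suc m" for x
      by (simp add: one_le_power del: power_Suc)
    show "((\<lambda>s. ?\<chi> s) has_derivative
        (\<lambda>h. \<Sum>e\<in>Basis. of_real (h \<bullet> e) * (\<i> * of_real (e \<bullet> y) * ?\<chi> x))) (at x)" for x
    proof -
      have hy: "(\<Sum>e\<in>Basis. complex_of_real (h \<bullet> e) * of_real (e \<bullet> y)) = of_real (h \<bullet> y)" for h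
        by (subst euclidean_inner[of h y]) (simp add: inner_commute)
      have "(\<Sum>e\<in>Basis. of_real (h \<bullet> e) * (\<i> * of_real (e \<bullet> y) * ?\<chi> x))
          = \<i> * (\<Sum>e\<in>Basis. complex_of_real (h \<bullet> e) * of_real (e \<bullet> y)) * ?\<chi> x" for h
        by (simp add: sum_distrib_left sum_distrib_right mult_ac)
      moreover have "((\<lambda>s. ?\<chi> s) has_derivative
          (\<lambda>h. \<i> * of_real (h \<bullet> y) * ?\<chi> x)) (at x)"
      proof -
        have "((\<lambda>s. \<i> * complex_of_real ((s - q) \<bullet> y)) has_derivative (\<lambda>h. \<i> * complex_of_real (h \<bullet> y))) (at x)"
          by (auto intro!: derivative_eq_intros)
        from has_derivative_compose[OF this DERIV_exp[unfolded has_field_derivative_def]]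
        show ?thesis by (simp add: mult.commute)
      qed
      ultimately show ?thesis by (simp only: hy)
    qed
    show "derivs_bounded m (\<lambda>s. \<i> * of_real (e \<bullet> y) * ?\<chi> s) (\<lambda>s. (1 + norm y) ^ Suc m)"
      if e: "e \<in> Basis" for e
    proof (rule derivs_bounded_mono[OF derivs_bounded_cmult[OF Suc]])
      have "\<bar>e \<bullet> y\<bar> \<le> 1 + norm y" using Basis_le_norm[OF e, of y] by (simp add: inner_commute)
      then have "norm (\<i> * complex_of_real (e \<bullet> y)) * (1 + norm y) ^ m \<le> (1 + norm y) * (1 + norm y) ^ m"
        by (intro mult_right_mono) (auto simp: norm_mult)
      then show "norm (\<i> * complex_of_real (e \<bullet> y)) * (1 + norm y) ^ m \<le> (1 + norm y) ^ Suc m" by simp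
    qed
  qed
qed

section \<open>The kernel of the commutator\<close>

text \<open>The kernel of \<^term>\<open>U_op \<theta> F\<close>, from the substitution \<open>t = r - s\<close> in its defining integral.\<close>

definition moyal_kernel :: "real^'n^'n \<Rightarrow> (real^'n \<Rightarrow> complex) \<Rightarrow> real^'n \<Rightarrow> real^'n \<Rightarrow> complex" where
  "moyal_kernel \<theta> F r s = F (r - s) * exp (- (\<i> / 2) * of_real ((r - s) \<bullet> (\<theta> *v r)))"

definition commutator_kernel ::
    "real^'n^'n \<Rightarrow> (real^'n \<Rightarrow> complex) \<Rightarrow> real \<Rightarrow> real \<Rightarrow> real^'n \<Rightarrow> real^'n \<Rightarrow> complex" where
  "commutator_kernel \<theta> F \<alpha> \<beta> r s =
     of_real (wt \<alpha> r - wt \<alpha> s) * of_real (wt (- \<beta>) s) * moyal_kernel \<theta> F r s"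

lemma wt_1_power: "wt 1 x ^ n = wt (real n) x"
  by (simp add: powr_realpow[symmetric] wt_powr)

lemma rapidly_decreasing_imp_continuous:
  assumes "rapidly_decreasing F" shows "continuous_on S F"
proof -
  obtain C where "derivs_bounded (Suc 0) F (\<lambda>x. C * wt 0 x)"
    using assms unfolding rapidly_decreasing_def by (metis minus_zero)
  then show ?thesis
    by (auto elim!: derivs_bounded_SucE simp del: derivs_bounded.simps
        intro!: continuous_at_imp_continuous_on has_derivative_continuous)
qed

text \<open>
  The phase \<open>- (r - s, \<theta> r) / 2\<close> relative to a base point \<open>q\<close>: since \<open>(s, \<theta> r)\<close> is the sum of \<open>(q, \<theta> r)\<close>,
  \<open>(s - q, \<theta> q)\<close> and \<open>(s - q, \<theta> (r - q))\<close>, it splits into a part that depends on \<open>s\<close> only (the column phase), a part that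
  depends on \<open>r\<close> only (the row phase), and a part that varies slowly for \<open>r\<close> and \<open>s\<close> close to \<open>q\<close>.
\<close>

definition phase_column :: "real^'n^'n \<Rightarrow> real^'n \<Rightarrow> real^'n \<Rightarrow> complex" where
  "phase_column \<theta> q s = exp (\<i> * of_real ((s - q) \<bullet> ((1 / 2) *\<^sub>R (\<theta> *v q))))"

definition phase_row :: "real^'n^'n \<Rightarrow> real^'n \<Rightarrow> real^'n \<Rightarrow> complex" where
  "phase_row \<theta> q r = exp (- (\<i> / 2) * of_real (r \<bullet> (\<theta> *v r) - q \<bullet> (\<theta> *v r)))"

definition local_symbol ::
    "real^'n^'n \<Rightarrow> (real^'n \<Rightarrow> complex) \<Rightarrow> real \<Rightarrow> real \<Rightarrow> real^'n \<Rightarrow> real^'n \<Rightarrow> real^'n \<Rightarrow> complex" where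
  "local_symbol \<theta> F \<alpha> \<beta> q r s = phase_row \<theta> q r *
     (of_real (wt \<alpha> r - wt \<alpha> s) * (of_real (wt (- \<beta>) s) *
       (F (r - s) * exp (\<i> * of_real ((s - q) \<bullet> ((1 / 2) *\<^sub>R (\<theta> *v (r - q))))))))"

lemma commutator_kernel_factor:
  "commutator_kernel \<theta> F \<alpha> \<beta> r s = phase_column \<theta> q s * local_symbol \<theta> F \<alpha> \<beta> q r s"
proof -
  have "- (\<i> / 2) * complex_of_real ((r - s) \<bullet> (\<theta> *v r))
      = \<i> * of_real ((s - q) \<bullet> ((1 / 2) *\<^sub>R (\<theta> *v q))) + (- (\<i> / 2) * of_real (r \<bullet> (\<theta> *v r) - q \<bullet> (\<theta> *v r))
        + \<i> * of_real ((s - q) \<bullet> ((1 / 2) *\<^sub>R (\<theta> *v (r - q)))))"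
    by (simp add: algebra_simps)
  then have "exp (- (\<i> / 2) * complex_of_real ((r - s) \<bullet> (\<theta> *v r)))
      = phase_column \<theta> q s * (phase_row \<theta> q r * exp (\<i> * of_real ((s - q) \<bullet> ((1 / 2) *\<^sub>R (\<theta> *v (r - q))))))"
    by (simp only: exp_add phase_column_def phase_row_def)
  then show ?thesis
    unfolding commutator_kernel_def moyal_kernel_def local_symbol_def by (simp only: mult_ac)
qed

lemma norm_phase_column: "norm (phase_column \<theta> q s) = 1"
  by (simp add: phase_column_def)

lemma norm_phase_row: "norm (phase_row \<theta> q r) = 1"
  by (simp add: phase_row_def)

lemma measurable_phase_column: "phase_column \<theta> q \<in> borel_measurable borel"
  unfolding phase_column_def[abs_def]
  by (intro borel_measurable_continuous_onI continuous_intros)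

text \<open>
  The product of four estimates: order \<open>\<alpha> - 1\<close> in \<open>s\<close> from the difference of weights, order \<open>- \<beta>\<close> from the
  second weight, arbitrarily fast decay in \<open>r - s\<close> from \<open>F\<close>, and growth of order \<open>M\<close> in \<open>r - q\<close> from the character. The
  latter is split by Peetre's inequality into growth in \<open>r - s\<close>, which \<open>F\<close> absorbs, and growth in \<open>s - q\<close>, which is
  harmless because \<open>s\<close> will stay close to \<open>q\<close>.
\<close>

lemma local_symbol_derivs_bounded:
  fixes \<theta> :: "real^'n^'n"
  assumes F: "rapidly_decreasing F"
  shows "\<exists>C\<ge>0. \<forall>q r. derivs_bounded M (local_symbol \<theta> F \<alpha> \<beta> q r)
    (\<lambda>s. C * (wt (- (\<beta> - \<alpha> + 1)) s * decay (r - s) * wt (real M) (s - q)))"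
proof -
  define N1 where "N1 = \<bar>\<alpha> - 1\<bar> + 1"
  \<comment> \<open>enough decay to absorb both growth factors and still leave \<open>decay\<close>\<close>
  define N3 where "N3 = N1 + real M + 2 * real DIM(real^'n)"
  obtain C1 where C1: "0 \<le> C1" "\<And>r. derivs_bounded M (\<lambda>s. complex_of_real (wt \<alpha> r - wt \<alpha> s))
     (\<lambda>s::real^'n. C1 * (wt (\<alpha> - 1) s * wt N1 (r - s)))"
    using derivs_bounded_wt_difference[where ?'a = "real^'n", of M \<alpha>] unfolding N1_def by blast
  obtain C2 where C2: "0 \<le> C2" "derivs_bounded M (\<lambda>s. complex_of_real (wt (- \<beta>) s)) (\<lambda>s::real^'n. C2 * wt (- \<beta>) s)"
    using derivs_bounded_wt[where ?'a = "real^'n", of M "- \<beta>"] by blast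
  obtain C3 where C3: "0 \<le> C3" "derivs_bounded M F (\<lambda>s. C3 * wt (- N3) s)"
    using F unfolding rapidly_decreasing_def by blast
  obtain \<Theta> where \<Theta>: "0 < \<Theta>" "\<And>x. norm (\<theta> *v x) \<le> \<Theta> * norm x"
    using linear_bounded_pos[OF matrix_vector_mul_linear[of \<theta>]] by blast
  define C4 where "C4 = ((1 + \<Theta>) * 2 powr (1 / 2)) ^ M"
  have C4: "0 \<le> C4" using \<Theta> by (simp add: C4_def)
  define y where "y q r = (1 / 2) *\<^sub>R (\<theta> *v (r - q))" for q r
  have y: "(1 + norm (y q r)) ^ M \<le> C4 * (wt (real M) (r - s) * wt (real M) (s - q))" for q r s
  proof -
    have "norm (y q r) \<le> norm (\<theta> *v (r - q))" by (simp add: y_def)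
    also have "\<dots> \<le> \<Theta> * norm (r - q)" by (rule \<Theta>(2))
    also have "\<dots> \<le> \<Theta> * wt 1 (r - q)" using \<Theta>(1) by (intro mult_left_mono norm_le_wt_1) simp
    finally have "1 + norm (y q r) \<le> (1 + \<Theta>) * wt 1 (r - q)"
      using wt_ge_1[of 1 "r - q"] by (simp add: distrib_right)
    also have "\<dots> \<le> (1 + \<Theta>) * (2 powr (1 / 2) * wt 1 (r - s) * wt 1 (s - q))"
      using peetre[of 1 "r - s" "s - q"] \<Theta>(1) by (intro mult_left_mono) auto
    finally have "(1 + norm (y q r)) ^ M \<le> ((1 + \<Theta>) * 2 powr (1 / 2) * (wt 1 (r - s) * wt 1 (s - q))) ^ M"
      by (intro power_mono) (auto simp: mult.assoc)
    then show ?thesis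
      by (simp add: power_mult_distrib C4_def wt_1_power mult.assoc)
  qed
  define C where "C = 2 ^ M * (2 ^ M * 2 ^ M) * (C1 * C2 * C3 * C4)"
  show ?thesis
  proof (intro exI[of _ C] conjI allI)
    show "0 \<le> C" using C1 C2 C3 C4 by (simp add: C_def)
    fix q r
    let ?B = "\<lambda>s. norm (phase_row \<theta> q r) * (2 ^ M * (C1 * (wt (\<alpha> - 1) s * wt N1 (r - s)) * (2 ^ M * (C2 * wt (- \<beta>) s *
        (2 ^ M * (C3 * wt (- N3) (r - s) * (1 + norm (y q r)) ^ M))))))"
    have "derivs_bounded M (\<lambda>s. phase_row \<theta> q r * (of_real (wt \<alpha> r - wt \<alpha> s) * (of_real (wt (- \<beta>) s) *
       (F (r - s) * exp (\<i> * of_real ((s - q) \<bullet> y q r))))))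
      ?B"
      by (intro derivs_bounded_cmult derivs_bounded_mult C1(2) C2(2) derivs_bounded_reflect[OF C3(2)]
          derivs_bounded_character)
    then show "derivs_bounded M (local_symbol \<theta> F \<alpha> \<beta> q r)
      (\<lambda>s. C * (wt (- (\<beta> - \<alpha> + 1)) s * decay (r - s) * wt (real M) (s - q)))"
      unfolding local_symbol_def[abs_def] y_def[symmetric]
    proof (rule derivs_bounded_mono)
      fix s :: "real^'n"
      have w1: "wt (- (\<beta> - \<alpha> + 1)) s = wt (\<alpha> - 1) s * wt (- \<beta>) s"
        unfolding wt_add[symmetric] by (simp add: algebra_simps)
      have w2: "wt N1 (r - s) * (wt (- N3) (r - s) * wt (real M) (r - s)) = decay (r - s)"
        unfolding wt_add[symmetric] by (simp add: decay_def N3_def)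
      let ?A = "2 ^ M * (2 ^ M * 2 ^ M) * (C1 * C2 * C3) * (wt (\<alpha> - 1) s * wt (- \<beta>) s) * (wt N1 (r - s) * wt (- N3) (r - s))"
      have "?B s = ?A * (1 + norm (y q r)) ^ M"
        unfolding norm_phase_row by (simp only: mult_ac mult_1)
      also have "\<dots> \<le> ?A * (C4 * (wt (real M) (r - s) * wt (real M) (s - q)))"
        using C1 C2 C3 by (intro mult_left_mono y) simp
      also have "\<dots> = C * ((wt (\<alpha> - 1) s * wt (- \<beta>) s) * (wt N1 (r - s) * (wt (- N3) (r - s) * wt (real M) (r - s))) * wt (real M) (s - q))"
        unfolding C_def by (simp only: mult_ac)
      also have "\<dots> = C * (wt (- (\<beta> - \<alpha> + 1)) s * decay (r - s) * wt (real M) (s - q))"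
        unfolding w1 w2 ..
      finally show "?B s
        \<le> C * (wt (- (\<beta> - \<alpha> + 1)) s * decay (r - s) * wt (real M) (s - q))" .
    qed
  qed
qed

lemma continuous_moyal_kernel:
  fixes \<theta> :: "real^'n^'n"
  assumes F: "rapidly_decreasing F"
  shows "continuous_on UNIV (\<lambda>p. moyal_kernel \<theta> F (fst p) (snd p))"
proof -
  have "continuous_on UNIV (\<lambda>p::(real^'n) \<times> (real^'n). F (fst p - snd p))"
    by (rule continuous_on_compose2[OF rapidly_decreasing_imp_continuous[OF F, of UNIV]])
       (intro continuous_intros, simp)
  moreover have "continuous_on UNIV (\<lambda>p::(real^'n) \<times> (real^'n). \<theta> *v fst p)"
    by (intro linear_continuous_on_compose[OF continuous_on_fst[OF continuous_on_id]] matrix_vector_mul_linear)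
  ultimately show ?thesis
    unfolding moyal_kernel_def by (intro continuous_intros)
qed

lemma decaying_kernelI:
  assumes "(\<lambda>p. K (fst p) (snd p)) \<in> borel_measurable borel" "0 \<le> c"
    "\<And>r s. norm (K r s) \<le> c * decay (r - s)"
  shows "decaying_kernel c K"
proof -
  have "(\<lambda>(r, s). K r s) = (\<lambda>p. K (fst p) (snd p))" by auto
  with assms show ?thesis unfolding decaying_kernel_def by auto
qed

lemma decaying_moyal_kernel:
  fixes \<theta> :: "real^'n^'n"
  assumes F: "rapidly_decreasing F"
  shows "\<exists>C. decaying_kernel C (moyal_kernel \<theta> F)"
proof -
  obtain C where C: "0 \<le> C" "derivs_bounded 0 F (\<lambda>x. C * wt (- (2 * real DIM(real^'n))) x)"
    using F unfolding rapidly_decreasing_def by blast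
  have "norm (moyal_kernel \<theta> F r s) \<le> C * decay (r - s)" for r s
    using derivs_boundedD[OF C(2), of "r - s"] by (simp add: moyal_kernel_def norm_mult decay_def)
  with decaying_kernelI[OF borel_measurable_continuous_onI[OF continuous_moyal_kernel[OF F]] C(1)]
  show ?thesis by blast
qed

lemma decaying_commutator_kernel:
  fixes \<theta> :: "real^'n^'n"
  assumes F: "rapidly_decreasing F" and "\<alpha> \<le> \<beta> + 1"
  shows "\<exists>C. decaying_kernel C (commutator_kernel \<theta> F \<alpha> \<beta>)"
proof -
  obtain C where C: "0 \<le> C" "\<And>q r. derivs_bounded 0 (local_symbol \<theta> F \<alpha> \<beta> q r)
    (\<lambda>s. C * (wt (- (\<beta> - \<alpha> + 1)) s * decay (r - s) * wt (real 0) (s - q)))"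
    using local_symbol_derivs_bounded[OF F, of 0 \<theta> \<alpha> \<beta>] by blast
  have "norm (commutator_kernel \<theta> F \<alpha> \<beta> r s) \<le> C * decay (r - s)" for r s
  proof -
    have "norm (commutator_kernel \<theta> F \<alpha> \<beta> r s) = norm (local_symbol \<theta> F \<alpha> \<beta> s r s)"
      unfolding commutator_kernel_factor[of \<theta> F \<alpha> \<beta> r s s] norm_mult norm_phase_column by simp
    also have "\<dots> \<le> C * (wt (- (\<beta> - \<alpha> + 1)) s * decay (r - s))"
      using derivs_boundedD[OF C(2), of s r s] by simp
    also have "\<dots> \<le> C * (1 * decay (r - s))"
    proof (intro mult_left_mono mult_right_mono C)
      show "wt (- (\<beta> - \<alpha> + 1)) s \<le> 1" using wt_mono[of "- (\<beta> - \<alpha> + 1)" 0 s] assms(2) by simp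
    qed simp
    finally show ?thesis by simp
  qed
  moreover have "(\<lambda>p. commutator_kernel \<theta> F \<alpha> \<beta> (fst p) (snd p)) \<in> borel_measurable borel"
    unfolding commutator_kernel_def
    by (intro borel_measurable_continuous_onI continuous_intros continuous_moyal_kernel F)
  ultimately show ?thesis using decaying_kernelI[OF _ C(1)] by blast
qed

lemma separably_approximable_commutator_kernel:
  fixes \<theta> :: "real^'n^'n"
  assumes F: "rapidly_decreasing F" and "\<alpha> \<le> \<beta> + 1"
  shows "separably_approximable (\<beta> - \<alpha> + 1) (commutator_kernel \<theta> F \<alpha> \<beta>)"
proof -
  obtain M :: nat where M: "3 * (\<beta> - \<alpha> + 1) \<le> real M"
    using real_arch_simple by blast
  obtain C where C: "0 \<le> C" "\<And>q r. derivs_bounded M (local_symbol \<theta> F \<alpha> \<beta> q r)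
    (\<lambda>s. C * (wt (- (\<beta> - \<alpha> + 1)) s * decay (r - s) * wt (real M) (s - q)))"
    using local_symbol_derivs_bounded[OF F, of M \<theta> \<alpha> \<beta>] by blast
  show ?thesis
    by (rule smooth_kernel_separably_approximable[OF _ M C(1) _ commutator_kernel_factor
          norm_phase_column measurable_phase_column C(2)]) (use assms in auto)
qed

section \<open>The operators as integral operators\<close>

text \<open>
  A class of functions that contains the Schwartz functions, is stable under all \<^term>\<open>J_power \<gamma>\<close>, and on
  which the strong integral defining \<^term>\<open>U_op \<theta> F\<close> has a continuous integrand.
\<close>

definition continuous_rapid :: "('a::euclidean_space \<Rightarrow> complex) \<Rightarrow> bool" where
  "continuous_rapid f \<longleftrightarrow> continuous_on UNIV f \<and> (\<forall>N. \<exists>C\<ge>0. \<forall>x. norm (f x) \<le> C * wt (- N) x)"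

lemma rapidly_decreasing_imp_continuous_rapid:
  assumes "rapidly_decreasing f" shows "continuous_rapid f"
  unfolding continuous_rapid_def
proof (intro conjI allI)
  show "continuous_on UNIV f" by (rule rapidly_decreasing_imp_continuous[OF assms])
  fix N
  obtain C where "0 \<le> C" "derivs_bounded 0 f (\<lambda>x. C * wt (- N) x)"
    using assms unfolding rapidly_decreasing_def by blast
  then show "\<exists>C\<ge>0. \<forall>x. norm (f x) \<le> C * wt (- N) x" by auto
qed

lemma continuous_rapid_wt_mult:
  assumes "continuous_rapid f" shows "continuous_rapid (\<lambda>x. of_real (wt \<gamma> x) * f x)"
  unfolding continuous_rapid_def
proof (intro conjI allI)
  show "continuous_on UNIV (\<lambda>x. complex_of_real (wt \<gamma> x) * f x)"
    using assms unfolding continuous_rapid_def by (intro continuous_intros) auto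
  fix N
  obtain C where C: "0 \<le> C" "\<And>x. norm (f x) \<le> C * wt (- (N + \<gamma>)) x"
    using assms unfolding continuous_rapid_def by blast
  have "norm (complex_of_real (wt \<gamma> x) * f x) \<le> C * wt (- N) x" for x
  proof -
    have "norm (complex_of_real (wt \<gamma> x) * f x) = wt \<gamma> x * norm (f x)" by (simp add: norm_mult)
    also have "\<dots> \<le> wt \<gamma> x * (C * wt (- (N + \<gamma>)) x)" by (intro mult_left_mono C) simp
    also have "\<dots> = C * wt (\<gamma> + - (N + \<gamma>)) x" unfolding wt_add by simp
    finally show ?thesis by simp
  qed
  with C(1) show "\<exists>C\<ge>0. \<forall>x. norm (complex_of_real (wt \<gamma> x) * f x) \<le> C * wt (- N) x" by blast
qed

lemma continuous_rapid_bound: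
  assumes "continuous_rapid f"
  obtains C where "0 \<le> C" "\<And>x. norm (f x) \<le> C * wt (- N) x"
  using assms unfolding continuous_rapid_def by blast

lemma continuous_rapid_measurable:
  "continuous_rapid f \<Longrightarrow> f \<in> borel_measurable borel"
  unfolding continuous_rapid_def by (auto intro: borel_measurable_continuous_onI)

lemma continuous_rapid_square_integrable:
  fixes f :: "'a::euclidean_space \<Rightarrow> complex"
  assumes f: "continuous_rapid f" shows "square_integrable f"
proof -
  obtain C where C: "0 \<le> C" "\<And>x. norm (f x) \<le> C * wt (- (real DIM('a))) x"
    using continuous_rapid_bound[OF f] by blast
  show ?thesis
  proof (rule square_integrable_bound[OF continuous_rapid_measurable[OF f]])
    show "integrable lborel (\<lambda>x::'a. C\<^sup>2 * decay x)" by (intro integrable_mult_right integrable_decay)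
    have "(norm (f x))\<^sup>2 \<le> C\<^sup>2 * decay x" for x
    proof -
      have "(norm (f x))\<^sup>2 \<le> (C * wt (- (real DIM('a))) x)\<^sup>2" by (intro power_mono C) simp
      also have "\<dots> = C\<^sup>2 * wt (- (real DIM('a)) + - (real DIM('a))) x"
        unfolding wt_add by (simp add: power2_eq_square)
      finally show ?thesis by (simp add: decay_def)
    qed
    then show "AE x in lborel. (norm (f x))\<^sup>2 \<le> C\<^sup>2 * decay x" by simp
  qed
qed

lemma lborel_distr_reflect: "distr lborel borel (\<lambda>x. r - x) = (lborel :: 'a::euclidean_space measure)"
  using lborel_affine_euclidean[where c = "\<lambda>_. -1" and t = r]
  by (simp add: sum_negf euclidean_representation density_1)

lemma integral_lborel_reflect:
  fixes f :: "'a::euclidean_space \<Rightarrow> complex"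
  assumes "f \<in> borel_measurable borel"
  shows "(\<integral>x. f (r - x) \<partial>lborel) = (\<integral>x. f x \<partial>lborel)"
proof -
  have "(\<integral>x. f x \<partial>lborel) = (\<integral>x. f x \<partial>distr lborel borel (\<lambda>x. r - x))"
    by (simp only: lborel_distr_reflect)
  also have "\<dots> = (\<integral>x. f (r - x) \<partial>lborel)"
    by (rule integral_distr) (use assms in auto)
  finally show ?thesis by simp
qed

text \<open>The pointwise form of \<^const>\<open>U_point\<close>.\<close>

definition translate_phase :: "real^'n^'n \<Rightarrow> real^'n \<Rightarrow> (real^'n \<Rightarrow> complex) \<Rightarrow> real^'n \<Rightarrow> complex" where
  "translate_phase \<theta> t f r = exp (- (\<i> / 2) * of_real (t \<bullet> (\<theta> *v r))) * f (r - t)"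

lemma norm_translate_phase: "norm (translate_phase \<theta> t f r) = norm (f (r - t))"
  by (simp add: translate_phase_def norm_mult)

lemma continuous_translate_phase:
  fixes f :: "real^'n \<Rightarrow> complex"
  assumes "continuous_on UNIV f"
  shows "continuous_on UNIV (\<lambda>p. translate_phase \<theta> (fst p) f (snd p))"
proof -
  have "continuous_on UNIV (\<lambda>p::(real^'n) \<times> (real^'n). f (snd p - fst p))"
    by (rule continuous_on_compose2[OF assms]) (intro continuous_intros, simp)
  moreover have "continuous_on UNIV (\<lambda>p::(real^'n) \<times> (real^'n). \<theta> *v snd p)"
    by (intro linear_continuous_on_compose[OF continuous_on_snd[OF continuous_on_id]] matrix_vector_mul_linear)
  ultimately show ?thesis
    unfolding translate_phase_def by (intro continuous_intros)
qed

lemma square_integrable_translate_phase: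
  assumes f: "square_integrable f"
  shows "square_integrable (translate_phase \<theta> t f)"
proof (rule square_integrable_bound)
  have e: "(\<lambda>r. exp (- (\<i> / 2) * of_real (t \<bullet> (\<theta> *v r)))) \<in> borel_measurable borel"
    by (intro borel_measurable_continuous_onI continuous_intros
        linear_continuous_on_compose[OF continuous_on_id] matrix_vector_mul_linear)
  show "translate_phase \<theta> t f \<in> borel_measurable borel"
    unfolding translate_phase_def[abs_def]
    by (rule borel_measurable_times[OF e square_integrable_measurable[OF square_integrable_translation[OF f]]])
  show "integrable lborel (\<lambda>r. (norm (f (r - t)))\<^sup>2)"
    using square_integrable_translation[OF f] by (simp add: square_integrable_def)
qed (simp add: norm_translate_phase)

lemma U_point_l2_class:
  assumes "square_integrable f"
  shows "U_point \<theta> t (l2_class f) = l2_class (translate_phase \<theta> t f)"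
  using assms square_integrable_translate_phase[OF assms, of \<theta> t]
  by transfer (simp add: l2_rel_def translate_phase_def[abs_def])

lemma integral_norm_translate:
  fixes f :: "'a::euclidean_space \<Rightarrow> complex"
  assumes "square_integrable f"
  shows "(\<integral>r. (norm (f (r - t)))\<^sup>2 \<partial>lborel) = (\<integral>r. (norm (f r))\<^sup>2 \<partial>lborel)"
proof -
  note [measurable] = square_integrable_measurable[OF assms]
  have "(\<integral>r. (norm (f r))\<^sup>2 \<partial>lborel) = (\<integral>r. (norm (f r))\<^sup>2 \<partial>distr lborel borel ((+) (- t)))"
    by (simp only: lborel_distr_plus)
  also have "\<dots> = (\<integral>r. (norm (f (- t + r)))\<^sup>2 \<partial>lborel)"
    by (rule integral_distr) auto
  finally show ?thesis by simp
qed

lemma norm_U_integrand: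
  assumes f: "square_integrable f"
  shows "norm (l2_class (\<lambda>r. c * translate_phase \<theta> t f r)) = norm c * norm (l2_class f)"
proof -
  have "(\<integral>r. (norm (c * translate_phase \<theta> t f r))\<^sup>2 \<partial>lborel) = (norm c)\<^sup>2 * (\<integral>r. (norm (f r))\<^sup>2 \<partial>lborel)"
    by (simp add: norm_mult norm_translate_phase power_mult_distrib integral_norm_translate[OF f])
  then show ?thesis
    using f by (simp add: norm_l2_class square_integrable_cmult square_integrable_translate_phase real_sqrt_mult)
qed

text \<open>
  Dominated convergence: for a convergent sequence of translations the translated functions have a common rapidly
  decreasing majorant, again by Peetre's inequality.
\<close>

lemma continuous_U_integrand:
  fixes f F :: "real^'n \<Rightarrow> complex"
  assumes f: "continuous_rapid f" and F: "continuous_on UNIV F"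
  shows "continuous_on UNIV (\<lambda>t. l2_class (\<lambda>r. F t * translate_phase \<theta> t f r))"
  unfolding continuous_on_sequentially
proof (intro allI ballI impI)
  let ?\<psi> = "\<lambda>t r. F t * translate_phase \<theta> t f r"
  fix u :: "nat \<Rightarrow> real^'n" and t
  assume "(\<forall>n. u n \<in> UNIV) \<and> u \<longlonglongrightarrow> t"
  then have u: "u \<longlonglongrightarrow> t" by simp
  define N where "N = real DIM(real^'n)"
  obtain C where C: "0 \<le> C" "\<And>x. norm (f x) \<le> C * wt (- N) x"
    using continuous_rapid_bound[OF f] by blast
  have fc: "continuous_on UNIV f" using f by (simp add: continuous_rapid_def)
  have jc: "continuous_on UNIV (\<lambda>p. ?\<psi> (fst p) (snd p))"
    by (intro continuous_on_mult continuous_translate_phase[OF fc]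
        continuous_on_compose2[OF F continuous_on_fst[OF continuous_on_id]]) simp
  have cr: "continuous_on UNIV (\<lambda>r. ?\<psi> t r)" for t
    using continuous_on_compose2[OF jc, of UNIV "\<lambda>r. (t, r)"] by (simp add: continuous_on_Pair)
  have "(\<lambda>n. F (u n)) \<longlonglongrightarrow> F t"
    using F u by (simp add: continuous_on_sequentially comp_def)
  then have "Bseq (\<lambda>n. F (u n))" by (intro convergent_imp_Bseq convergentI)
  then obtain B1 where "\<forall>n. norm (F (u n)) \<le> B1" by (rule BseqE)
  then have B1: "norm (F (u n)) \<le> B1" for n by simp
  have "Bseq u" using u by (intro convergent_imp_Bseq convergentI)
  then obtain B2 where "0 < B2" "\<forall>n. norm (u n) \<le> B2" by (rule BseqE)
  then have B2: "0 < B2" "norm (u n) \<le> B2" for n by simp_all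
  have B1': "0 \<le> B1" using B1[of 0] norm_ge_zero[of "F (u 0)"] by linarith
  define A where "A = B1 * C * (2 powr (N / 2) * (1 + B2\<^sup>2) powr (N / 2))"
  have "(\<lambda>n. l2_class (\<lambda>r. ?\<psi> (u n) r)) \<longlonglongrightarrow> l2_class (\<lambda>r. ?\<psi> t r)"
  proof (rule l2_class_dominated_convergence(3)[where w = "\<lambda>r. A * wt (- N) r"])
    show "(\<lambda>r. ?\<psi> t r) \<in> borel_measurable borel"
      by (rule borel_measurable_continuous_onI[OF cr])
    show "(\<lambda>r. ?\<psi> (u n) r) \<in> borel_measurable borel" for n
      by (rule borel_measurable_continuous_onI[OF cr])
    have "(A * wt (- N) r)\<^sup>2 = A\<^sup>2 * decay r" for r :: "real^'n"
    proof -
      have "(A * wt (- N) r)\<^sup>2 = A\<^sup>2 * wt (- N + - N) r"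
        unfolding wt_add by (simp add: power2_eq_square)
      then show ?thesis by (simp add: decay_def N_def)
    qed
    then show "integrable lborel (\<lambda>r::real^'n. (A * wt (- N) r)\<^sup>2)"
      using integrable_decay[where ?'a = "real^'n"] by simp
    show "AE r in lborel. (\<lambda>n. ?\<psi> (u n) r) \<longlonglongrightarrow> ?\<psi> t r"
    proof (rule AE_I2)
      fix r :: "real^'n"
      have "(\<lambda>n. (u n, r)) \<longlonglongrightarrow> (t, r)" by (intro tendsto_intros u)
      then show "(\<lambda>n. ?\<psi> (u n) r) \<longlonglongrightarrow> ?\<psi> t r"
        using jc by (auto simp: continuous_on_sequentially comp_def dest!: spec[of _ "\<lambda>n. (u n, r)"])
    qed
    have "norm (?\<psi> (u n) r) \<le> A * wt (- N) r" for n r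
    proof -
      have "norm (f (r - u n)) \<le> C * wt (- N) (r - u n)" by (rule C)
      also have "\<dots> \<le> C * (2 powr (N / 2) * (1 + B2\<^sup>2) powr (N / 2) * wt (- N) r)"
        using wt_near[of "r - u n" r B2 "- N"] B2(2)[of n] C(1) by (intro mult_left_mono) (auto simp: N_def)
      finally have "norm (F (u n)) * norm (f (r - u n)) \<le> B1 * (C * (2 powr (N / 2) * (1 + B2\<^sup>2) powr (N / 2) * wt (- N) r))"
        using B1' by (intro mult_mono B1) auto
      then show ?thesis by (simp add: norm_mult norm_translate_phase A_def mult_ac)
    qed
    then show "AE r in lborel. norm (?\<psi> (u n) r) \<le> A * wt (- N) r" for n
      by simp
  qed
  then show "((\<lambda>t. l2_class (\<lambda>r. ?\<psi> t r)) \<circ> u) \<longlonglongrightarrow> l2_class (\<lambda>r. ?\<psi> t r)"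
    by (simp add: comp_def)
qed

text \<open>
  The left-hand side is a Bochner integral of classes of functions, the right-hand side the class of a pointwise
  integral. Both have the same inner product with every square-integrable \<open>g\<close>, by Fubini's theorem.
\<close>

lemma U_op_eq_kernel_op:
  fixes f F :: "real^'n \<Rightarrow> complex"
  assumes f: "continuous_rapid f" and F: "rapidly_decreasing F"
  shows "U_op \<theta> F (l2_class f) = kernel_op (moyal_kernel \<theta> F) (l2_class f)"
proof -
  let ?\<psi> = "\<lambda>t r. F t * translate_phase \<theta> t f r"
  let ?h = "\<lambda>t. l2_class (\<lambda>r. ?\<psi> t r)"
  let ?G = "\<lambda>r. \<integral>t. ?\<psi> t r \<partial>lborel"
  have sf: "square_integrable f" by (rule continuous_rapid_square_integrable[OF f])
  have fc: "continuous_on UNIV f" using f by (simp add: continuous_rapid_def)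
  have Fc: "continuous_on UNIV F" by (rule rapidly_decreasing_imp_continuous[OF F])
  have fm [measurable]: "f \<in> borel_measurable borel" and Fm [measurable]: "F \<in> borel_measurable borel"
    using fc Fc by (auto intro: borel_measurable_continuous_onI)
  have joint: "(\<lambda>p. ?\<psi> (fst p) (snd p)) \<in> borel_measurable borel"
    by (intro borel_measurable_continuous_onI continuous_on_mult continuous_translate_phase[OF fc]
        continuous_on_compose2[OF Fc continuous_on_fst[OF continuous_on_id]]) simp
  have sh: "square_integrable (\<lambda>r. ?\<psi> t r)" for t
    by (intro square_integrable_cmult square_integrable_translate_phase sf)
  obtain C where C: "0 \<le> C" "\<And>t. norm (F t) \<le> C * decay t"
    using continuous_rapid_bound[OF rapidly_decreasing_imp_continuous_rapid[OF F]]
    unfolding decay_def by blast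
  obtain B where B: "0 \<le> B" "\<And>t. norm (f t) \<le> B"
    using continuous_rapid_bound[OF f, of 0] by auto
  have U: "U_op \<theta> F (l2_class f) = (\<integral>t. ?h t \<partial>lborel)"
    unfolding U_op_def
    by (simp add: U_point_l2_class[OF sf] scaleC_l2_class square_integrable_translate_phase sf)
  have hi: "integrable lborel ?h"
  proof (rule Bochner_Integration.integrable_bound)
    show "integrable lborel (\<lambda>t. C * norm (l2_class f) * decay (t :: real^'n))"
      by (intro integrable_mult_right integrable_decay)
    show "?h \<in> borel_measurable lborel"
      using borel_measurable_continuous_onI[OF continuous_U_integrand[OF f Fc]] by simp
    have "norm (?h t) \<le> C * norm (l2_class f) * decay t" for t
      using mult_right_mono[OF C(2)[of t] norm_ge_zero[of "l2_class f"]]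
      by (simp add: norm_U_integrand[OF sf] mult_ac)
    then show "AE t in lborel. norm (?h t) \<le> norm (C * norm (l2_class f) * decay t)"
      using C(1) by simp
  qed
  have G: "?G r = (\<integral>s. moyal_kernel \<theta> F r s * f s \<partial>lborel)" for r
  proof -
    have m: "(\<lambda>t. ?\<psi> t r) \<in> borel_measurable borel"
      using measurable_compose[OF _ joint, of "\<lambda>t. (t, r)" borel] by simp
    have "(\<integral>s. ?\<psi> (r - s) r \<partial>lborel) = ?G r"
      by (rule integral_lborel_reflect[OF m])
    moreover have "?\<psi> (r - s) r = moyal_kernel \<theta> F r s * f s" for s
      by (simp add: translate_phase_def moyal_kernel_def)
    ultimately show ?thesis by simp
  qed
  obtain c where K: "decaying_kernel c (moyal_kernel \<theta> F)"
    using decaying_moyal_kernel[OF F] by blast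
  have sG: "square_integrable ?G"
    unfolding G by (rule square_integrable_kernel_integral[OF K sf])
  have ti: "integrable lborel (\<lambda>t. ?\<psi> t r)" for r
  proof (rule Bochner_Integration.integrable_bound)
    show "integrable lborel (\<lambda>t. C * B * decay (t :: real^'n))"
      by (intro integrable_mult_right integrable_decay)
    show "(\<lambda>t. ?\<psi> t r) \<in> borel_measurable lborel"
      using measurable_compose[OF _ joint, of "\<lambda>t. (t, r)" borel] by simp
    have "norm (?\<psi> t r) \<le> C * B * decay t" for t
      using mult_mono[OF C(2)[of t] B(2)[of "r - t"]] C(1) by (simp add: norm_mult norm_translate_phase mult_ac)
    then show "AE t in lborel. norm (?\<psi> t r) \<le> norm (C * B * decay t)"
      using C B by simp
  qed
  have "(\<integral>t. ?h t \<partial>lborel) \<bullet> y = l2_class ?G \<bullet> y" for y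
  proof -
    obtain g where g: "square_integrable g" "y = l2_class g" by (rule l2_class_cases)
    note [measurable] = square_integrable_measurable[OF g(1)]
    have g2: "integrable lborel (\<lambda>r. (norm (g r))\<^sup>2)" using g(1) by (simp add: square_integrable_def)
    define \<Phi> where "\<Phi> t r = (?\<psi> t r) \<bullet> g r" for t r
    have [measurable]: "(\<lambda>p. ?\<psi> (fst p) (snd p)) \<in> borel_measurable (borel \<Otimes>\<^sub>M borel)"
      using joint by (simp add: borel_prod)
    have \<Phi>m: "case_prod \<Phi> \<in> borel_measurable (lborel \<Otimes>\<^sub>M lborel)"
      unfolding \<Phi>_def case_prod_unfold by measurable
    \<comment> \<open>an integrable majorant for Fubini, from \<open>2 u v \<le> u\<^sup>2 + v\<^sup>2\<close>\<close>
    define D where "D t r = decay t * ((norm (f (r - t)))\<^sup>2 + (norm (g r))\<^sup>2)" for t r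
    have f2: "integrable lborel (\<lambda>r. (norm (f (r - t)))\<^sup>2)" for t
      using square_integrable_translation[OF sf] by (simp add: square_integrable_def)
    have D: "integrable (lborel \<Otimes>\<^sub>M lborel) (case_prod D)"
    proof (rule lborel_pair.Fubini_integrable)
      show "case_prod D \<in> borel_measurable (lborel \<Otimes>\<^sub>M lborel)"
        unfolding D_def case_prod_unfold by measurable
      have "(\<integral>r. norm (D t r) \<partial>lborel) = decay t * ((\<integral>r. (norm (f r))\<^sup>2 \<partial>lborel) + (\<integral>r. (norm (g r))\<^sup>2 \<partial>lborel))" for t
      proof -
        have "(\<integral>r. norm (D t r) \<partial>lborel) = (\<integral>r. decay t * ((norm (f (r - t)))\<^sup>2 + (norm (g r))\<^sup>2) \<partial>lborel)"
          by (simp add: D_def)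
        also have "\<dots> = decay t * ((\<integral>r. (norm (f (r - t)))\<^sup>2 \<partial>lborel) + (\<integral>r. (norm (g r))\<^sup>2 \<partial>lborel))"
          using f2 g2 by simp
        finally show ?thesis by (simp only: integral_norm_translate[OF sf])
      qed
      then show "integrable lborel (\<lambda>t. \<integral>r. norm (case_prod D (t, r)) \<partial>lborel)"
        by (simp add: integrable_decay)
      show "AE t in lborel. integrable lborel (\<lambda>r. case_prod D (t, r))"
        using f2 g2 by (simp add: D_def)
    qed
    have \<Phi>i: "integrable (lborel \<Otimes>\<^sub>M lborel) (case_prod \<Phi>)"
    proof (rule Bochner_Integration.integrable_bound[OF _ \<Phi>m])
      show "integrable (lborel \<Otimes>\<^sub>M lborel) (\<lambda>p. C * case_prod D p)" using D by simp
      have "norm (\<Phi> t r) \<le> norm (C * D t r)" for t r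
      proof -
        have "norm (\<Phi> t r) \<le> norm (F t) * norm (f (r - t)) * norm (g r)"
          using Cauchy_Schwarz_ineq2[of "?\<psi> t r" "g r"]
          by (simp add: \<Phi>_def norm_mult norm_translate_phase)
        also have "\<dots> = norm (F t) * (norm (f (r - t)) * norm (g r))" by simp
        also have "\<dots> \<le> (C * decay t) * ((norm (f (r - t)))\<^sup>2 + (norm (g r))\<^sup>2)"
        proof (intro mult_mono C)
          show "norm (f (r - t)) * norm (g r) \<le> (norm (f (r - t)))\<^sup>2 + (norm (g r))\<^sup>2"
            using sum_squares_bound[of "norm (f (r - t))" "norm (g r)"]
              mult_nonneg_nonneg[OF norm_ge_zero[of "f (r - t)"] norm_ge_zero[of "g r"]] by linarith
        qed (use C(1) in auto)
        also have "\<dots> = C * D t r" by (simp add: D_def)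
        finally show ?thesis using abs_ge_self[of "C * D t r"] unfolding real_norm_def by linarith
      qed
      then show "AE p in lborel \<Otimes>\<^sub>M lborel. norm (case_prod \<Phi> p) \<le> norm (C * case_prod D p)" by auto
    qed
    have "(\<integral>t. ?h t \<partial>lborel) \<bullet> y = (\<integral>t. ?h t \<bullet> y \<partial>lborel)"
      using hi by simp
    also have "\<dots> = (\<integral>t. (\<integral>r. \<Phi> t r \<partial>lborel) \<partial>lborel)"
      by (simp add: g inner_l2_class sh \<Phi>_def)
    also have "\<dots> = (\<integral>r. (\<integral>t. \<Phi> t r \<partial>lborel) \<partial>lborel)"
      by (rule lborel_pair.Fubini_integral[OF \<Phi>i, symmetric])
    also have "\<dots> = (\<integral>r. ?G r \<bullet> g r \<partial>lborel)"
      unfolding \<Phi>_def using ti by simp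
    also have "\<dots> = l2_class ?G \<bullet> y"
      by (simp add: g inner_l2_class sG)
    finally show ?thesis .
  qed
  then have "(\<integral>t. ?h t \<partial>lborel) = l2_class ?G" using vector_eq_rdot by blast
  then show ?thesis
    unfolding U G by (simp add: kernel_op_l2_class[OF K sf])
qed

lemma J_power_l2_class:
  assumes "square_integrable f" "square_integrable (\<lambda>t. of_real (wt \<alpha> t) * f t)"
  shows "J_power \<alpha> (l2_class f) = l2_class (\<lambda>t. of_real (wt \<alpha> t) * f t)"
  using assms unfolding wt_def by transfer (simp add: l2_rel_def Let_def)

text \<open>
  A finite combination of operators \<open>U(F\<^sub>j)\<close> is again of the form \<open>U(F)\<close>, with
  \<open>F\<close> the same combination of the \<open>F\<^sub>j\<close>.
\<close>

lemma algebra_A_kernel: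
  fixes \<theta> :: "real^'n^'n"
  assumes "x \<in> algebra_A \<theta>"
  shows "\<exists>F. rapidly_decreasing F \<and>
    (\<forall>f. continuous_rapid f \<longrightarrow> x (l2_class f) = kernel_op (moyal_kernel \<theta> F) (l2_class f))"
proof -
  define K where "K = {v. \<theta> *v v = 0}"
  have subK: "subspace K"
    unfolding K_def subspace_def
    by (simp add: matrix_vector_right_distrib scaleR_matrix_vector_assoc matrix_vector_mult_scaleR)
  obtain m :: nat and c f g where x: "x = (\<lambda>\<xi>. \<Sum>j<m. c j *\<^sub>C U_op \<theta> (tensor_along K (f j) (g j)) \<xi>)"
    and fg: "\<forall>j<m. schwartz_on K (f j) \<and> schwartz_on (K\<^sup>\<bottom>) (g j)"
    using assms unfolding algebra_A_def Let_def K_def[symmetric] by blast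
  define F where "F j = tensor_along K (f j) (g j)" for j
  define H where "H t = (\<Sum>j<m. c j * F j t)" for t
  have F: "rapidly_decreasing (F j)" if "j < m" for j
    unfolding F_def using fg that by (intro rapidly_decreasing_tensor_along subK) auto
  have H: "rapidly_decreasing H"
    unfolding H_def by (intro rapidly_decreasing_sum rapidly_decreasing_cmult F) simp
  have "x (l2_class u) = kernel_op (moyal_kernel \<theta> H) (l2_class u)" if u: "continuous_rapid u" for u
  proof -
    let ?V = "\<lambda>j r. \<integral>s. moyal_kernel \<theta> (F j) r s * u s \<partial>lborel"
    have su: "square_integrable u" by (rule continuous_rapid_square_integrable[OF u])
    have K: "\<exists>a. decaying_kernel a (moyal_kernel \<theta> (F j))" if "j < m" for j
      by (rule decaying_moyal_kernel[OF F[OF that]])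
    have sq: "square_integrable (?V j)" if "j < m" for j
      using K[OF that] square_integrable_kernel_integral[OF _ su] by blast
    have int: "integrable lborel (\<lambda>s. moyal_kernel \<theta> (F j) r s * u s)" if "j < m" for j r
      using K[OF that] integrable_kernel[OF _ su] by blast
    obtain b where Hk: "decaying_kernel b (moyal_kernel \<theta> H)"
      using decaying_moyal_kernel[OF H] by blast
    have "x (l2_class u) = (\<Sum>j<m. c j *\<^sub>C l2_class (?V j))"
      unfolding x F_def[symmetric]
    proof (rule sum.cong[OF refl])
      fix j assume "j \<in> {..<m}"
      then have j: "j < m" by simp
      obtain a where "decaying_kernel a (moyal_kernel \<theta> (F j))" using K[OF j] by blast
      then show "c j *\<^sub>C U_op \<theta> (F j) (l2_class u) = c j *\<^sub>C l2_class (?V j)"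
        by (simp add: U_op_eq_kernel_op[OF u F[OF j]] kernel_op_l2_class su)
    qed
    also have "\<dots> = (\<Sum>j<m. l2_class (\<lambda>r. c j * ?V j r))"
      by (intro sum.cong refl scaleC_l2_class sq) simp
    also have "\<dots> = l2_class (\<lambda>r. \<Sum>j<m. c j * ?V j r)"
      by (intro l2_class_sum[symmetric] square_integrable_cmult sq) simp
    also have "(\<lambda>r. \<Sum>j<m. c j * ?V j r)
        = (\<lambda>r. \<integral>s. moyal_kernel \<theta> H r s * u s \<partial>lborel)"
    proof
      fix r
      have "(\<Sum>j<m. c j * ?V j r)
          = (\<integral>s. (\<Sum>j<m. c j * (moyal_kernel \<theta> (F j) r s * u s)) \<partial>lborel)"
        using int by simp
      also have "\<dots> = (\<integral>s. moyal_kernel \<theta> H r s * u s \<partial>lborel)"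
        by (intro Bochner_Integration.integral_cong refl)
           (simp add: moyal_kernel_def H_def sum_distrib_left sum_distrib_right mult_ac)
      finally show "(\<Sum>j<m. c j * ?V j r)
          = (\<integral>s. moyal_kernel \<theta> H r s * u s \<partial>lborel)" .
    qed
    finally show ?thesis by (simp add: kernel_op_l2_class[OF Hk su])
  qed
  with H show ?thesis by blast
qed

text \<open>
  With \<open>f = J^(-\<beta>) \<phi>\<close>, the value of \<open>J^\<alpha> (x f)\<close> is defined by cases and is 0 outside the natural domain of \<open>J^\<alpha>\<close>.
  That \<open>x f\<close> belongs to the domain follows from writing \<open>w^\<alpha>\<close> times \<open>x f\<close> as the sum of \<open>x (J^\<alpha> f)\<close> and the image
  of \<open>\<phi>\<close> under the commutator kernel, both of which are square-integrable.
\<close>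

lemma commutator_on_schwartz:
  fixes \<theta> :: "real^'n^'n"
  assumes F: "rapidly_decreasing F" and le: "\<alpha> \<le> \<beta> + 1"
    and x: "\<And>f. continuous_rapid f \<Longrightarrow> x (l2_class f) = kernel_op (moyal_kernel \<theta> F) (l2_class f)"
    and \<phi>: "schwartz \<phi>"
  shows "kernel_op (commutator_kernel \<theta> F \<alpha> \<beta>) (l2_class \<phi>)
    = (commutator (J_power \<alpha>) x \<circ> J_power (- \<beta>)) (l2_class \<phi>)"
proof -
  let ?k = "moyal_kernel \<theta> F" and ?K = "commutator_kernel \<theta> F \<alpha> \<beta>"
  have \<phi>r: "continuous_rapid \<phi>"
    by (rule rapidly_decreasing_imp_continuous_rapid[OF rapidly_decreasing_schwartz[OF \<phi>]])
  define f where "f t = of_real (wt (- \<beta>) t) * \<phi> t" for t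
  define g where "g t = of_real (wt \<alpha> t) * f t" for t
  have f: "continuous_rapid f" unfolding f_def by (rule continuous_rapid_wt_mult[OF \<phi>r])
  have g: "continuous_rapid g" unfolding g_def by (rule continuous_rapid_wt_mult[OF f])
  note sq = continuous_rapid_square_integrable
  obtain a where k: "decaying_kernel a ?k" using decaying_moyal_kernel[OF F] by blast
  obtain b where K: "decaying_kernel b ?K" using decaying_commutator_kernel[OF F le] by blast
  have J1: "J_power (- \<beta>) (l2_class \<phi>) = l2_class f"
    using J_power_l2_class[of \<phi> "- \<beta>"] sq[OF \<phi>r] sq[OF f] unfolding f_def by simp
  have J2: "J_power \<alpha> (l2_class f) = l2_class g"
    using J_power_l2_class[of f \<alpha>] sq[OF f] sq[OF g] unfolding g_def by simp
  define p where "p r = (\<integral>s. ?k r s * f s \<partial>lborel)" for r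
  define q where "q r = (\<integral>s. ?k r s * g s \<partial>lborel)" for r
  define z where "z r = (\<integral>s. ?K r s * \<phi> s \<partial>lborel)" for r
  have sp: "square_integrable p" and sq': "square_integrable q" and sz: "square_integrable z"
    unfolding p_def q_def z_def
    by (intro square_integrable_kernel_integral[OF k] square_integrable_kernel_integral[OF K] sq f g \<phi>r)+
  have split: "of_real (wt \<alpha> r) * p r = z r + q r" for r
  proof -
    have "z r + q r = (\<integral>s. ?K r s * \<phi> s + ?k r s * g s \<partial>lborel)"
      unfolding z_def q_def
      by (intro Bochner_Integration.integral_add[symmetric] integrable_kernel[OF k] integrable_kernel[OF K] sq g \<phi>r)
    also have "\<dots> = (\<integral>s. of_real (wt \<alpha> r) * (?k r s * f s) \<partial>lborel)"
      by (intro Bochner_Integration.integral_cong refl)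
         (simp add: commutator_kernel_def g_def f_def algebra_simps)
    also have "\<dots> = of_real (wt \<alpha> r) * p r" by (simp add: p_def)
    finally show ?thesis by simp
  qed
  have "J_power \<alpha> (x (l2_class f)) = J_power \<alpha> (l2_class p)"
    by (simp only: x[OF f] kernel_op_l2_class[OF k sq[OF f]] p_def[abs_def])
  also have "\<dots> = l2_class (\<lambda>r. z r + q r)"
    using J_power_l2_class[OF sp, of \<alpha>] square_integrable_add[OF sz sq'] by (simp add: split)
  also have "\<dots> = l2_class z + l2_class q" by (rule l2_class_add[OF sz sq'])
  finally have 1: "J_power \<alpha> (x (l2_class f)) = l2_class z + l2_class q" .
  have 2: "x (J_power \<alpha> (l2_class f)) = l2_class q"
    by (simp only: J2 x[OF g] kernel_op_l2_class[OF k sq[OF g]] q_def[abs_def])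
  have "kernel_op ?K (l2_class \<phi>) = l2_class z"
    by (simp only: kernel_op_l2_class[OF K sq[OF \<phi>r]] z_def[abs_def])
  then show ?thesis
    by (simp add: commutator_def J1 1 2)
qed

section \<open>Commutators with powers of \<open>J\<close>\<close>

theorem theorem1p6:
  fixes \<theta> :: "real^'n^'n" and \<alpha> \<beta> :: real and x :: "(real^'n) l2 \<Rightarrow> (real^'n) l2"
  assumes "CARD('n) \<ge> 2"
    and "transpose \<theta> = - \<theta>"
    and "x \<in> algebra_A \<theta>"
  shows "(\<alpha> < \<beta> + 1 \<longrightarrow>
            has_extension_in (commutator (J_power \<alpha>) x \<circ> J_power (- \<beta>))
              (weak_schatten (real CARD('n) / (\<beta> - \<alpha> + 1)))) \<and>
         (\<alpha> = \<beta> + 1 \<longrightarrow>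
            has_extension_in (commutator (J_power \<alpha>) x \<circ> J_power (- \<beta>))
              {T. bounded_operator T})"
proof -
  from algebra_A_kernel[OF assms(3)] obtain F where F: "rapidly_decreasing F"
    and x: "\<And>f. continuous_rapid f \<Longrightarrow> x (l2_class f) = kernel_op (moyal_kernel \<theta> F) (l2_class f)"
    by blast
  let ?T = "kernel_op (commutator_kernel \<theta> F \<alpha> \<beta>)"
  have ext: "has_extension_in (commutator (J_power \<alpha>) x \<circ> J_power (- \<beta>)) \<I>"
    if "?T \<in> \<I>" "\<alpha> \<le> \<beta> + 1" for \<I>
    unfolding has_extension_in_def
    using that commutator_on_schwartz[OF F that(2) x] by blast
  show ?thesis
  proof (intro conjI impI)
    assume less: "\<alpha> < \<beta> + 1"
    then have le: "\<alpha> \<le> \<beta> + 1" by simp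
    obtain c where K: "decaying_kernel c (commutator_kernel \<theta> F \<alpha> \<beta>)"
      using decaying_commutator_kernel[OF F le] by blast
    have "?T \<in> weak_schatten (real DIM(real^'n) / (\<beta> - \<alpha> + 1))"
      by (rule kernel_op_in_weak_schatten[OF K _ separably_approximable_commutator_kernel[OF F le]])
         (use less in simp)
    then show "has_extension_in (commutator (J_power \<alpha>) x \<circ> J_power (- \<beta>))
        (weak_schatten (real CARD('n) / (\<beta> - \<alpha> + 1)))"
      using le by (intro ext) simp_all
  next
    assume "\<alpha> = \<beta> + 1"
    then have le: "\<alpha> \<le> \<beta> + 1" by simp
    obtain c where K: "decaying_kernel c (commutator_kernel \<theta> F \<alpha> \<beta>)"
      using decaying_commutator_kernel[OF F le] by blast
    show "has_extension_in (commutator (J_power \<alpha>) x \<circ> J_power (- \<beta>)) {T. bounded_operator T}"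
      using bounded_operator_kernel_op[OF K] le by (intro ext) simp_all
  qed
qed

end
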